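(* Consider a general network (described in the context) and $T>0$, and assume that: (i) for all $i\in\mathcal I$ the beam parameters satisfy $\mathbf M_i,\mathbf C_i\in C^1([0,\ell_i];\mathbb S_{++}^6)$, $R_i\in C^2([0,\ell_i];\mathrm{SO}(3))$, the initial data satisfy $(\mathbf p_i^0,\mathbf R_i^0)\in C^2([0,\ell_i];\mathbb R^3\times\mathrm{SO}(3))$, $\mathbf p_i^1,w_i^0\in C^1([0,\ell_i];\mathbb R^3)$, and $$y_i^0=\begin{bmatrix}v_i^0\\ z_i^0\end{bmatrix},\ v_i^0=\begin{bmatrix}(\mathbf R_i^0)^\intercal\mathbf p_i^1\\ (\mathbf R_i^0)^\intercal w_i^0\end{bmatrix},\ z_i^0=\mathbf C_i^{-1}\begin{bmatrix}(\mathbf R_i^0)^\intercal\frac{\mathrm d}{\mathrm dx}\mathbf p_i^0-e_1\\ \mathrm{vec}((\mathbf R_i^0)^\intercal\frac{\mathrm d}{\mathrm dx}\mathbf R_i^0)-\Upsilon_{c,i}\end{bmatrix};$$ (ii) the Neumann data $f_n$, $n\in\mathcal N_M\cup\mathcal N_S^N$, have the form $$f_n=\mathrm{diag}(\mathbf R_{i^n},\mathbf R_{i^n})(\mathbf x_{i^n}^n,\cdot)\,q_n\ (n\in\mathcal N_S^N),\qquad f_n=\mathrm{diag}(\mathbf R_{i^n}R_{i^n}^\intercal,\mathbf R_{i^n}R_{i^n}^\intercal)(\mathbf x_{i^n}^n,\cdot)\,q_n\ (n\in\mathcal N_M)$$ for given $q_n\in C^1([0,T];\mathbb R^6)$; (iii)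 the Dirichlet data satisfy $(f_n^{\mathbf p},f_n^{\mathbf R})\in C^2([0,T];\mathbb R^3\times\mathrm{SO}(3))$, $n\in\mathcal N_S^D$, and $q_n=\begin{bmatrix}(f_n^{\mathbf R})^\intercal\frac{\mathrm d}{\mathrm dt}f_n^{\mathbf p}\\ \mathrm{vec}((f_n^{\mathbf R})^\intercal\frac{\mathrm d}{\mathrm dt}f_n^{\mathbf R})\end{bmatrix}$ for $n\in\mathcal N_S^D$; (iv) $(f_n^{\mathbf p},f_n^{\mathbf R})(0)=(\mathbf p_{i^n}^0,\mathbf R_{i^n}^0)(\mathbf x_{i^n}^n)$ for $n\in\mathcal N_S^D$, and $\mathbf p_i^0(\mathbf x_i^n)=\mathbf p_{i^n}^0(\mathbf x_{i^n}^n)$, $(\mathbf R_i^0R_i^\intercal)(\mathbf x_i^n)=(\mathbf R_{i^n}^0R_{i^n}^\intercal)(\mathbf x_{i^n}^n)$ for $i\in\mathcal I^n$, $n\in\mathcal N_M$. Then, if there exists a unique solution $(y_i)_{i\in\mathcal I}\in\prod_{i=1}^NC^1([0,\ell_i]\times[0,T];\mathbb R^{12})$ to the intrinsic network system (S) with initial and nodal data $y_i^0$ and $q_n$, there exists a unique solution $(\mathbf p_i,\mathbf R_i)_{i\in\mathcal I}\in\prod_{i=1}^NC^2([0,\ell_i]\times[0,T];\mathbb R^3\times\mathrm{SO}(3))$ to the network system (G) with initial data $(\mathbf p_i^0,\mathbf R_i^0,\mathbf p_i^1,w_i^0)$ and nodal data $f_n$, $(f_n^{\mathbf p},f_n^{\mathbf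 R})$, and $(y_i)_{i\in\mathcal I}=\mathcal T_{\mathrm{net}}((\mathbf p_i,\mathbf R_i)_{i\in\mathcal I})$.
   Context: Notation. $\mathbb S_{++}^n$: real symmetric positive definite $n\times n$ matrices. For $u,\zeta\in\mathbb R^3$, $\widehat u\,\zeta=u\times\zeta$ and $\mathrm{vec}(\widehat u)=u$. $e_1=(1,0,0)^\intercal$. Network. $N$ beams indexed by $\mathcal I=\{1,\dots,N\}$ are the edges of an oriented graph with nodes $\mathcal N$. Edge $i$ is identified with $[0,\ell_i]$, $\ell_i>0$; its endpoints $x=0$ and $x=\ell_i$ correspond to two (distinct) nodes. For $n\in\mathcal N$: $\mathcal I^n$ is the set of edges incident with $n$, $i^n=\min\mathcal I^n$; for $i\in\mathcal I^n$, $\mathbf x_i^n\in\{0,\ell_i\}$ is the end of $[0,\ell_i]$ corresponding to $n$, and $\tau_i^n=-1$ if $\mathbf x_i^n=0$, $\tau_i^n=+1$ if $\mathbf x_i^n=\ell_i$. $\mathcal N_S$: simple nodes (one incident edge); $\mathcal N_M$: multiple nodes; $\mathcal N_S=\mathcal N_S^D\cup\mathcal N_S^N$ is a partition. Cycles are allowed. Beam quantities. $\Upsilon_{c,i}=\mathrm{vec}(R_i^\intercal\frac{\mathrm d}{\mathrm dx}R_i)$, $\overline R_i=\mathrm{diag}(R_i,R_i)$, $\mathbf E_i=\begin{bmatrix}\widehat\Upsilon_{c,i}&0\\ \widehat e_1&\widehat\Upsilon_{c,i}\end{bmatrix}$, $Q_i^{\mathcal P}=\mathrm{diag}(\mathbf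 M_i,\mathbf C_i)$, $$A_i=-(Q_i^{\mathcal P})^{-1}\begin{bmatrix}0&\mathbf I_6\\ \mathbf I_6&0\end{bmatrix},\quad \overline B_i=(Q_i^{\mathcal P})^{-1}\begin{bmatrix}0&-\mathbf E_i\\ \mathbf E_i^\intercal&0\end{bmatrix},\quad \overline g_i(x,u)=Q_i^{\mathcal P}(x)^{-1}\mathcal G(u)Q_i^{\mathcal P}(x)u,$$ where for $u=(u_1^\intercal,\dots,u_4^\intercal)^\intercal$, $u_j\in\mathbb R^3$, $\mathcal G(u)=-\begin{bmatrix}\widehat u_2&0&0&\widehat u_3\\ \widehat u_1&\widehat u_2&\widehat u_3&\widehat u_4\\ 0&0&\widehat u_2&\widehat u_1\\ 0&0&0&\widehat u_2\end{bmatrix}.$ Transformation. $\mathcal T_{\mathrm{net}}((\mathbf p_i,\mathbf R_i)_{i\in\mathcal I})=\left(\begin{bmatrix}v_i\\ z_i\end{bmatrix}\right)_{i\in\mathcal I}$ with $$v_i=\begin{bmatrix}\mathbf R_i^\intercal\partial_t\mathbf p_i\\ \mathrm{vec}(\mathbf R_i^\intercal\partial_t\mathbf R_i)\end{bmatrix},\quad z_i=\mathbf C_i^{-1}\begin{bmatrix}\mathbf R_i^\intercal\partial_x\mathbf p_i-e_1\\ \mathrm{vec}(\mathbf R_i^\intercal\partial_x\mathbf R_i)-\Upsilon_{c,i}\end{bmatrix}.\qquad( * )$$ System (S). Unknown $y_i=(v_i^\intercal,z_i^\intercal)^\intercal$, $v_i,z_i\in\mathbb R^6$: $\partial_ty_i+A_i\partial_xy_i+\overline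 B_iy_i=\overline g_i(\cdot,y_i)$ in $(0,\ell_i)\times(0,T)$, $i\in\mathcal I$; $(\overline R_iv_i)(\mathbf x_i^n,t)=(\overline R_{i^n}v_{i^n})(\mathbf x_{i^n}^n,t)$, $i\in\mathcal I^n$, $n\in\mathcal N_M$; $\sum_{i\in\mathcal I^n}\tau_i^n(\overline R_iz_i)(\mathbf x_i^n,t)=q_n(t)$, $n\in\mathcal N_M$; $\tau_{i^n}^nz_{i^n}(\mathbf x_{i^n}^n,t)=q_n(t)$, $n\in\mathcal N_S^N$; $v_{i^n}(\mathbf x_{i^n}^n,t)=q_n(t)$, $n\in\mathcal N_S^D$; $y_i(x,0)=y_i^0(x)$, $i\in\mathcal I$ (nodal conditions for $t\in(0,T)$). System (G). Unknown $(\mathbf p_i,\mathbf R_i)_{i\in\mathcal I}$ with values in $\mathbb R^3\times\mathrm{SO}(3)$. With $v_i,z_i$ as in $( * )$, $W_i=\mathrm{vec}(\mathbf R_i^\intercal\partial_t\mathbf R_i)$, $\begin{bmatrix}\phi_i\\ \psi_i\end{bmatrix}=\mathrm{diag}(\mathbf R_i,\mathbf R_i)z_i$, $\begin{bmatrix}a_i\\ b_i\end{bmatrix}=\mathrm{diag}(\mathbf R_i,\mathbf R_i)\mathbf M_iv_i$: $\partial_ta_i=\partial_x\phi_i$ and $(\partial_t\mathbf p_i)\times a_i+\partial_tb_i=(\partial_x\mathbf p_i)\times\phi_i+\partial_x\psi_i$ in $(0,\ell_i)\times(0,T)$, $i\in\mathcal I$; $\mathbf p_i(\mathbf x_i^n,t)=\mathbf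 p_{i^n}(\mathbf x_{i^n}^n,t)$ and $(\mathbf R_iR_i^\intercal)(\mathbf x_i^n,t)=(\mathbf R_{i^n}R_{i^n}^\intercal)(\mathbf x_{i^n}^n,t)$, $i\in\mathcal I^n$, $n\in\mathcal N_M$ (with $R_i$ depending on $x$ only); $\sum_{i\in\mathcal I^n}\tau_i^n\begin{bmatrix}\phi_i\\ \psi_i\end{bmatrix}(\mathbf x_i^n,t)=f_n(t)$, $n\in\mathcal N_M$; $\tau_{i^n}^n\begin{bmatrix}\phi_{i^n}\\ \psi_{i^n}\end{bmatrix}(\mathbf x_{i^n}^n,t)=f_n(t)$, $n\in\mathcal N_S^N$; $(\mathbf p_{i^n},\mathbf R_{i^n})(\mathbf x_{i^n}^n,t)=(f_n^{\mathbf p},f_n^{\mathbf R})(t)$, $n\in\mathcal N_S^D$; $(\mathbf p_i,\mathbf R_i)(x,0)=(\mathbf p_i^0,\mathbf R_i^0)(x)$ and $(\partial_t\mathbf p_i,\mathbf R_iW_i)(x,0)=(\mathbf p_i^1,w_i^0)(x)$, $i\in\mathcal I$ (nodal conditions for $t\in(0,T)$). *)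

theory Defs
  imports "HOL-Analysis.Analysis" "Graph_Theory.Digraph"
begin

section \<open>Block vectors and block matrices\<close>

text \<open>
  Vectors of \<open>\<real>\<^sup>6\<close> and \<open>\<real>\<^sup>1\<^sup>2\<close> are indexed by the sum types \<open>3 + 3\<close> (six elements) and
  \<open>(3 + 3) + (3 + 3)\<close> (twelve elements), so that the block decompositions are given by the
  two injections of the index type.
\<close>

type_synonym vec3 = "real^3"
type_synonym mat3 = "real^3^3"
type_synonym vec6 = "real^(3 + 3)"
type_synonym mat6 = "real^(3 + 3)^(3 + 3)"
type_synonym vec12 = "real^((3 + 3) + (3 + 3))"
type_synonym mat12 = "real^((3 + 3) + (3 + 3))^((3 + 3) + (3 + 3))"

definition bvec :: "'a^'m::finite \<Rightarrow> 'a^'n::finite \<Rightarrow> 'a^('m + 'n)" where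
  "bvec u v = (\<chi> k. case k of Inl i \<Rightarrow> u $ i | Inr j \<Rightarrow> v $ j)"

definition upper :: "'a^('m::finite + 'n::finite) \<Rightarrow> 'a^'m" where
  "upper w = (\<chi> i. w $ Inl i)"

definition lower :: "'a^('m::finite + 'n::finite) \<Rightarrow> 'a^'n" where
  "lower w = (\<chi> j. w $ Inr j)"

text \<open>\<open>bmat A B C D\<close> has first block row \<open>A B\<close> and second block row \<open>C D\<close>.\<close>

definition bmat ::
    "'a^'c::finite^'r::finite \<Rightarrow> 'a^'d::finite^'r \<Rightarrow> 'a^'c^'s::finite \<Rightarrow> 'a^'d^'s \<Rightarrow> 'a^('c + 'd)^('r + 's)" where
  "bmat A B C D =
     (\<chi> k. case k of Inl i \<Rightarrow> bvec (A $ i) (B $ i) | Inr j \<Rightarrow> bvec (C $ j) (D $ j))"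

definition bdiag :: "'a::zero^'c::finite^'r::finite \<Rightarrow> 'a^'d::finite^'s::finite \<Rightarrow> 'a^('c + 'd)^('r + 's)" where
  "bdiag A D = bmat A 0 0 D"

lemma upper_bvec [simp]: "upper (bvec u v) = u"
  by (simp add: upper_def bvec_def vec_eq_iff)

lemma lower_bvec [simp]: "lower (bvec u v) = v"
  by (simp add: lower_def bvec_def vec_eq_iff)

lemma bmat_mult_bvec:
  fixes A :: "real^'c^'r" and B :: "real^'d^'r" and C :: "real^'c^'s" and D :: "real^'d^'s"
  shows "bmat A B C D *v bvec u v = bvec (A *v u + B *v v) (C *v u + D *v v)"
proof -
  have sum: "(\<Sum>k\<in>UNIV. h k) = (\<Sum>i\<in>UNIV. h (Inl i)) + (\<Sum>j\<in>UNIV. h (Inr j))"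
    for h :: "'c + 'd \<Rightarrow> real"
    by (subst UNIV_Plus_UNIV[symmetric], subst sum.Plus) simp_all
  show ?thesis
    by (simp add: vec_eq_iff bmat_def bvec_def matrix_vector_mult_def sum split: sum.split)
qed


section \<open>The hat operator and symmetric positive definite matrices\<close>

definition hat :: "vec3 \<Rightarrow> mat3" where
  "hat u = matrix (cross3 u)"

text \<open>The inverse of \<open>hat\<close> on skew-symmetric matrices, by its explicit formula.\<close>

definition vee :: "mat3 \<Rightarrow> vec3" where
  "vee S = vector [S $ 3 $ 2, S $ 1 $ 3, S $ 2 $ 1]"

lemma hat_mult: "hat u *v \<zeta> = cross3 u \<zeta>"
  by (simp add: hat_def matrix_def matrix_vector_mult_def cross3_def axis_def vec_eq_iff
      forall_3 sum_3 algebra_simps)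

lemma vee_hat: "vee (hat u) = u"
  by (simp add: vee_def hat_def matrix_def cross3_def axis_def vec_eq_iff forall_3)

lemma hat_vee:
  assumes "transpose S = - S"
  shows "hat (vee S) = S"
proof -
  have eq: "S $ j $ i = - S $ i $ j" for i j
  proof -
    have "transpose S $ i $ j = (- S) $ i $ j"
      by (simp only: assms)
    then show ?thesis
      by (simp add: transpose_def)
  qed
  have diag: "S $ i $ i = 0" for i
    using eq[of i i] by simp
  show ?thesis
    using eq[of 2 1] eq[of 1 3] eq[of 3 2] diag
    by (simp add: vee_def hat_def matrix_def cross3_def axis_def vec_eq_iff forall_3)
qed

definition e1 :: vec3 where
  "e1 = axis 1 1"

definition spd :: "(real^'n^'n) set" where
  "spd = {A. transpose A = A \<and> (\<forall>x. x \<noteq> 0 \<longrightarrow> x \<bullet> (A *v x) > 0)}"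

definition SO3 :: "mat3 set" where
  "SO3 = {A. rotation_matrix A}"


section \<open>Regularity on closed intervals and rectangles; partial derivatives\<close>

text \<open>
  \<open>S\<close> is always a nondegenerate compact interval or rectangle. The derivative relative
  to \<open>S\<close> is then unique; at boundary points it is the one-sided one.
\<close>

definition C1_on :: "'a::real_normed_vector set \<Rightarrow> ('a \<Rightarrow> 'b::real_normed_vector) \<Rightarrow> bool" where
  "C1_on S f \<longleftrightarrow> (\<exists>f' :: 'a \<Rightarrow> 'a \<Rightarrow>\<^sub>L 'b.
      (\<forall>z\<in>S. (f has_derivative blinfun_apply (f' z)) (at z within S)) \<and> continuous_on S f')"

definition C2_on :: "'a::real_normed_vector set \<Rightarrow> ('a \<Rightarrow> 'b::real_normed_vector) \<Rightarrow> bool" where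
  "C2_on S f \<longleftrightarrow> (\<exists>f' :: 'a \<Rightarrow> 'a \<Rightarrow>\<^sub>L 'b.
      (\<forall>z\<in>S. (f has_derivative blinfun_apply (f' z)) (at z within S)) \<and> C1_on S f')"

text \<open>
  \<open>d_on L f\<close> is the derivative on \<open>[0, L]\<close>. Functions of space and time take the pair
  \<open>(x, t)\<close> in \<open>[0, l] \<times> [0, T]\<close>.
\<close>

definition d_on :: "real \<Rightarrow> (real \<Rightarrow> 'b::real_normed_vector) \<Rightarrow> real \<Rightarrow> 'b" where
  "d_on L f s = vector_derivative f (at s within {0..L})"

definition dx :: "real \<Rightarrow> (real \<times> real \<Rightarrow> 'b::real_normed_vector) \<Rightarrow> real \<times> real \<Rightarrow> 'b" where
  "dx l f = (\<lambda>(x, t). d_on l (\<lambda>\<xi>. f (\<xi>, t)) x)"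

definition dt :: "real \<Rightarrow> (real \<times> real \<Rightarrow> 'b::real_normed_vector) \<Rightarrow> real \<times> real \<Rightarrow> 'b" where
  "dt T f = (\<lambda>(x, t). d_on T (\<lambda>s. f (x, s)) t)"


section \<open>Networks of beams\<close>

text \<open>
  The tail of edge \<open>i\<close> is the node at \<open>x = 0\<close>, its head the node at
  \<open>x = edge_len i\<close>. The fields \<open>mass_mat\<close>, \<open>flex_mat\<close>, \<open>ref_rot\<close> are the beam parameters
  \<open>\<^bold>M\<^sub>i\<close>, \<open>\<^bold>C\<^sub>i\<close>, \<open>R\<^sub>i\<close>.
\<close>

record 'v beam_net =
  net_graph :: "('v, nat) pre_digraph"
  dirichlet_nodes :: "'v set"
  edge_len :: "nat \<Rightarrow> real"
  mass_mat :: "nat \<Rightarrow> real \<Rightarrow> mat6"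
  flex_mat :: "nat \<Rightarrow> real \<Rightarrow> mat6"
  ref_rot :: "nat \<Rightarrow> real \<Rightarrow> mat3"

definition edges :: "'v beam_net \<Rightarrow> nat set" where
  "edges \<Gamma> = arcs (net_graph \<Gamma>)"

definition incident :: "'v beam_net \<Rightarrow> 'v \<Rightarrow> nat set" where
  "incident \<Gamma> n = {i \<in> edges \<Gamma>. tail (net_graph \<Gamma>) i = n \<or> head (net_graph \<Gamma>) i = n}"

definition first_edge :: "'v beam_net \<Rightarrow> 'v \<Rightarrow> nat" where
  "first_edge \<Gamma> n = Min (incident \<Gamma> n)"

definition end_pos :: "'v beam_net \<Rightarrow> 'v \<Rightarrow> nat \<Rightarrow> real" where
  "end_pos \<Gamma> n i = (if tail (net_graph \<Gamma>) i = n then 0 else edge_len \<Gamma> i)"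

definition end_sign :: "'v beam_net \<Rightarrow> 'v \<Rightarrow> nat \<Rightarrow> real" where
  "end_sign \<Gamma> n i = (if end_pos \<Gamma> n i = 0 then -1 else 1)"

definition simple_nodes :: "'v beam_net \<Rightarrow> 'v set" where
  "simple_nodes \<Gamma> = {n \<in> verts (net_graph \<Gamma>). card (incident \<Gamma> n) = 1}"

definition multiple_nodes :: "'v beam_net \<Rightarrow> 'v set" where
  "multiple_nodes \<Gamma> = {n \<in> verts (net_graph \<Gamma>). card (incident \<Gamma> n) \<ge> 2}"

definition neumann_nodes :: "'v beam_net \<Rightarrow> 'v set" where
  "neumann_nodes \<Gamma> = simple_nodes \<Gamma> - dirichlet_nodes \<Gamma>"

definition is_beam_network :: "nat \<Rightarrow> 'v beam_net \<Rightarrow> bool" where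
  "is_beam_network N \<Gamma> \<longleftrightarrow>
     fin_digraph (net_graph \<Gamma>) \<and> loopfree_digraph (net_graph \<Gamma>) \<and> edges \<Gamma> = {1..N} \<and>
     (\<forall>i\<in>edges \<Gamma>. 0 < edge_len \<Gamma> i) \<and> dirichlet_nodes \<Gamma> \<subseteq> simple_nodes \<Gamma>"

definition rect :: "'v beam_net \<Rightarrow> real \<Rightarrow> nat \<Rightarrow> (real \<times> real) set" where
  "rect \<Gamma> T i = {0..edge_len \<Gamma> i} \<times> {0..T}"


section \<open>Beam quantities and the transformation of the unknowns\<close>

definition ref_curv :: "'v beam_net \<Rightarrow> nat \<Rightarrow> real \<Rightarrow> vec3" where
  "ref_curv \<Gamma> i x =
     vee (transpose (ref_rot \<Gamma> i x) ** d_on (edge_len \<Gamma> i) (ref_rot \<Gamma> i) x)"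

definition Rbar :: "'v beam_net \<Rightarrow> nat \<Rightarrow> real \<Rightarrow> mat6" where
  "Rbar \<Gamma> i x = bdiag (ref_rot \<Gamma> i x) (ref_rot \<Gamma> i x)"

definition Emat :: "'v beam_net \<Rightarrow> nat \<Rightarrow> real \<Rightarrow> mat6" where
  "Emat \<Gamma> i x = bmat (hat (ref_curv \<Gamma> i x)) 0 (hat e1) (hat (ref_curv \<Gamma> i x))"

definition Qmat :: "'v beam_net \<Rightarrow> nat \<Rightarrow> real \<Rightarrow> mat12" where
  "Qmat \<Gamma> i x = bdiag (mass_mat \<Gamma> i x) (flex_mat \<Gamma> i x)"

definition Amat :: "'v beam_net \<Rightarrow> nat \<Rightarrow> real \<Rightarrow> mat12" where
  "Amat \<Gamma> i x = - (matrix_inv (Qmat \<Gamma> i x) ** bmat 0 (mat 1) (mat 1) 0)"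

definition Bmat :: "'v beam_net \<Rightarrow> nat \<Rightarrow> real \<Rightarrow> mat12" where
  "Bmat \<Gamma> i x =
     matrix_inv (Qmat \<Gamma> i x) ** bmat 0 (- Emat \<Gamma> i x) (transpose (Emat \<Gamma> i x)) 0"

definition Gmat :: "vec12 \<Rightarrow> mat12" where
  "Gmat u =
     (let h1 = hat (upper (upper u)); h2 = hat (lower (upper u));
          h3 = hat (upper (lower u)); h4 = hat (lower (lower u))
      in - bmat (bmat h2 0  h1 h2) (bmat 0 h3  h3 h4)
                0                  (bmat h2 h1  0 h2))"

definition gfun :: "'v beam_net \<Rightarrow> nat \<Rightarrow> real \<Rightarrow> vec12 \<Rightarrow> vec12" where
  "gfun \<Gamma> i x u =
     (matrix_inv (Qmat \<Gamma> i x) ** Gmat u ** Qmat \<Gamma> i x) *v u"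

definition angvel :: "real \<Rightarrow> (real \<times> real \<Rightarrow> mat3) \<Rightarrow> real \<times> real \<Rightarrow> vec3" where
  "angvel T R z = vee (transpose (R z) ** dt T R z)"

definition vel ::
    "real \<Rightarrow> (real \<times> real \<Rightarrow> vec3) \<Rightarrow> (real \<times> real \<Rightarrow> mat3) \<Rightarrow> real \<times> real \<Rightarrow> vec6" where
  "vel T p R z = bvec (transpose (R z) *v dt T p z) (angvel T R z)"

definition stress :: "'v beam_net \<Rightarrow> nat \<Rightarrow>
    (real \<times> real \<Rightarrow> vec3) \<Rightarrow> (real \<times> real \<Rightarrow> mat3) \<Rightarrow> real \<times> real \<Rightarrow> vec6" where
  "stress \<Gamma> i p R z =
     matrix_inv (flex_mat \<Gamma> i (fst z)) *v
       bvec (transpose (R z) *v dx (edge_len \<Gamma> i) p z - e1)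
            (vee (transpose (R z) ** dx (edge_len \<Gamma> i) R z) - ref_curv \<Gamma> i (fst z))"

definition Tnet :: "'v beam_net \<Rightarrow> real \<Rightarrow> (nat \<Rightarrow> real \<times> real \<Rightarrow> vec3) \<Rightarrow>
    (nat \<Rightarrow> real \<times> real \<Rightarrow> mat3) \<Rightarrow> nat \<Rightarrow> real \<times> real \<Rightarrow> vec12" where
  "Tnet \<Gamma> T p R i z = bvec (vel T (p i) (R i) z) (stress \<Gamma> i (p i) (R i) z)"


section \<open>The intrinsic network system\<close>

text \<open>For \<open>y = (v, z)\<close>, the parts \<open>v\<close> and \<open>z\<close> are \<open>upper y\<close> and \<open>lower y\<close>.\<close>

definition solves_intrinsic ::
    "'v beam_net \<Rightarrow> real \<Rightarrow> ('v \<Rightarrow> real \<Rightarrow> vec6) \<Rightarrow> (nat \<Rightarrow> real \<Rightarrow> vec12) \<Rightarrow>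
     (nat \<Rightarrow> real \<times> real \<Rightarrow> vec12) \<Rightarrow> bool" where
  "solves_intrinsic \<Gamma> T q y0 y \<longleftrightarrow>
     (\<forall>i\<in>edges \<Gamma>. C1_on (rect \<Gamma> T i) (y i)) \<and>
     (\<forall>i\<in>edges \<Gamma>. \<forall>x\<in>{0<..<edge_len \<Gamma> i}. \<forall>t\<in>{0<..<T}.
        dt T (y i) (x, t) + Amat \<Gamma> i x *v dx (edge_len \<Gamma> i) (y i) (x, t)
          + Bmat \<Gamma> i x *v y i (x, t) = gfun \<Gamma> i x (y i (x, t))) \<and>
     (\<forall>n\<in>multiple_nodes \<Gamma>. \<forall>i\<in>incident \<Gamma> n. \<forall>t\<in>{0<..<T}.
        let k = first_edge \<Gamma> n in
        Rbar \<Gamma> i (end_pos \<Gamma> n i) *v upper (y i (end_pos \<Gamma> n i, t))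
          = Rbar \<Gamma> k (end_pos \<Gamma> n k) *v upper (y k (end_pos \<Gamma> n k, t))) \<and>
     (\<forall>n\<in>multiple_nodes \<Gamma>. \<forall>t\<in>{0<..<T}.
        (\<Sum>i\<in>incident \<Gamma> n. end_sign \<Gamma> n i *\<^sub>R
           (Rbar \<Gamma> i (end_pos \<Gamma> n i) *v lower (y i (end_pos \<Gamma> n i, t)))) = q n t) \<and>
     (\<forall>n\<in>neumann_nodes \<Gamma>. \<forall>t\<in>{0<..<T}.
        let k = first_edge \<Gamma> n in
        end_sign \<Gamma> n k *\<^sub>R lower (y k (end_pos \<Gamma> n k, t)) = q n t) \<and>
     (\<forall>n\<in>dirichlet_nodes \<Gamma>. \<forall>t\<in>{0<..<T}.
        let k = first_edge \<Gamma> n in upper (y k (end_pos \<Gamma> n k, t)) = q n t) \<and>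
     (\<forall>i\<in>edges \<Gamma>. \<forall>x\<in>{0..edge_len \<Gamma> i}. y i (x, 0) = y0 i x)"


section \<open>The geometrically exact network system\<close>

text \<open>
  \<open>(\<phi>, \<psi>)\<close> is \<open>forces\<close> and \<open>(a, b)\<close> is \<open>momenta\<close>.
\<close>

definition forces :: "'v beam_net \<Rightarrow> nat \<Rightarrow>
    (real \<times> real \<Rightarrow> vec3) \<Rightarrow> (real \<times> real \<Rightarrow> mat3) \<Rightarrow> real \<times> real \<Rightarrow> vec6" where
  "forces \<Gamma> i p R z = bdiag (R z) (R z) *v stress \<Gamma> i p R z"

definition momenta :: "'v beam_net \<Rightarrow> real \<Rightarrow> nat \<Rightarrow>
    (real \<times> real \<Rightarrow> vec3) \<Rightarrow> (real \<times> real \<Rightarrow> mat3) \<Rightarrow> real \<times> real \<Rightarrow> vec6" where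
  "momenta \<Gamma> T i p R z =
     (bdiag (R z) (R z) ** mass_mat \<Gamma> i (fst z)) *v vel T p R z"

text \<open>
  The Neumann data \<open>f\<close> may depend on the unknown rotations (follower loads), so it takes
  the whole family \<open>R\<close> as an argument.
\<close>

definition solves_geb ::
    "'v beam_net \<Rightarrow> real \<Rightarrow>
     ((nat \<Rightarrow> real \<times> real \<Rightarrow> mat3) \<Rightarrow> 'v \<Rightarrow> real \<Rightarrow> vec6) \<Rightarrow>
     ('v \<Rightarrow> real \<Rightarrow> vec3) \<Rightarrow> ('v \<Rightarrow> real \<Rightarrow> mat3) \<Rightarrow>
     (nat \<Rightarrow> real \<Rightarrow> vec3) \<Rightarrow> (nat \<Rightarrow> real \<Rightarrow> mat3) \<Rightarrow>
     (nat \<Rightarrow> real \<Rightarrow> vec3) \<Rightarrow> (nat \<Rightarrow> real \<Rightarrow> vec3) \<Rightarrow>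
     (nat \<Rightarrow> real \<times> real \<Rightarrow> vec3) \<Rightarrow> (nat \<Rightarrow> real \<times> real \<Rightarrow> mat3) \<Rightarrow> bool" where
  "solves_geb \<Gamma> T f fp fR p0 R0 p1 w0 p R \<longleftrightarrow>
     (\<forall>i\<in>edges \<Gamma>. C2_on (rect \<Gamma> T i) (p i) \<and> C2_on (rect \<Gamma> T i) (R i) \<and>
        R i ` rect \<Gamma> T i \<subseteq> SO3) \<and>
     (\<forall>i\<in>edges \<Gamma>. \<forall>x\<in>{0<..<edge_len \<Gamma> i}. \<forall>t\<in>{0<..<T}.
        let l = edge_len \<Gamma> i;
            \<phi> = (\<lambda>z. upper (forces \<Gamma> i (p i) (R i) z));
            \<psi> = (\<lambda>z. lower (forces \<Gamma> i (p i) (R i) z));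
            a = (\<lambda>z. upper (momenta \<Gamma> T i (p i) (R i) z));
            b = (\<lambda>z. lower (momenta \<Gamma> T i (p i) (R i) z))
        in dt T a (x, t) = dx l \<phi> (x, t) \<and>
           cross3 (dt T (p i) (x, t)) (a (x, t)) + dt T b (x, t)
             = cross3 (dx l (p i) (x, t)) (\<phi> (x, t)) + dx l \<psi> (x, t)) \<and>
     (\<forall>n\<in>multiple_nodes \<Gamma>. \<forall>i\<in>incident \<Gamma> n. \<forall>t\<in>{0<..<T}.
        let k = first_edge \<Gamma> n; xi = end_pos \<Gamma> n i; xk = end_pos \<Gamma> n k in
        p i (xi, t) = p k (xk, t) \<and>
        R i (xi, t) ** transpose (ref_rot \<Gamma> i xi) = R k (xk, t) ** transpose (ref_rot \<Gamma> k xk)) \<and>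
     (\<forall>n\<in>multiple_nodes \<Gamma>. \<forall>t\<in>{0<..<T}.
        (\<Sum>i\<in>incident \<Gamma> n. end_sign \<Gamma> n i *\<^sub>R
           forces \<Gamma> i (p i) (R i) (end_pos \<Gamma> n i, t)) = f R n t) \<and>
     (\<forall>n\<in>neumann_nodes \<Gamma>. \<forall>t\<in>{0<..<T}.
        let k = first_edge \<Gamma> n in
        end_sign \<Gamma> n k *\<^sub>R forces \<Gamma> k (p k) (R k) (end_pos \<Gamma> n k, t) = f R n t) \<and>
     (\<forall>n\<in>dirichlet_nodes \<Gamma>. \<forall>t\<in>{0<..<T}.
        let k = first_edge \<Gamma> n in
        p k (end_pos \<Gamma> n k, t) = fp n t \<and> R k (end_pos \<Gamma> n k, t) = fR n t) \<and>
     (\<forall>i\<in>edges \<Gamma>. \<forall>x\<in>{0..edge_len \<Gamma> i}.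
        p i (x, 0) = p0 i x \<and> R i (x, 0) = R0 i x \<and>
        dt T (p i) (x, 0) = p1 i x \<and> R i (x, 0) *v angvel T (R i) (x, 0) = w0 i x)"

end

theory Submission
  imports Defs
begin

text \<open>
  In terms of the rigid motions \<open>u = (p, R)\<close>, the velocity \<open>v\<close> and the strain
  \<open>k = \<^bold>C z + (e\<^sub>1, \<Upsilon>\<^sub>c)\<close> are the left-invariant logarithmic derivatives of \<open>u\<close> in \<open>t\<close> and \<open>x\<close>:
  \<open>\<partial>\<^sub>t u = u v\<close> and \<open>\<partial>\<^sub>x u = u k\<close>. The last six equations of the intrinsic system are the
  zero-curvature condition \<open>\<partial>\<^sub>t k = \<partial>\<^sub>x v + [k, v]\<close>, hence exactly the condition under which
  \<open>u\<close> can be recovered from \<open>(v, k)\<close> and the initial data; the first six equations are the balance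
  of momentum written in the moving frame. At a node the rigid motions of the beams, rotated by the
  reference frames, solve the same linear equation \<open>u' = u c\<close> in time as soon as the
  velocities agree, so that continuity of velocities and of positions are equivalent given the
  compatibility at \<open>t = 0\<close>. Uniqueness of \<open>u\<close> is uniqueness for \<open>\<partial>\<^sub>t u = u v\<close>, since \<open>v\<close> is
  determined by the uniqueness assumption on the intrinsic system.
\<close>


section \<open>Continuously differentiable functions\<close>

text \<open>Regularity shapes the proof. Velocity and strain are only C^1 on a closed rectangle,
  with one-sided derivatives at its boundary, and the equations hold in the interior. Integrability
  is therefore extended to the boundary by continuity and proved directly:
  \<open>\<partial>\<^sub>t u = u v\<close> is solved for each fixed \<open>x\<close>, and a
  Gronwall estimate yields the derivative in \<open>x\<close>. Time is the direction of integration
  because \<open>u\<close> is prescribed at \<open>t = 0\<close> on every edge; edges are treated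
  one by one, and cycles of the graph impose no closing condition. The equivalence of the two
  systems is stated for every family of beams with the prescribed initial shape, because it is
  applied twice: to the motions recovered from \<open>y\<close>, for existence, and to a competing
  solution, whose transform thereby solves the intrinsic system and must be \<open>y\<close>. The
  second use needs a C^1 transform, hence a C^1 inverse of the flexibility matrix. Force balance at
  a multiple node is transferred only after continuity of the rotations, which supplies the common
  frame in which forces are added.\<close>

lemma C1_onI:
  fixes f :: "'a::euclidean_space \<Rightarrow> 'b::real_normed_vector"
  assumes der: "\<And>z. z \<in> S \<Longrightarrow> (f has_derivative D z) (at z within S)"
    and cont: "\<And>h. continuous_on S (\<lambda>z. D z h)"
  shows "C1_on S f"
  unfolding C1_on_def
proof (intro exI conjI ballI)
  have bl: "bounded_linear (D z)" if "z \<in> S" for z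
    using der[OF that] by (rule has_derivative_bounded_linear)
  show "(f has_derivative blinfun_apply (Blinfun (D z))) (at z within S)" if "z \<in> S" for z
    using der[OF that] bl[OF that] by (simp add: bounded_linear_Blinfun_apply)
  \<comment> \<open>The domain is finite-dimensional, so continuity in operator norm reduces to
    continuity of the derivative along each basis vector.\<close>
  show "continuous_on S (\<lambda>z. Blinfun (D z))"
  proof (rule continuous_on_blinfun_componentwise)
    fix i :: 'a
    show "continuous_on S (\<lambda>z. Blinfun (D z) i)"
      using cont[of i] by (rule continuous_on_eq) (simp add: bl bounded_linear_Blinfun_apply)
  qed
qed

lemma C1_onE:
  assumes "C1_on S f"
  obtains D where "\<And>z. z \<in> S \<Longrightarrow> (f has_derivative D z) (at z within S)"
    and "\<And>h. continuous_on S (\<lambda>z. D z h)"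
proof -
  obtain f' where f': "\<forall>z\<in>S. (f has_derivative blinfun_apply (f' z)) (at z within S)"
    "continuous_on S f'"
    using assms unfolding C1_on_def by blast
  show thesis
  proof (rule that)
    show "\<And>z. z \<in> S \<Longrightarrow> (f has_derivative blinfun_apply (f' z)) (at z within S)"
      using f'(1) by blast
    show "\<And>h. continuous_on S (\<lambda>z. blinfun_apply (f' z) h)"
      by (intro continuous_intros f'(2))
  qed
qed

lemma C1_on_imp_continuous_on: "C1_on S f \<Longrightarrow> continuous_on S f"
  unfolding C1_on_def continuous_on_eq_continuous_within by (blast dest: has_derivative_continuous)

lemma C1_on_cong:
  assumes "C1_on S f" "\<And>z. z \<in> S \<Longrightarrow> g z = f z"
  shows "C1_on S g"
proof -
  have "(g has_derivative D) (at z within S)" if "z \<in> S" "(f has_derivative D) (at z within S)" for z D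
    using that(1) assms(2) that(2) by (rule has_derivative_transform)
  then show ?thesis
    using assms(1) unfolding C1_on_def by blast
qed

lemma C1_on_const [simp]: "C1_on S (\<lambda>z. c)"
  unfolding C1_on_def by (rule exI[of _ "\<lambda>_. 0"]) (simp add: zero_blinfun.rep_eq)

lemma C1_on_if: "C1_on S f \<Longrightarrow> C1_on S g \<Longrightarrow> C1_on S (\<lambda>z. if P then f z else g z)"
  by (cases P) simp_all

lemma C1_on_bounded_linear:
  fixes f :: "'a::euclidean_space \<Rightarrow> 'b::real_normed_vector"
  assumes "bounded_linear g" "C1_on S f"
  shows "C1_on S (\<lambda>z. g (f z))"
proof -
  obtain D where D: "\<And>z. z \<in> S \<Longrightarrow> (f has_derivative D z) (at z within S)"
    "\<And>h. continuous_on S (\<lambda>z. D z h)"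
    using C1_onE[OF assms(2)] by blast
  show ?thesis
    by (rule C1_onI[where D = "\<lambda>z h. g (D z h)"])
      (use D in \<open>auto intro!: bounded_linear.has_derivative[OF assms(1)]
        bounded_linear.continuous_on[OF assms(1)]\<close>)
qed

lemma C1_on_bounded_bilinear:
  fixes f :: "'a::euclidean_space \<Rightarrow> 'b::real_normed_vector"
  assumes "bounded_bilinear pr" "C1_on S f" "C1_on S g"
  shows "C1_on S (\<lambda>z. pr (f z) (g z))"
proof -
  interpret bounded_bilinear pr by fact
  obtain D where D: "\<And>z. z \<in> S \<Longrightarrow> (f has_derivative D z) (at z within S)"
    "\<And>h. continuous_on S (\<lambda>z. D z h)"
    using C1_onE[OF assms(2)] by blast
  obtain E where E: "\<And>z. z \<in> S \<Longrightarrow> (g has_derivative E z) (at z within S)"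
    "\<And>h. continuous_on S (\<lambda>z. E z h)"
    using C1_onE[OF assms(3)] by blast
  show ?thesis
    by (rule C1_onI[where D = "\<lambda>z h. pr (f z) (E z h) + pr (D z h) (g z)"])
      (use D E assms(2,3)[THEN C1_on_imp_continuous_on] in
        \<open>auto intro!: FDERIV continuous_on continuous_on_add\<close>)
qed

lemma C1_on_Pair:
  fixes f :: "'a::euclidean_space \<Rightarrow> 'b::real_normed_vector"
  assumes "C1_on S f" "C1_on S g"
  shows "C1_on S (\<lambda>z. (f z, g z))"
proof -
  obtain D where D: "\<And>z. z \<in> S \<Longrightarrow> (f has_derivative D z) (at z within S)"
    "\<And>h. continuous_on S (\<lambda>z. D z h)"
    using C1_onE[OF assms(1)] by blast
  obtain E where E: "\<And>z. z \<in> S \<Longrightarrow> (g has_derivative E z) (at z within S)"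
    "\<And>h. continuous_on S (\<lambda>z. E z h)"
    using C1_onE[OF assms(2)] by blast
  show ?thesis
    by (rule C1_onI[where D = "\<lambda>z h. (D z h, E z h)"])
      (use D E in \<open>auto intro!: has_derivative_Pair continuous_intros\<close>)
qed

lemma C1_on_add:
  fixes f :: "'a::euclidean_space \<Rightarrow> 'b::real_normed_vector"
  assumes "C1_on S f" "C1_on S g"
  shows "C1_on S (\<lambda>z. f z + g z)"
  using C1_on_bounded_linear[OF bounded_linear_add[OF bounded_linear_fst bounded_linear_snd]
    C1_on_Pair[OF assms]] by simp

lemma C1_on_diff:
  fixes f :: "'a::euclidean_space \<Rightarrow> 'b::real_normed_vector"
  assumes "C1_on S f" "C1_on S g"
  shows "C1_on S (\<lambda>z. f z - g z)"
  using C1_on_bounded_linear[OF bounded_linear_sub[OF bounded_linear_fst bounded_linear_snd]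
    C1_on_Pair[OF assms]] by simp

lemma C1_on_sum:
  fixes f :: "'i \<Rightarrow> 'a::euclidean_space \<Rightarrow> 'b::real_normed_vector"
  assumes "\<And>i. i \<in> I \<Longrightarrow> C1_on S (f i)"
  shows "C1_on S (\<lambda>z. \<Sum>i\<in>I. f i z)"
  using assms by (induction I rule: infinite_finite_induct) (auto intro!: C1_on_add)

lemma C1_on_mult:
  fixes f g :: "'a::euclidean_space \<Rightarrow> real"
  assumes "C1_on S f" "C1_on S g"
  shows "C1_on S (\<lambda>z. f z * g z)"
  using C1_on_bounded_bilinear[OF bounded_bilinear_mult assms] .

lemma C1_on_prod:
  fixes f :: "'i \<Rightarrow> 'a::euclidean_space \<Rightarrow> real"
  assumes "\<And>i. i \<in> I \<Longrightarrow> C1_on S (f i)"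
  shows "C1_on S (\<lambda>z. \<Prod>i\<in>I. f i z)"
  using assms by (induction I rule: infinite_finite_induct) (auto intro!: C1_on_mult)

lemma C1_on_inverse:
  fixes f :: "'a::euclidean_space \<Rightarrow> real"
  assumes "C1_on S f" and nz: "\<And>z. z \<in> S \<Longrightarrow> f z \<noteq> 0"
  shows "C1_on S (\<lambda>z. inverse (f z))"
proof -
  obtain D where D: "\<And>z. z \<in> S \<Longrightarrow> (f has_derivative D z) (at z within S)"
    "\<And>h. continuous_on S (\<lambda>z. D z h)"
    using C1_onE[OF assms(1)] by blast
  show ?thesis
    by (rule C1_onI[where D = "\<lambda>z h. - (inverse (f z) * D z h * inverse (f z))"])
      (use D nz assms(1)[THEN C1_on_imp_continuous_on] in
        \<open>auto intro!: Deriv.has_derivative_inverse continuous_on_minus continuous_on_mult continuous_on_inverse\<close>)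
qed

lemma C1_on_vec_lambda:
  fixes f :: "'a::euclidean_space \<Rightarrow> 'n::finite \<Rightarrow> 'b::euclidean_space"
  assumes "\<And>i. C1_on S (\<lambda>z. f z i)"
  shows "C1_on S (\<lambda>z. \<chi> i. f z i)"
proof -
  have "linear (axis i :: 'b \<Rightarrow> 'b^'n)" for i
    by (rule linearI) (simp_all add: axis_def vec_eq_iff)
  then have "C1_on S (\<lambda>z. axis i (f z i) :: 'b^'n)" for i
    by (intro C1_on_bounded_linear[OF _ assms]) (simp add: linear_conv_bounded_linear)
  then have "C1_on S (\<lambda>z. \<Sum>i\<in>UNIV. axis i (f z i) :: 'b^'n)"
    by (rule C1_on_sum)
  then show ?thesis
    by (rule C1_on_cong) (simp add: vec_eq_iff axis_def)
qed

lemma C1_on_vec_nth: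
  fixes f :: "'a::euclidean_space \<Rightarrow> ('b::real_normed_vector)^'n::finite"
  assumes "C1_on S f"
  shows "C1_on S (\<lambda>z. f z $ i)"
  using C1_on_bounded_linear[OF bounded_linear_vec_nth assms] .

lemma C1_on_det:
  fixes A :: "'a::euclidean_space \<Rightarrow> real^'n^'n"
  assumes "C1_on S A"
  shows "C1_on S (\<lambda>z. det (A z))"
  unfolding det_def
  by (intro C1_on_sum C1_on_mult C1_on_prod C1_on_const C1_on_vec_nth assms)

section \<open>The inverse of a differentiable matrix function\<close>

lemma matrix_inv_mult:
  fixes A :: "real^'n^'n"
  assumes "invertible A"
  shows "A ** matrix_inv A = mat 1" "matrix_inv A ** A = mat 1"
  using someI_ex[OF assms[unfolded invertible_def]] unfolding matrix_inv_def by auto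

text \<open>The \<open>j\<close>-th column of the inverse solves \<open>A x = axis j 1\<close>, and
  Cramer's rule expresses it by determinants. The inverse is thereby rational in the entries of
  \<open>A\<close>, so its C^1 dependence follows from sums, products and reciprocals.\<close>

lemma matrix_inv_cramer:
  fixes A :: "real^'n^'n"
  assumes "det A \<noteq> 0"
  shows "matrix_inv A =
    (\<chi> k j. det (\<chi> i l. if l = k then axis j 1 $ i else A $ i $ l) * inverse (det A))"
proof -
  have inv: "invertible A" using assms by (simp add: invertible_det_nz)
  have "matrix_inv A *v axis j 1 =
      (\<chi> k. det (\<chi> i l. if l = k then axis j 1 $ i else A $ i $ l) / det A)" for j
  proof (subst cramer[OF assms, symmetric])
    show "A *v (matrix_inv A *v axis j 1) = axis j 1"
      using inv by (simp add: matrix_vector_mul_assoc matrix_inv_mult)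
  qed
  then show ?thesis
    by (simp add: vec_eq_iff matrix_vector_mul_component field_simps matrix_vector_mult_basis column_def)
qed

lemma C1_on_matrix_inv:
  fixes A :: "'a::euclidean_space \<Rightarrow> real^'n^'n"
  assumes A: "C1_on S A" and nz: "\<And>z. z \<in> S \<Longrightarrow> det (A z) \<noteq> 0"
  shows "C1_on S (\<lambda>z. matrix_inv (A z))"
proof (rule C1_on_cong)
  show "C1_on S (\<lambda>z. \<chi> k j. det (\<chi> i l. if l = k then axis j 1 $ i else A z $ i $ l) * inverse (det (A z)))"
    by (intro C1_on_vec_lambda C1_on_mult C1_on_inverse C1_on_det A nz, assumption?)
      (auto simp: if_distrib if_distribR intro!: C1_on_if C1_on_vec_nth A)
qed (simp add: matrix_inv_cramer nz)

text \<open>Lifts a coefficient that depends on \<open>x\<close> alone, such as the flexibility or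
  the reference curvature, to the space-time rectangle.\<close>

lemma C1_on_fst:
  fixes f :: "'a::euclidean_space \<Rightarrow> 'b::real_normed_vector"
  assumes "C1_on A f"
  shows "C1_on (A \<times> B) (\<lambda>z :: 'a \<times> 'c::euclidean_space. f (fst z))"
proof -
  obtain D where D: "\<And>z. z \<in> A \<Longrightarrow> (f has_derivative D z) (at z within A)"
    "\<And>h. continuous_on A (\<lambda>z. D z h)"
    using C1_onE[OF assms(1)] by blast
  show ?thesis
  proof (rule C1_onI[where D = "\<lambda>z h. D (fst z) (fst h)"])
    fix z :: "'a \<times> 'c" assume z: "z \<in> A \<times> B"
    show "((\<lambda>z. f (fst z)) has_derivative (\<lambda>h. D (fst z) (fst h))) (at z within A \<times> B)"
    proof (rule has_derivative_in_compose2[where t = A and g' = D])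
      show "(fst has_derivative fst) (at z within A \<times> B)"
        by (intro bounded_linear_imp_has_derivative bounded_linear_fst)
    qed (use z D in auto)
  next
    fix h :: "'a \<times> 'c"
    show "continuous_on (A \<times> B) (\<lambda>z. D (fst z) (fst h))"
      by (rule continuous_on_compose2[OF D(2)]) (auto intro!: continuous_intros)
  qed
qed

lemma C2_on_imp_C1_on: "C2_on S f \<Longrightarrow> C1_on S f"
  unfolding C2_on_def C1_on_def[of S f] using C1_on_imp_continuous_on by blast


section \<open>Partial derivatives on rectangles\<close>

lemma d_on_eqI:
  assumes "(f has_vector_derivative d) (at s within {0..L})" "0 < L" "s \<in> {0..L}"
  shows "d_on L f s = d"
  using assms vector_derivative_within_cbox[of 0 L s f d] by (simp add: d_on_def)

lemma C1_on_d_on: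
  fixes f :: "real \<Rightarrow> 'b::real_normed_vector"
  assumes "C1_on {0..L} f" "0 < L"
  shows "\<And>s. s \<in> {0..L} \<Longrightarrow> (f has_vector_derivative d_on L f s) (at s within {0..L})"
    and "continuous_on {0..L} (d_on L f)"
proof -
  obtain D where D: "\<And>z. z \<in> {0..L} \<Longrightarrow> (f has_derivative D z) (at z within {0..L})"
    "\<And>h. continuous_on {0..L} (\<lambda>z. D z h)"
    using C1_onE[OF assms(1)] by blast
  have *: "(f has_vector_derivative D s 1) (at s within {0..L})" if "s \<in> {0..L}" for s
  proof -
    have "D s = (\<lambda>h. h *\<^sub>R D s 1)"
      by (rule ext) (metis has_derivative_linear[OF D(1)[OF that]] linear_scale mult.right_neutral
          real_scaleR_def)
    then show ?thesis
      using D(1)[OF that] unfolding has_vector_derivative_def by simp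
  qed
  have eq: "d_on L f s = D s 1" if "s \<in> {0..L}" for s
    using *[OF that] assms(2) that by (rule d_on_eqI)
  show "(f has_vector_derivative d_on L f s) (at s within {0..L})" if "s \<in> {0..L}" for s
    using *[OF that] eq[OF that] by simp
  show "continuous_on {0..L} (d_on L f)"
    using D(2)[of 1] by (rule continuous_on_eq) (simp add: eq)
qed

lemma C2_on_d_on:
  fixes f :: "real \<Rightarrow> 'b::real_normed_vector"
  assumes "C2_on {0..L} f" "0 < L"
  shows "C1_on {0..L} (d_on L f)"
proof -
  obtain f' where f': "\<forall>z\<in>{0..L}. (f has_derivative blinfun_apply (f' z)) (at z within {0..L})"
    "C1_on {0..L} f'"
    using assms(1) unfolding C2_on_def by blast
  have "blinfun_apply (f' s) = (\<lambda>h. h *\<^sub>R f' s 1)" for s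
    by (simp add: fun_eq_iff flip: blinfun.scaleR_right)
  then have "(f has_vector_derivative f' s 1) (at s within {0..L})" if "s \<in> {0..L}" for s
    using f'(1) that unfolding has_vector_derivative_def by metis
  then have "d_on L f s = f' s 1" if "s \<in> {0..L}" for s
    using assms(2) that by (intro d_on_eqI) auto
  moreover have "C1_on {0..L} (\<lambda>s. f' s 1)"
    by (rule C1_on_bounded_linear[OF _ f'(2)]) (auto intro!: bounded_linear_intros)
  ultimately show ?thesis
    by (rule C1_on_cong[rotated]) auto
qed

text \<open>Total differentiability with gradient \<open>(a, b)\<close>, in space and time
  respectively, rather than mere existence of the two partial derivatives. The derivatives are kept
  as named functions, so that equations such as \<open>\<partial>\<^sub>x u = u k\<close>,
  \<open>\<partial>\<^sub>t u = u v\<close> become a single statement.\<close>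

definition has_partials :: "(real \<times> real) set \<Rightarrow> (real \<times> real \<Rightarrow> 'b::real_normed_vector) \<Rightarrow>
    (real \<times> real \<Rightarrow> 'b) \<Rightarrow> (real \<times> real \<Rightarrow> 'b) \<Rightarrow> bool" where
  "has_partials S f a b \<longleftrightarrow>
     (\<forall>z\<in>S. (f has_derivative (\<lambda>h. fst h *\<^sub>R a z + snd h *\<^sub>R b z)) (at z within S))"

lemma has_partials_cong:
  assumes "has_partials S f a b"
    and "\<And>z. z \<in> S \<Longrightarrow> f' z = f z" "\<And>z. z \<in> S \<Longrightarrow> a' z = a z" "\<And>z. z \<in> S \<Longrightarrow> b' z = b z"
  shows "has_partials S f' a' b'"
  unfolding has_partials_def
proof
  fix z assume z: "z \<in> S"
  then have "(f has_derivative (\<lambda>h. fst h *\<^sub>R a' z + snd h *\<^sub>R b' z)) (at z within S)"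
    using assms by (simp add: has_partials_def)
  then show "(f' has_derivative (\<lambda>h. fst h *\<^sub>R a' z + snd h *\<^sub>R b' z)) (at z within S)"
    using z assms(2) by (rule has_derivative_transform[rotated 2])
qed

lemma has_partials_slice:
  assumes "has_partials (A \<times> B) f a b" "x \<in> A" "t \<in> B"
  shows "((\<lambda>\<xi>. f (\<xi>, t)) has_vector_derivative a (x, t)) (at x within A)"
    and "((\<lambda>s. f (x, s)) has_vector_derivative b (x, t)) (at t within B)"
proof -
  have D: "(f has_derivative (\<lambda>h. fst h *\<^sub>R a (x, t) + snd h *\<^sub>R b (x, t))) (at (x, t) within A \<times> B)"
    using assms by (auto simp: has_partials_def)
  show "((\<lambda>\<xi>. f (\<xi>, t)) has_vector_derivative a (x, t)) (at x within A)"
    unfolding has_vector_derivative_def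
    by (rule has_derivative_eq_rhs,
        rule has_derivative_in_compose[where f = "\<lambda>\<xi>. (\<xi>, t)"],
        auto intro!: derivative_eq_intros has_derivative_subset[OF D] simp: assms)
  show "((\<lambda>s. f (x, s)) has_vector_derivative b (x, t)) (at t within B)"
    unfolding has_vector_derivative_def
    by (rule has_derivative_eq_rhs,
        rule has_derivative_in_compose[where f = "\<lambda>s. (x, s)"],
        auto intro!: derivative_eq_intros has_derivative_subset[OF D] simp: assms)
qed

context
  fixes l T :: real
  assumes l: "0 < l" and T: "0 < T"
begin

lemma has_partials_dx_dt:
  assumes "has_partials ({0..l} \<times> {0..T}) f a b" "z \<in> {0..l} \<times> {0..T}"
  shows "dx l f z = a z" "dt T f z = b z"
  using has_partials_slice[OF assms(1), of "fst z" "snd z"] assms(2) l T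
  by (auto simp: dx_def dt_def intro!: d_on_eqI)

lemma C1_on_partials:
  assumes "C1_on ({0..l} \<times> {0..T}) f"
  shows "has_partials ({0..l} \<times> {0..T}) f (dx l f) (dt T f)"
    and "continuous_on ({0..l} \<times> {0..T}) (dx l f)"
    and "continuous_on ({0..l} \<times> {0..T}) (dt T f)"
proof -
  let ?S = "{0..l} \<times> {0..T}"
  obtain D where D: "\<And>z. z \<in> ?S \<Longrightarrow> (f has_derivative D z) (at z within ?S)"
    "\<And>h. continuous_on ?S (\<lambda>z. D z h)"
    using C1_onE[OF assms(1)] by blast
  have "D z = (\<lambda>h. fst h *\<^sub>R D z (1, 0) + snd h *\<^sub>R D z (0, 1))" if "z \<in> ?S" for z
  proof
    fix h :: "real \<times> real"
    interpret linear "D z" using D(1)[OF that] by (rule has_derivative_linear)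
    have "h = fst h *\<^sub>R (1, 0) + snd h *\<^sub>R (0, 1)"
      by (cases h) auto
    then show "D z h = fst h *\<^sub>R D z (1, 0) + snd h *\<^sub>R D z (0, 1)"
      using add[of "fst h *\<^sub>R (1, 0)" "snd h *\<^sub>R (0, 1)"] scale[of "fst h" "(1, 0)"]
        scale[of "snd h" "(0, 1)"] by simp
  qed
  then have P: "has_partials ?S f (\<lambda>z. D z (1, 0)) (\<lambda>z. D z (0, 1))"
    unfolding has_partials_def using D(1) by simp
  note eq = has_partials_dx_dt[OF P]
  show "has_partials ?S f (dx l f) (dt T f)"
    using P by (rule has_partials_cong) (auto simp: eq)
  show "continuous_on ?S (dx l f)" "continuous_on ?S (dt T f)"
    using D(2)[of "(1, 0)"] D(2)[of "(0, 1)"] by (auto intro: continuous_on_eq simp: eq)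
qed

lemma C2_on_partials:
  assumes "C2_on ({0..l} \<times> {0..T}) f"
  shows "C1_on ({0..l} \<times> {0..T}) (dx l f)" "C1_on ({0..l} \<times> {0..T}) (dt T f)"
proof -
  let ?S = "{0..l} \<times> {0..T}"
  obtain f' where f': "\<forall>z\<in>?S. (f has_derivative blinfun_apply (f' z)) (at z within ?S)"
    "C1_on ?S f'"
    using assms unfolding C2_on_def by blast
  have P: "has_partials ?S f (\<lambda>z. f' z (1, 0)) (\<lambda>z. f' z (0, 1))"
    unfolding has_partials_def
  proof
    fix z assume z: "z \<in> ?S"
    have "blinfun_apply (f' z) = (\<lambda>h. fst h *\<^sub>R f' z (1, 0) + snd h *\<^sub>R f' z (0, 1))"
      by (simp add: fun_eq_iff flip: blinfun.scaleR_right blinfun.add_right)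
    then show "(f has_derivative (\<lambda>h. fst h *\<^sub>R f' z (1, 0) + snd h *\<^sub>R f' z (0, 1))) (at z within ?S)"
      using has_derivative_eq_rhs[OF bspec[OF f'(1) z]] by blast
  qed
  have "C1_on ?S (\<lambda>z. f' z h)" for h
    by (rule C1_on_bounded_linear[OF _ f'(2)]) (auto intro!: bounded_linear_intros)
  from this[THEN C1_on_cong] show "C1_on ?S (dx l f)" "C1_on ?S (dt T f)"
    by (simp_all add: has_partials_dx_dt[OF P])
qed

end

lemma has_partials_C1_on:
  assumes "has_partials S f a b" "continuous_on S a" "continuous_on S b"
  shows "C1_on S f"
  by (rule C1_onI[where D = "\<lambda>z h. fst h *\<^sub>R a z + snd h *\<^sub>R b z"])
    (use assms in \<open>auto simp: has_partials_def intro!: continuous_intros\<close>)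

text \<open>The derivative as an operator is a fixed linear expression in \<open>a\<close> and
  \<open>b\<close>, built with the two coordinate projections, so it inherits C^1 from them.\<close>

lemma has_partials_C2_on:
  fixes a :: "real \<times> real \<Rightarrow> 'a::real_normed_vector"
  assumes "has_partials S f a b" "C1_on S a" "C1_on S b"
  shows "C2_on S f"
  unfolding C2_on_def
proof (intro exI conjI ballI)
  let ?D = "\<lambda>z. (blinfun_scaleR_left (a z) o\<^sub>L fst_blinfun) + (blinfun_scaleR_left (b z) o\<^sub>L snd_blinfun)"
  show "(f has_derivative blinfun_apply (?D z)) (at z within S)" if "z \<in> S" for z
    using assms(1) that by (simp add: has_partials_def plus_blinfun.rep_eq)
  have 1: "bounded_linear (\<lambda>x. blinfun_scaleR_left x o\<^sub>L fst_blinfun :: (real \<times> real) \<Rightarrow>\<^sub>L 'a)"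
    "bounded_linear (\<lambda>x. blinfun_scaleR_left x o\<^sub>L snd_blinfun :: (real \<times> real) \<Rightarrow>\<^sub>L 'a)"
    by (auto intro!: bounded_linear_intros)
  show "C1_on S ?D"
    by (intro C1_on_add C1_on_bounded_linear[OF 1(1)] C1_on_bounded_linear[OF 1(2)] assms)
qed

lemma has_partials_Pair:
  assumes "has_partials S f a b" "has_partials S g c d"
  shows "has_partials S (\<lambda>z. (f z, g z)) (\<lambda>z. (a z, c z)) (\<lambda>z. (b z, d z))"
  using assms by (auto simp: has_partials_def intro!: derivative_eq_intros)

lemma has_partials_bounded_linear:
  assumes "bounded_linear g" "has_partials S f a b"
  shows "has_partials S (\<lambda>z. g (f z)) (\<lambda>z. g (a z)) (\<lambda>z. g (b z))"
proof -
  interpret bounded_linear g by fact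
  show ?thesis
    using assms(2) unfolding has_partials_def
    by (auto simp: add scaleR dest!: bspec has_derivative)
qed

lemma has_partials_bounded_bilinear:
  assumes "bounded_bilinear pr" "has_partials S f a b" "has_partials S g c d"
  shows "has_partials S (\<lambda>z. pr (f z) (g z)) (\<lambda>z. pr (f z) (c z) + pr (a z) (g z))
    (\<lambda>z. pr (f z) (d z) + pr (b z) (g z))"
proof -
  interpret bounded_bilinear pr by fact
  show ?thesis
    using assms(2,3) unfolding has_partials_def
    by (auto intro!: has_derivative_eq_rhs[OF FDERIV]
        simp: add_left add_right scaleR_left scaleR_right algebra_simps fun_eq_iff)
qed


section \<open>Linear differential equations with bilinear right-hand side\<close>

text \<open>The squared norm is used because the norm itself need not be differentiable at zeros. By
  \<open>2 |w| e \<le> |w|^2 + e^2\<close> the derivative of \<open>|w|^2\<close> is at most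
  \<open>(2 M + 1) |w|^2 + e^2\<close>, whence the exponent; the factor \<open>1 + T\<close>
  collects \<open>e^2\<close> from the initial value and \<open>e^2 t\<close> from the
  inhomogeneity.\<close>

lemma gronwall_sq:
  fixes w :: "real \<Rightarrow> 'e::real_inner"
  assumes cont: "continuous_on {0..T} w"
    and der: "\<And>t. 0 < t \<Longrightarrow> t < T \<Longrightarrow> (w has_vector_derivative w' t) (at t)"
    and bound: "\<And>t. 0 < t \<Longrightarrow> t < T \<Longrightarrow> norm (w' t) \<le> M * norm (w t) + e"
    and M: "0 \<le> M" and e: "0 \<le> e" and init: "norm (w 0) \<le> e" and t: "t \<in> {0..T}"
  shows "(norm (w t))\<^sup>2 \<le> e\<^sup>2 * ((1 + T) * exp ((2 * M + 1) * T))"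
proof -
  define c where "c = 2 * M + 1"
  have c: "0 \<le> c" using M by (simp add: c_def)
  \<comment> \<open>Nonincreasing by the differential inequality: the weight absorbs
    \<open>c |w|^2\<close>, and the linear term absorbs the remaining \<open>e^2\<close>, since the
    weight is at most 1.\<close>
  define \<phi> where "\<phi> s = exp (- (c * s)) * (w s \<bullet> w s) - e\<^sup>2 * s" for s
  have "\<phi> t \<le> \<phi> 0"
  proof (rule DERIV_nonpos_imp_decreasing_open[where f = \<phi> and a = 0 and b = t])
    show "0 \<le> t" using t by simp
    show "continuous_on {0..t} \<phi>"
      unfolding \<phi>_def
      by (intro continuous_intros continuous_on_subset[OF cont]) (use t in auto)
    fix s assume s: "0 < s" "s < t"
    then have s': "s < T" using t by simp
    note d = der[OF s(1) s', unfolded has_vector_derivative_def]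
    have "(\<phi> has_real_derivative (exp (- (c * s)) * (2 * (w s \<bullet> w' s) - c * (w s \<bullet> w s)) - e\<^sup>2)) (at s)"
      unfolding \<phi>_def has_field_derivative_def
      by (rule derivative_eq_intros d refl | simp add: fun_eq_iff algebra_simps inner_commute)+
    moreover have "exp (- (c * s)) * (2 * (w s \<bullet> w' s) - c * (w s \<bullet> w s)) - e\<^sup>2 \<le> 0"
    proof -
      have "w s \<bullet> w' s \<le> norm (w s) * norm (w' s)"
        by (rule norm_cauchy_schwarz)
      also have "\<dots> \<le> norm (w s) * (M * norm (w s) + e)"
        by (intro mult_left_mono bound s s') simp
      finally have "2 * (w s \<bullet> w' s) \<le> 2 * M * (norm (w s))\<^sup>2 + 2 * norm (w s) * e"
        by (simp add: power2_eq_square algebra_simps)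
      moreover have "2 * norm (w s) * e \<le> (norm (w s))\<^sup>2 + e\<^sup>2"
        by (rule sum_squares_bound)
      ultimately have "2 * (w s \<bullet> w' s) - c * (w s \<bullet> w s) \<le> e\<^sup>2"
        by (simp add: c_def dot_square_norm algebra_simps)
      then have "exp (- (c * s)) * (2 * (w s \<bullet> w' s) - c * (w s \<bullet> w s)) \<le> exp (- (c * s)) * e\<^sup>2"
        by (intro mult_left_mono) auto
      also have "\<dots> \<le> 1 * e\<^sup>2"
        using c s by (intro mult_right_mono) auto
      finally show ?thesis by simp
    qed
    ultimately show "\<exists>y. (\<phi> has_real_derivative y) (at s) \<and> y \<le> 0" by blast
  qed
  also have "\<phi> 0 \<le> e\<^sup>2"
    using init by (simp add: \<phi>_def dot_square_norm power_mono)
  finally have "exp (- (c * t)) * (norm (w t))\<^sup>2 \<le> e\<^sup>2 * (1 + t)"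
    by (simp add: \<phi>_def dot_square_norm algebra_simps)
  then have "exp (c * t) * (exp (- (c * t)) * (norm (w t))\<^sup>2) \<le> exp (c * t) * (e\<^sup>2 * (1 + t))"
    by (intro mult_left_mono) auto
  then have "(norm (w t))\<^sup>2 \<le> e\<^sup>2 * ((1 + t) * exp (c * t))"
    by (simp add: mult.assoc[symmetric] exp_add[symmetric]) (simp add: algebra_simps)
  also have "\<dots> \<le> e\<^sup>2 * ((1 + T) * exp (c * T))"
    using t c by (intro mult_left_mono mult_mono) (auto intro!: mult_left_mono)
  finally show ?thesis by (simp add: c_def)
qed

text \<open>The bound is proportional to \<open>e\<close>, which controls initial value and
  inhomogeneity together: \<open>e = 0\<close> gives uniqueness, and \<open>e\<close> a small
  multiple of an increment gives differentiability in a parameter.\<close>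

lemma gronwall:
  fixes w :: "real \<Rightarrow> 'e::real_inner"
  assumes "continuous_on {0..T} w"
    and "\<And>t. 0 < t \<Longrightarrow> t < T \<Longrightarrow> (w has_vector_derivative w' t) (at t)"
    and "\<And>t. 0 < t \<Longrightarrow> t < T \<Longrightarrow> norm (w' t) \<le> M * norm (w t) + e"
    and "0 \<le> M" and e: "0 \<le> e" and "norm (w 0) \<le> e" and "t \<in> {0..T}"
  shows "norm (w t) \<le> e * sqrt ((1 + T) * exp ((2 * M + 1) * T))"
  using real_sqrt_le_mono[OF gronwall_sq[OF assms]] e by (simp add: real_sqrt_mult)

lemma linear_ode_unique:
  fixes pr :: "'e::real_inner \<Rightarrow> 'f::real_normed_vector \<Rightarrow> 'e"
  assumes pr: "bounded_bilinear pr" and c: "continuous_on {0..T} c"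
    and u: "continuous_on {0..T} u"
      "\<And>t. 0 < t \<Longrightarrow> t < T \<Longrightarrow> (u has_vector_derivative pr (u t) (c t)) (at t)"
    and v: "continuous_on {0..T} v"
      "\<And>t. 0 < t \<Longrightarrow> t < T \<Longrightarrow> (v has_vector_derivative pr (v t) (c t)) (at t)"
    and init: "u 0 = v 0" and t: "t \<in> {0..T}"
  shows "u t = v t"
proof -
  interpret bounded_bilinear pr by fact
  obtain K where K: "0 < K" "\<And>a b. norm (pr a b) \<le> norm a * norm b * K"
    using pos_bounded by blast
  have "bounded (c ` {0..T})"
    by (intro compact_imp_bounded compact_continuous_image c) simp
  then obtain C where C: "0 < C" "\<And>t. t \<in> {0..T} \<Longrightarrow> norm (c t) \<le> C"
    unfolding bounded_pos by auto
  have "norm (u t - v t) \<le> 0 * sqrt ((1 + T) * exp ((2 * (C * K) + 1) * T))"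
  proof (rule gronwall[where w = "\<lambda>t. u t - v t" and w' = "\<lambda>t. pr (u t - v t) (c t)"])
    show "continuous_on {0..T} (\<lambda>t. u t - v t)"
      by (intro continuous_intros u v)
    fix t assume t: "0 < t" "t < T"
    show "((\<lambda>t. u t - v t) has_vector_derivative pr (u t - v t) (c t)) (at t)"
      unfolding diff_left by (intro has_vector_derivative_diff u v t)
    have "norm (pr (u t - v t) (c t)) \<le> norm (u t - v t) * norm (c t) * K"
      by (rule K)
    also have "\<dots> \<le> norm (u t - v t) * C * K"
      using t K by (intro mult_right_mono mult_left_mono C) auto
    finally show "norm (pr (u t - v t) (c t)) \<le> C * K * norm (u t - v t) + 0"
      by (simp add: mult_ac)
  qed (use C K init t in auto)
  then show ?thesis by simp
qed

text \<open>Picard's fixed point in an exponentially weighted norm. For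
  \<open>w t = exp (- \<mu> t) u t\<close>, with \<open>\<mu>\<close> twice the bound
  \<open>m\<close> of the coefficient, the integral operator contracts by
  \<open>m / \<mu> = 1/2\<close> on all of \<open>[0, T]\<close>, so no local solutions have to be
  glued.\<close>

lemma linear_ode_exists:
  fixes pr :: "'e::banach \<Rightarrow> 'f::real_normed_vector \<Rightarrow> 'e"
  assumes pr: "bounded_bilinear pr" and c: "continuous_on {0..T} c" and T: "0 \<le> T"
  obtains u where "u 0 = u0"
    "\<And>t. t \<in> {0..T} \<Longrightarrow> (u has_vector_derivative pr (u t) (c t)) (at t within {0..T})"
proof -
  interpret bounded_bilinear pr by fact
  obtain K where K: "0 < K" "\<And>a b. norm (pr a b) \<le> norm a * norm b * K"
    using pos_bounded by blast
  have "bounded (c ` {0..T})"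
    by (intro compact_imp_bounded compact_continuous_image c) simp
  then obtain C where C: "0 < C" "\<And>t. t \<in> {0..T} \<Longrightarrow> norm (c t) \<le> C"
    unfolding bounded_pos by auto
  define m where "m = C * K"
  have m: "0 < m" using C K by (simp add: m_def)
  have prm: "norm (pr a (c t)) \<le> m * norm a" if "t \<in> {0..T}" for a t
  proof -
    have "norm (pr a (c t)) \<le> norm a * norm (c t) * K" by (rule K)
    also have "\<dots> \<le> norm a * C * K"
      using that K by (intro mult_right_mono mult_left_mono C) auto
    finally show ?thesis by (simp add: m_def mult_ac)
  qed
  define \<mu> where "\<mu> = 2 * m"
  have \<mu>: "0 < \<mu>" using m by (simp add: \<mu>_def)
  define I where "I w r = exp (\<mu> * r) *\<^sub>R pr (w r) (c r)" for w r
  define G where "G w t = exp (- (\<mu> * t)) *\<^sub>R (u0 + integral {0..t} (I w))" for w t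
  \<comment> \<open>Clamping the time extends functions on \<open>[0, T]\<close> to bounded
    continuous functions on the line, a complete space to which the contraction principle
    applies.\<close>
  define cl where "cl t = max 0 (min T t)" for t
  have cl: "cl t \<in> {0..T}" for t using T by (auto simp: cl_def)
  have cl_id: "cl t = t" if "t \<in> {0..T}" for t using that by (auto simp: cl_def)
  have contI: "continuous_on {0..T} (I w)" if "continuous_on {0..T} w" for w
    unfolding I_def by (intro continuous_intros continuous_on that c)
  have contG: "continuous_on {0..T} (G w)" if "continuous_on {0..T} w" for w
    unfolding G_def
    by (intro continuous_intros indefinite_integral_continuous_1 integrable_continuous_real
        contI that)
  have bc: "(\<lambda>t. G w (cl t)) \<in> bcontfun" if "continuous_on {0..T} w" for w
  proof -
    have "continuous_on UNIV (\<lambda>t. G w (cl t))"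
      by (rule continuous_on_compose2[OF contG[OF that]])
        (auto simp: cl_def T intro!: continuous_intros)
    moreover have "bounded (G w ` {0..T})"
      by (intro compact_imp_bounded compact_continuous_image contG that) simp
    then have "bounded (range (\<lambda>t. G w (cl t)))"
      by (rule bounded_subset) (use cl in auto)
    ultimately show ?thesis by (simp add: bcontfun_def)
  qed
  define \<Phi> where "\<Phi> w = Bcontfun (\<lambda>t. G (apply_bcontfun w) (cl t))" for w
  have \<Phi>: "apply_bcontfun (\<Phi> w) t = G (apply_bcontfun w) (cl t)" for w t
    unfolding \<Phi>_def by (subst Bcontfun_inverse) (auto intro!: bc)
  have contr: "dist (\<Phi> w) (\<Phi> w') \<le> 1 / 2 * dist w w'" for w w'
  proof (rule dist_bound)
    fix x
    define t where "t = cl x"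
    have t: "t \<in> {0..T}" using cl by (simp add: t_def)
    have int: "I (apply_bcontfun w) integrable_on {0..t}" for w
      by (intro integrable_continuous_real continuous_on_subset[OF contI]) (use t in auto)
    have "((\<lambda>r. m * dist w w' * exp (\<mu> * r)) has_integral
        (m * dist w w' / \<mu> * exp (\<mu> * t) - m * dist w w' / \<mu> * exp (\<mu> * 0))) {0..t}"
      using t \<mu>
      by (intro fundamental_theorem_of_calculus)
        (auto intro!: derivative_eq_intros simp flip: has_real_derivative_iff_has_vector_derivative)
    note ex = this
    have "norm (integral {0..t} (\<lambda>r. I (apply_bcontfun w) r - I (apply_bcontfun w') r)) \<le>
        integral {0..t} (\<lambda>r. m * dist w w' * exp (\<mu> * r))"
    proof (rule integral_norm_bound_integral)
      fix r assume r: "r \<in> {0..t}"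
      have "norm (I (apply_bcontfun w) r - I (apply_bcontfun w') r) =
          exp (\<mu> * r) * norm (pr (apply_bcontfun w r - apply_bcontfun w' r) (c r))"
        by (simp add: I_def diff_left flip: scaleR_diff_right)
      also have "\<dots> \<le> exp (\<mu> * r) * (m * norm (apply_bcontfun w r - apply_bcontfun w' r))"
        using r t by (intro mult_left_mono prm) auto
      also have "\<dots> \<le> exp (\<mu> * r) * (m * dist w w')"
        using m dist_bounded[of w r w'] by (intro mult_left_mono) (auto simp: dist_norm)
      finally show "norm (I (apply_bcontfun w) r - I (apply_bcontfun w') r) \<le> m * dist w w' * exp (\<mu> * r)"
        by (simp add: mult_ac)
    qed (use ex int in \<open>auto intro!: integrable_diff\<close>)
    also have "\<dots> = m * dist w w' / \<mu> * (exp (\<mu> * t) - 1)"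
      unfolding integral_unique[OF ex] by (simp add: algebra_simps diff_divide_distrib)
    also have "\<dots> = dist w w' / 2 * (exp (\<mu> * t) - 1)"
      using m by (simp add: \<mu>_def)
    also have "\<dots> \<le> dist w w' / 2 * exp (\<mu> * t)"
      by (intro mult_left_mono) auto
    finally have B: "norm (integral {0..t} (I (apply_bcontfun w)) - integral {0..t} (I (apply_bcontfun w')))
        \<le> dist w w' / 2 * exp (\<mu> * t)"
      using int by (simp add: integral_diff)
    have "dist (apply_bcontfun (\<Phi> w) x) (apply_bcontfun (\<Phi> w') x) =
        exp (- (\<mu> * t)) * norm (integral {0..t} (I (apply_bcontfun w)) - integral {0..t} (I (apply_bcontfun w')))"
      by (simp add: \<Phi> G_def dist_norm t_def[symmetric] flip: scaleR_diff_right)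
    also have "\<dots> \<le> exp (- (\<mu> * t)) * (dist w w' / 2 * exp (\<mu> * t))"
      by (intro mult_left_mono B) auto
    also have "\<dots> = 1 / 2 * dist w w'"
      by (simp add: exp_minus field_simps)
    finally show "dist (apply_bcontfun (\<Phi> w) x) (apply_bcontfun (\<Phi> w') x) \<le> 1 / 2 * dist w w'" .
  qed
  obtain w where w: "\<Phi> w = w"
    using banach_fix_type[of "1 / 2" \<Phi>] contr by auto
  define W where "W = apply_bcontfun w"
  define u where "u t = u0 + integral {0..t} (I W)" for t
  have W: "W t = exp (- (\<mu> * t)) *\<^sub>R u t" if "t \<in> {0..T}" for t
    using \<Phi>[of w t] that by (simp add: w cl_id G_def W_def u_def)
  have IW: "I W t = pr (u t) (c t)" if "t \<in> {0..T}" for t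
    by (simp add: I_def W[OF that] scaleR_left flip: exp_add)
  show thesis
  proof (rule that)
    show "u 0 = u0" by (simp add: u_def)
    fix t assume t: "t \<in> {0..T}"
    have "continuous_on {0..T} (I W)" by (rule contI) (simp add: W_def)
    from integral_has_vector_derivative[OF this t]
    show "(u has_vector_derivative pr (u t) (c t)) (at t within {0..T})"
      unfolding u_def[abs_def] has_vector_derivative_def IW[OF t, unfolded u_def]
      by (auto intro!: derivative_eq_intros)
  qed
qed


text \<open>Differentiating in \<open>x\<close> the solutions of the \<open>t\<close>-equations: the compatibility condition
  says that \<open>u(x, t) - u(x\<^sub>0, t) - (x - x\<^sub>0) pr (u(x\<^sub>0, t)) (k(x\<^sub>0, t))\<close> solves, up to a small
  inhomogeneity, the same linear equation.\<close>

lemma compatible_linear_system_exists: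
  fixes pr :: "'e::euclidean_space \<Rightarrow> 'f::real_normed_vector \<Rightarrow> 'e" and l T :: real
  defines "S \<equiv> {0..l} \<times> {0..T}"
  assumes pr: "bounded_bilinear pr" and l: "0 < l" and T: "0 < T"
    and v: "has_partials S v vx vt" "continuous_on S vx"
    and k: "has_partials S k kx kt"
    and compat: "\<And>z u. z \<in> S \<Longrightarrow>
      pr (pr u (k z)) (v z) + pr u (vx z) = pr (pr u (v z)) (k z) + pr u (kt z)"
    and u0: "\<And>x. x \<in> {0..l} \<Longrightarrow> (u0 has_vector_derivative pr (u0 x) (k (x, 0))) (at x within {0..l})"
  obtains u where "has_partials S u (\<lambda>z. pr (u z) (k z)) (\<lambda>z. pr (u z) (v z))"
    "\<And>x. x \<in> {0..l} \<Longrightarrow> u (x, 0) = u0 x"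
proof -
  interpret bounded_bilinear pr by fact
  have contv: "continuous_on S v" and contk: "continuous_on S k"
    using v(1) k unfolding has_partials_def continuous_on_eq_continuous_within
    by (blast dest: has_derivative_continuous)+
  have cS: "compact S" by (simp add: S_def compact_Times)
  obtain K where K: "0 < K" "\<And>a b. norm (pr a b) \<le> norm a * norm b * K"
    using pos_bounded by blast
  obtain V where V: "0 < V" "\<And>z. z \<in> S \<Longrightarrow> norm (v z) \<le> V"
    using compact_imp_bounded[OF compact_continuous_image[OF contv cS]] unfolding bounded_pos by auto
  obtain k1 where k1: "0 < k1" "\<And>z. z \<in> S \<Longrightarrow> norm (k z) \<le> k1"
    using compact_imp_bounded[OF compact_continuous_image[OF contk cS]] unfolding bounded_pos by auto
  have "continuous_on {0..l} u0"
    using u0 by (rule continuous_on_vector_derivative)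
  from compact_imp_bounded[OF compact_continuous_image[OF this]]
  obtain b0 where b0: "0 < b0" "\<And>x. x \<in> {0..l} \<Longrightarrow> norm (u0 x) \<le> b0"
    unfolding bounded_pos by auto
  have prb: "norm (pr a b) \<le> A * B * K" if "norm a \<le> A" "norm b \<le> B" for a b A B
  proof -
    have "0 \<le> A" using that(1) norm_ge_zero order_trans by blast
    then have "norm a * norm b * K \<le> A * B * K"
      using that K by (intro mult_right_mono mult_mono) auto
    then show ?thesis using K(2)[of a b] by linarith
  qed
  \<comment> \<open>The time equation is solved separately for each \<open>x\<close>; nothing is
    known yet about the dependence on \<open>x\<close>.\<close>
  have "\<exists>f. f 0 = u0 x \<and>
      (\<forall>t\<in>{0..T}. (f has_vector_derivative pr (f t) (v (x, t))) (at t within {0..T}))"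
    if "x \<in> {0..l}" for x
  proof -
    have "continuous_on {0..T} (\<lambda>t. v (x, t))"
      by (rule continuous_on_compose2[OF contv]) (use that in \<open>auto simp: S_def intro!: continuous_intros\<close>)
    from linear_ode_exists[OF pr this, of "u0 x"] T show ?thesis by (metis less_imp_le)
  qed
  then obtain U where U0: "\<And>x. x \<in> {0..l} \<Longrightarrow> U x 0 = u0 x"
    and dU: "\<And>x t. x \<in> {0..l} \<Longrightarrow> t \<in> {0..T} \<Longrightarrow>
      (U x has_vector_derivative pr (U x t) (v (x, t))) (at t within {0..T})"
    by metis
  have contU: "continuous_on {0..T} (U x)" if "x \<in> {0..l}" for x
    using dU[OF that] by (rule continuous_on_vector_derivative)
  define c where "c = sqrt ((1 + T) * exp ((2 * (V * K) + 1) * T))"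
  have c: "0 < c" using T by (auto simp: c_def intro!: mult_pos_pos)
  define b where "b = b0 * c"
  have b: "0 < b" using b0 c by (simp add: b_def)
  \<comment> \<open>Gronwall with \<open>e = b0\<close>, the bound of the initial values; the
    equation has no inhomogeneity.\<close>
  have Ub: "norm (U x t) \<le> b" if x: "x \<in> {0..l}" and t: "t \<in> {0..T}" for x t
    unfolding b_def c_def
  proof (rule gronwall[OF contU[OF x] _ _ _ _ _ t])
    fix t assume t: "0 < t" "t < T"
    then show "(U x has_vector_derivative pr (U x t) (v (x, t))) (at t)"
      using dU[OF x, of t] by (simp add: at_within_Icc_at)
    have "norm (pr (U x t) (v (x, t))) \<le> norm (U x t) * V * K"
      by (rule prb) (use t x in \<open>auto intro!: V simp: S_def\<close>)
    then show "norm (pr (U x t) (v (x, t))) \<le> V * K * norm (U x t) + b0"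
      using b0 by (simp add: mult_ac)
  qed (use V K b0 U0 x in auto)
  \<comment> \<open>Uniform continuity on the compact rectangle allows \<open>\<delta>\<close> to be
    chosen before \<open>t\<close>, as the Gronwall estimate needs its bounds at all times.\<close>
  have unif: "\<exists>\<delta>>0. \<forall>x\<in>{0..l}. \<bar>x - x0\<bar> < \<delta> \<longrightarrow> (\<forall>t\<in>{0..T}.
      norm (U x t - U x0 t - (x - x0) *\<^sub>R pr (U x0 t) (k (x0, t))) \<le> \<epsilon> * \<bar>x - x0\<bar>)"
    if x0: "x0 \<in> {0..l}" and \<epsilon>: "0 < \<epsilon>" for x0 \<epsilon>
  proof -
    \<comment> \<open>\<open>A\<close> collects the bounds of the two terms of the remainder
      \<open>r\<close> below, which is then at most \<open>|h| \<eta> A\<close>; the division by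
      \<open>c\<close> in \<open>\<eta>\<close> compensates the Gronwall constant and leaves exactly
      \<open>\<epsilon> |h|\<close>.\<close>
    define A where "A = b * K + b * k1 * K * K"
    have A: "0 < A" using b K k1 by (auto simp: A_def intro!: add_pos_pos mult_pos_pos)
    define \<eta> where "\<eta> = \<epsilon> / c / A"
    have \<eta>: "0 < \<eta>" using \<epsilon> c A by (simp add: \<eta>_def)
    obtain d1 where d1: "0 < d1" "\<And>x. x \<in> {0..l} \<Longrightarrow> \<bar>x - x0\<bar> < d1 \<Longrightarrow>
        norm (u0 x - u0 x0 - (x - x0) *\<^sub>R pr (u0 x0) (k (x0, 0))) \<le> \<epsilon> / c * \<bar>x - x0\<bar>"
      using u0[OF x0] \<epsilon> c unfolding has_vector_derivative_def has_derivative_within_alt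
      by (metis divide_pos_pos real_norm_def)
    obtain d2 where d2: "0 < d2" "\<And>z z'. z \<in> S \<Longrightarrow> z' \<in> S \<Longrightarrow> dist z' z < d2 \<Longrightarrow> dist (vx z') (vx z) < \<eta>"
      using compact_uniformly_continuous[OF v(2) cS] \<eta> unfolding uniformly_continuous_on_def by metis
    obtain d3 where d3: "0 < d3" "\<And>z z'. z \<in> S \<Longrightarrow> z' \<in> S \<Longrightarrow> dist z' z < d3 \<Longrightarrow> dist (v z') (v z) < \<eta>"
      using compact_uniformly_continuous[OF contv cS] \<eta> unfolding uniformly_continuous_on_def by metis
    show ?thesis
    proof (intro exI[of _ "min d1 (min d2 d3)"] conjI ballI impI)
      show "0 < min d1 (min d2 d3)" using d1 d2 d3 by simp
      fix x t assume x: "x \<in> {0..l}" "\<bar>x - x0\<bar> < min d1 (min d2 d3)" and t: "t \<in> {0..T}"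
      define h where "h = x - x0"
      define D where "D t = U x t - U x0 t - h *\<^sub>R pr (U x0 t) (k (x0, t))" for t
      \<comment> \<open>What the derivative of \<open>D\<close> contains beyond the linear equation
        with coefficient \<open>v (x, t)\<close>: a linearization error of \<open>v\<close>, and
        \<open>h\<close> times an increment of \<open>v\<close>. Both are \<open>o(h)\<close>,
        uniformly in \<open>t\<close>.\<close>
      define r where "r t = pr (U x0 t) (v (x, t) - v (x0, t) - h *\<^sub>R vx (x0, t)) +
        h *\<^sub>R pr (pr (U x0 t) (k (x0, t))) (v (x, t) - v (x0, t))" for t
      have D': "(D has_vector_derivative (pr (D t) (v (x, t)) + r t)) (at t within {0..T})"
        if t: "t \<in> {0..T}" for t
      proof -
        have z: "(x0, t) \<in> S" using x0 t by (simp add: S_def)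
        have kd: "((\<lambda>t. k (x0, t)) has_vector_derivative kt (x0, t)) (at t within {0..T})"
          using has_partials_slice(2)[OF k[unfolded S_def] x0 t] .
        have "(D has_vector_derivative
            (pr (U x t) (v (x, t)) - pr (U x0 t) (v (x0, t)) -
              h *\<^sub>R (pr (U x0 t) (kt (x0, t)) + pr (pr (U x0 t) (v (x0, t))) (k (x0, t)))))
            (at t within {0..T})"
          unfolding D_def[abs_def]
          by (intro has_vector_derivative_diff dU x x0 t
              bounded_linear.has_vector_derivative[OF bounded_linear_scaleR_right]
              has_vector_derivative kd)
        \<comment> \<open>Compatibility trades the time derivative of \<open>k\<close> for the space
          derivative of \<open>v\<close>, which matches the linear term of
          \<open>v (x, t) - v (x0, t)\<close>.\<close>
        also have "pr (U x0 t) (kt (x0, t)) + pr (pr (U x0 t) (v (x0, t))) (k (x0, t)) =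
            pr (pr (U x0 t) (k (x0, t))) (v (x0, t)) + pr (U x0 t) (vx (x0, t))"
          using compat[OF z, of "U x0 t"] by (simp add: add.commute)
        finally show ?thesis
          by (rule has_vector_derivative_eq_rhs)
            (simp add: D_def r_def diff_left diff_right add_left add_right scaleR_left scaleR_right
              algebra_simps)
      qed
      have "norm (D t) \<le> (\<epsilon> / c * \<bar>h\<bar>) * sqrt ((1 + T) * exp ((2 * (V * K) + 1) * T))"
      proof (rule gronwall[OF _ _ _ _ _ _ t])
        show "continuous_on {0..T} D"
          using D' by (rule continuous_on_vector_derivative)
        show "0 \<le> V * K" "0 \<le> \<epsilon> / c * \<bar>h\<bar>" using V K \<epsilon> c by auto
        show "norm (D 0) \<le> \<epsilon> / c * \<bar>h\<bar>"
          using d1(2)[of x] x x0 by (simp add: D_def h_def U0)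
        fix t assume t: "0 < t" "t < T"
        show "(D has_vector_derivative (pr (D t) (v (x, t)) + r t)) (at t)"
          using D'[of t] t by (simp add: at_within_Icc_at)
        have zS: "(\<xi>, t) \<in> S" if "\<xi> \<in> {0..l}" for \<xi> using that t by (simp add: S_def)
        have seg: "closed_segment x0 x \<subseteq> {0..l}"
          using x x0 by (intro closed_segment_subset) auto
        have "norm (v (x, t) - v (x0, t) - (x - x0) *\<^sub>R vx (x0, t)) \<le> norm (x - x0) * \<eta>"
        proof (rule vector_differentiable_bound_linearization[where S = "closed_segment x0 x"
              and f = "\<lambda>\<xi>. v (\<xi>, t)" and f' = "\<lambda>\<xi>. vx (\<xi>, t)"])
          fix \<xi> assume \<xi>: "\<xi> \<in> closed_segment x0 x"
          then have \<xi>': "\<xi> \<in> {0..l}" using seg by auto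
          show "((\<lambda>\<xi>. v (\<xi>, t)) has_vector_derivative vx (\<xi>, t)) (at \<xi> within closed_segment x0 x)"
            using has_partials_slice(1)[OF v(1)[unfolded S_def] \<xi>', of t] t
            by (intro has_vector_derivative_within_subset[OF _ seg]) auto
          have "\<bar>\<xi> - x0\<bar> \<le> \<bar>x - x0\<bar>"
            using \<xi> by (auto simp: closed_segment_eq_real_ivl split: if_splits)
          then have "dist (\<xi>, t) (x0, t) < d2"
            using x by (simp add: dist_Pair_Pair dist_real_def)
          then show "norm (vx (\<xi>, t) - vx (x0, t)) \<le> \<eta>"
            using d2(2)[OF zS[OF x0] zS[OF \<xi>']] by (simp add: dist_norm less_imp_le)
        qed auto
        then have r1: "norm (pr (U x0 t) (v (x, t) - v (x0, t) - h *\<^sub>R vx (x0, t))) \<le> b * (\<bar>h\<bar> * \<eta>) * K"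
          using t x0 by (intro prb Ub) (auto simp: h_def)
        have "dist (x, t) (x0, t) < d3"
          using x by (simp add: dist_Pair_Pair dist_real_def)
        then have "norm (v (x, t) - v (x0, t)) \<le> \<eta>"
          using d3(2)[OF zS[OF x0] zS[OF x(1)]] by (simp add: dist_norm less_imp_le)
        then have "norm (pr (pr (U x0 t) (k (x0, t))) (v (x, t) - v (x0, t))) \<le> b * k1 * K * \<eta> * K"
          using t x0 by (intro prb Ub k1 zS) auto
        then have r2: "norm (h *\<^sub>R pr (pr (U x0 t) (k (x0, t))) (v (x, t) - v (x0, t))) \<le>
            \<bar>h\<bar> * (b * k1 * K * \<eta> * K)"
          by (simp add: mult_left_mono)
        have "norm (r t) \<le> b * (\<bar>h\<bar> * \<eta>) * K + \<bar>h\<bar> * (b * k1 * K * \<eta> * K)"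
          unfolding r_def by (rule order_trans[OF norm_triangle_ineq add_mono[OF r1 r2]])
        also have "\<dots> = \<bar>h\<bar> * \<eta> * A" by (simp add: A_def algebra_simps)
        also have "\<dots> = \<epsilon> / c * \<bar>h\<bar>" using A by (simp add: \<eta>_def)
        finally have "norm (r t) \<le> \<epsilon> / c * \<bar>h\<bar>" .
        moreover have "norm (pr (D t) (v (x, t))) \<le> norm (D t) * V * K"
          by (intro prb V zS x) auto
        ultimately show "norm (pr (D t) (v (x, t)) + r t) \<le> V * K * norm (D t) + \<epsilon> / c * \<bar>h\<bar>"
          using norm_triangle_ineq[of "pr (D t) (v (x, t))" "r t"] by (simp add: mult_ac)
      qed
      also have "\<dots> = \<epsilon> * \<bar>x - x0\<bar>"
        unfolding c_def[symmetric] using c by (simp add: h_def)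
      finally show "norm (U x t - U x0 t - (x - x0) *\<^sub>R pr (U x0 t) (k (x0, t))) \<le> \<epsilon> * \<bar>x - x0\<bar>"
        by (simp add: D_def h_def)
    qed
  qed
  have dUx: "((\<lambda>\<xi>. U \<xi> t) has_vector_derivative pr (U x t) (k (x, t))) (at x within {0..l})"
    if x: "x \<in> {0..l}" and t: "t \<in> {0..T}" for x t
    unfolding has_vector_derivative_def has_derivative_within_alt
  proof (intro conjI allI impI)
    show "bounded_linear (\<lambda>h. h *\<^sub>R pr (U x t) (k (x, t)))"
      by (rule bounded_linear_scaleR_left)
    fix e :: real assume "0 < e"
    from unif[OF x this] t
    show "\<exists>d>0. \<forall>y\<in>{0..l}. norm (y - x) < d \<longrightarrow>
        norm (U y t - U x t - (y - x) *\<^sub>R pr (U x t) (k (x, t))) \<le> e * norm (y - x)"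
      by (metis real_norm_def)
  qed
  \<comment> \<open>A Lipschitz constant in \<open>t\<close> common to all \<open>x\<close>; with
    continuity in \<open>x\<close> at fixed \<open>t\<close> it yields joint continuity.\<close>
  define L where "L = b * V * K"
  have L: "0 < L" using b V K by (simp add: L_def)
  have lip: "norm (U x t - U x t') \<le> L * \<bar>t - t'\<bar>"
    if x: "x \<in> {0..l}" and t: "t \<in> {0..T}" "t' \<in> {0..T}" for x t t'
  proof -
    have "norm (U x t - U x t') \<le> L * norm (t - t')"
    proof (rule differentiable_bound[OF convex_real_interval(5)])
      fix s assume s: "s \<in> {0..T}"
      show "(U x has_derivative (\<lambda>h. h *\<^sub>R pr (U x s) (v (x, s)))) (at s within {0..T})"
        using dU[OF x s] by (simp add: has_vector_derivative_def)
      have "norm (pr (U x s) (v (x, s))) \<le> L"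
        unfolding L_def using x s by (intro prb Ub V) (auto simp: S_def)
      then show "onorm (\<lambda>h. h *\<^sub>R pr (U x s) (v (x, s))) \<le> L"
        by (intro onorm_le) (simp add: mult.commute[of L] mult_left_mono)
    qed (use t in auto)
    then show ?thesis by simp
  qed
  define u where "u z = U (fst z) (snd z)" for z
  have contu: "continuous_on S u"
    unfolding continuous_on_iff
  proof (intro ballI allI impI)
    fix z :: "real \<times> real" and e :: real
    assume z: "z \<in> S" and e: "0 < e"
    obtain x t where xt: "z = (x, t)" "x \<in> {0..l}" "t \<in> {0..T}" using z by (auto simp: S_def)
    have "continuous (at x within {0..l}) (\<lambda>\<xi>. U \<xi> t)"
      using dUx[OF xt(2,3)] by (rule has_vector_derivative_continuous)
    then obtain d where d: "0 < d" "\<And>\<xi>. \<xi> \<in> {0..l} \<Longrightarrow> dist \<xi> x < d \<Longrightarrow> dist (U \<xi> t) (U x t) < e / 2"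
      using e unfolding continuous_within_eps_delta by (metis half_gt_zero)
    show "\<exists>d>0. \<forall>z'\<in>S. dist z' z < d \<longrightarrow> dist (u z') (u z) < e"
    proof (intro exI[of _ "min d (e / 2 / L)"] conjI ballI impI)
      show "0 < min d (e / 2 / L)" using d e L by simp
      fix z' assume z': "z' \<in> S" "dist z' z < min d (e / 2 / L)"
      obtain x' t' where xt': "z' = (x', t')" "x' \<in> {0..l}" "t' \<in> {0..T}" using z' by (auto simp: S_def)
      have "dist x' x < d" "dist t' t < e / 2 / L"
        using z'(2) dist_fst_le[of z' z] dist_snd_le[of z' z] by (auto simp: xt xt')
      then have "dist (U x' t) (U x t) < e / 2" "L * \<bar>t' - t\<bar> < e / 2"
        using d xt' L by (auto simp: dist_real_def field_simps)
      moreover have "dist (U x' t') (U x' t) \<le> L * \<bar>t' - t\<bar>"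
        using lip[OF xt'(2,3) xt(3)] by (simp add: dist_norm)
      ultimately show "dist (u z') (u z) < e"
        using dist_triangle[of "U x' t'" "U x t" "U x' t"] by (simp add: u_def xt xt')
    qed
  qed
  show thesis
  proof (rule that)
    show "u (x, 0) = u0 x" if "x \<in> {0..l}" for x using that by (simp add: u_def U0)
    show "has_partials S u (\<lambda>z. pr (u z) (k z)) (\<lambda>z. pr (u z) (v z))"
      unfolding has_partials_def
    proof
      fix z assume z: "z \<in> S"
      obtain x t where xt: "z = (x, t)" "x \<in> {0..l}" "t \<in> {0..T}" using z by (auto simp: S_def)
      have "((\<lambda>(x, t). U x t) has_derivative
          (\<lambda>(h, s). h *\<^sub>R pr (U x t) (k (x, t)) + blinfun_scaleR_left (pr (U x t) (v (x, t))) s))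
          (at (x, t) within {0..l} \<times> {0..T})"
      \<comment> \<open>Joint differentiability from the space derivative at the point and
        continuity of the time derivative there.\<close>
      proof (rule has_derivative_partialsI)
        show "((\<lambda>\<xi>. U \<xi> t) has_derivative (\<lambda>h. h *\<^sub>R pr (U x t) (k (x, t)))) (at x within {0..l})"
          using dUx[OF xt(2,3)] by (simp add: has_vector_derivative_def)
        show "((\<lambda>t. U \<xi> t) has_derivative blinfun_apply (blinfun_scaleR_left (pr (U \<xi> s) (v (\<xi>, s)))))
            (at s within {0..T})" if "\<xi> \<in> {0..l}" "s \<in> {0..T}" for \<xi> s
          using dU[OF that] by (simp add: has_vector_derivative_def)
        have "continuous_on S (\<lambda>z. blinfun_scaleR_left (pr (u z) (v z)))"
          by (intro bounded_linear.continuous_on[OF bounded_linear_blinfun_scaleR_left]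
              continuous_on contu contv)
        then show "continuous (at (x, t) within {0..l} \<times> {0..T})
            (\<lambda>(x, y). blinfun_scaleR_left (pr (U x y) (v (x, y))))"
          using z unfolding continuous_on_eq_continuous_within
          by (simp add: u_def S_def xt(1) case_prod_unfold)
      qed (use xt in auto)
      then show "(u has_derivative (\<lambda>h. fst h *\<^sub>R pr (u z) (k z) + snd h *\<^sub>R pr (u z) (v z))) (at z within S)"
        by (simp add: u_def[abs_def] xt(1) S_def case_prod_unfold)
    qed
  qed
qed


section \<open>Block vectors, hat matrices and rotations\<close>

declare transpose_matrix_vector [simp del]

lemma bvec_upper_lower [simp]: "bvec (upper w) (lower w) = w"
  by (auto simp: bvec_def upper_def lower_def vec_eq_iff split: sum.split)

lemma block_eq_iff: "v = w \<longleftrightarrow> upper v = upper w \<and> lower v = lower w"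
  by (metis bvec_upper_lower)

lemma bounded_linear_upper: "bounded_linear (upper :: real^('m::finite + 'n::finite) \<Rightarrow> real^'m)"
  by (subst linear_conv_bounded_linear[symmetric], rule linearI) (simp_all add: upper_def vec_eq_iff)

lemma bounded_linear_lower: "bounded_linear (lower :: real^('m::finite + 'n::finite) \<Rightarrow> real^'n)"
  by (subst linear_conv_bounded_linear[symmetric], rule linearI) (simp_all add: lower_def vec_eq_iff)

lemmas upper_linear [simp] =
  linear_add[OF bounded_linear.linear[OF bounded_linear_upper]]
  linear_diff[OF bounded_linear.linear[OF bounded_linear_upper]]
  linear_neg[OF bounded_linear.linear[OF bounded_linear_upper]]
  linear_0[OF bounded_linear.linear[OF bounded_linear_upper]]
  linear_scale[OF bounded_linear.linear[OF bounded_linear_upper]]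
  linear_sum[OF bounded_linear.linear[OF bounded_linear_upper]]

lemmas lower_linear [simp] =
  linear_add[OF bounded_linear.linear[OF bounded_linear_lower]]
  linear_diff[OF bounded_linear.linear[OF bounded_linear_lower]]
  linear_neg[OF bounded_linear.linear[OF bounded_linear_lower]]
  linear_0[OF bounded_linear.linear[OF bounded_linear_lower]]
  linear_scale[OF bounded_linear.linear[OF bounded_linear_lower]]
  linear_sum[OF bounded_linear.linear[OF bounded_linear_lower]]

lemma C1_on_bvec:
  fixes f :: "'a::euclidean_space \<Rightarrow> real^'m" and g :: "'a \<Rightarrow> real^'n"
  assumes "C1_on S f" "C1_on S g"
  shows "C1_on S (\<lambda>z. bvec (f z) (g z))"
proof -
  have "linear (\<lambda>w :: (real^'m) \<times> (real^'n). bvec (fst w) (snd w))"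
    by (rule linearI) (auto simp: bvec_def vec_eq_iff split: sum.split)
  then have "bounded_linear (\<lambda>w :: (real^'m) \<times> (real^'n). bvec (fst w) (snd w))"
    by (simp add: linear_conv_bounded_linear)
  from C1_on_bounded_linear[OF this C1_on_Pair[OF assms]] show ?thesis by simp
qed

lemma upper_bmat [simp]:
  fixes A :: "real^'c^'r" and B :: "real^'d^'r" and C :: "real^'c^'s" and D :: "real^'d^'s"
  shows "upper (bmat A B C D *v w) = A *v upper w + B *v lower w"
  using bmat_mult_bvec[of A B C D "upper w" "lower w"] by simp

lemma lower_bmat [simp]:
  fixes A :: "real^'c^'r" and B :: "real^'d^'r" and C :: "real^'c^'s" and D :: "real^'d^'s"
  shows "lower (bmat A B C D *v w) = C *v upper w + D *v lower w"
  using bmat_mult_bvec[of A B C D "upper w" "lower w"] by simp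

lemma upper_bdiag [simp]:
  fixes A :: "real^'c^'r" and D :: "real^'d^'s"
  shows "upper (bdiag A D *v w) = A *v upper w"
  by (simp add: bdiag_def)

lemma lower_bdiag [simp]:
  fixes A :: "real^'c^'r" and D :: "real^'d^'s"
  shows "lower (bdiag A D *v w) = D *v lower w"
  by (simp add: bdiag_def)

lemma bdiag_mult_bdiag:
  fixes A :: "real^'c^'r" and D :: "real^'d^'s" and B :: "real^'a^'c" and E :: "real^'b^'d"
  shows "bdiag A D *v (bdiag B E *v w) = bdiag (A ** B) (D ** E) *v w"
  by (simp add: block_eq_iff flip: matrix_vector_mul_assoc)

lemma transpose_bmat: "transpose (bmat A B C D) = bmat (transpose A) (transpose C) (transpose B) (transpose D)"
  by (auto simp: transpose_def bmat_def bvec_def vec_eq_iff split: sum.split)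

lemma bounded_bilinear_matrix_vector_mult:
  "bounded_bilinear ((*v) :: real^'n^'m \<Rightarrow> real^'n \<Rightarrow> real^'m)"
  unfolding bilinear_conv_bounded_bilinear[symmetric] bilinear_def
  by (auto intro!: linearI simp: algebra_simps scaleR_matrix_vector_assoc)

lemma bounded_bilinear_matrix_matrix_mult:
  "bounded_bilinear ((**) :: real^'n^'m \<Rightarrow> real^'k^'n \<Rightarrow> real^'k^'m)"
  unfolding bilinear_conv_bounded_bilinear[symmetric] bilinear_def
  by (auto intro!: linearI simp: matrix_matrix_mult_def vec_eq_iff algebra_simps sum.distrib
      sum_distrib_left)

lemma bounded_linear_transpose: "bounded_linear (transpose :: real^'n^'m \<Rightarrow> real^'m^'n)"
  by (subst linear_conv_bounded_linear[symmetric], rule linearI)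
    (simp_all add: transpose_def vec_eq_iff)

lemma bounded_linear_hat: "bounded_linear hat"
  by (subst linear_conv_bounded_linear[symmetric], rule linearI)
    (simp_all add: matrix_eq hat_mult algebra_simps cross_add_left cross_mult_left
      flip: scaleR_matrix_vector_assoc)

lemma bounded_linear_vee: "bounded_linear vee"
  by (subst linear_conv_bounded_linear[symmetric], rule linearI)
    (simp_all add: vee_def vec_eq_iff forall_3)

lemmas hat_linear =
  linear_add[OF bounded_linear.linear[OF bounded_linear_hat]]
  linear_diff[OF bounded_linear.linear[OF bounded_linear_hat]]
  linear_neg[OF bounded_linear.linear[OF bounded_linear_hat]]
  linear_scale[OF bounded_linear.linear[OF bounded_linear_hat]]

lemma hat_inject [simp]: "hat a = hat b \<longleftrightarrow> a = b"
  by (metis vee_hat)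

lemma transpose_hat: "transpose (hat a) = - hat a"
  by (simp add: transpose_def hat_def matrix_def cross3_def axis_def vec_eq_iff forall_3)

text \<open>The Jacobi identity of the cross product: \<open>hat\<close> identifies three-space
  under the cross product with the Lie algebra so(3).\<close>

lemma hat_commutator: "hat a ** hat b - hat b ** hat a = hat (cross3 a b)"
proof -
  have "cross3 a (cross3 b x) - cross3 b (cross3 a x) = cross3 (cross3 a b) x" for x
    by (simp add: cross3_simps forall_3)
  then show ?thesis
    by (simp add: matrix_eq hat_mult matrix_vector_mult_diff_rdistrib flip: matrix_vector_mul_assoc)
qed

section \<open>Rotations: cancellation, products and cross products\<close>

lemma SO3_orthogonal:
  assumes "R \<in> SO3"
  shows "transpose R ** R = mat 1" "R ** transpose R = mat 1"
  using assms by (auto simp: SO3_def rotation_matrix_def orthogonal_matrix_def)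

lemma SO3_transpose_mult:
  assumes "R \<in> SO3"
  shows "transpose R *v (R *v w) = w" "R *v (transpose R *v w) = w"
    "transpose R ** (R ** A) = A" "R ** (transpose R ** A) = A"
  using SO3_orthogonal[OF assms] by (simp_all add: matrix_vector_mul_assoc matrix_mul_assoc)

lemma SO3_cancel:
  assumes "R \<in> SO3"
  shows "R *v a = R *v b \<longleftrightarrow> a = b" "R ** A = R ** B \<longleftrightarrow> A = B"
  by (metis SO3_transpose_mult(1)[OF assms]) (metis SO3_transpose_mult(3)[OF assms])

lemma bdiag_SO3_cancel:
  assumes "R \<in> SO3"
  shows "bdiag R R *v v = bdiag R R *v w \<longleftrightarrow> v = w"
  by (simp add: block_eq_iff SO3_cancel[OF assms])

lemma SO3_cross: "R \<in> SO3 \<Longrightarrow> cross3 (R *v a) (R *v b) = R *v cross3 a b"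
  by (simp add: SO3_def cross_rotation_matrix)

lemma SO3_transpose: "R \<in> SO3 \<Longrightarrow> transpose R \<in> SO3"
  by (simp add: SO3_def rotation_matrix_def orthogonal_matrix_def det_transpose conj_commute)

lemma SO3_mult: "R \<in> SO3 \<Longrightarrow> S \<in> SO3 \<Longrightarrow> R ** S \<in> SO3"
  by (simp add: SO3_def rotation_matrix_def orthogonal_matrix_mul det_mul)

text \<open>Rotations preserve the cross product, so conjugation by \<open>R\<close> acts on axis
  vectors as \<open>R\<close> itself, the adjoint action of SO(3). It carries angular velocities
  from a beam's own frame to the one compared at a node.\<close>

lemma hat_rotate:
  assumes "R \<in> SO3"
  shows "hat (R *v a) = R ** hat a ** transpose R"
proof -
  have "cross3 (R *v a) x = R *v cross3 a (transpose R *v x)" for x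
    using SO3_cross[OF assms, of a "transpose R *v x"] by (simp add: SO3_transpose_mult[OF assms])
  then show ?thesis
    by (simp add: matrix_eq hat_mult flip: matrix_vector_mul_assoc)
qed

section \<open>Invertibility of positive definite matrices\<close>

lemma spd_mult_eq_0:
  assumes "A \<in> spd" "A *v x = 0"
  shows "x = 0"
  using assms unfolding spd_def by force

lemma invertible_if_kernel_trivial:
  fixes A :: "real^'n^'n"
  assumes "\<And>x. A *v x = 0 \<Longrightarrow> x = 0"
  shows "invertible A"
  using assms by (simp add: invertible_left_inverse matrix_left_invertible_ker)

lemma spd_invertible: "A \<in> spd \<Longrightarrow> invertible A"
  using invertible_if_kernel_trivial spd_mult_eq_0 by blast

lemma matrix_inv_mult_vector:
  fixes A :: "real^'n^'n"
  assumes "invertible A"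
  shows "A *v (matrix_inv A *v x) = x" "matrix_inv A *v (A *v x) = x"
  using matrix_inv_mult[OF assms] by (simp_all add: matrix_vector_mul_assoc)


section \<open>Infinitesimal rigid motions\<close>

text \<open>
  A pair \<open>(p, R)\<close> stands for the rigid motion \<open>x \<mapsto> R x + p\<close> and \<open>act\<close> for the right
  multiplication by an element of the Lie algebra se(3). In these terms the body velocity and the
  strain are the logarithmic derivatives in time and space, \<open>bracket\<close> is the Lie bracket and
  \<open>coad\<close> the coadjoint action on forces and momenta.
\<close>

definition act :: "vec3 \<times> mat3 \<Rightarrow> vec6 \<Rightarrow> vec3 \<times> mat3" where
  "act u c = (snd u *v upper c, snd u ** hat (lower c))"

definition bracket :: "vec6 \<Rightarrow> vec6 \<Rightarrow> vec6" where
  "bracket k v =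
     bvec (cross3 (lower k) (upper v) - cross3 (lower v) (upper k)) (cross3 (lower k) (lower v))"

definition coad :: "vec6 \<Rightarrow> vec6 \<Rightarrow> vec6" where
  "coad k z = bvec (cross3 (lower k) (upper z)) (cross3 (upper k) (upper z) + cross3 (lower k) (lower z))"

lemma bounded_bilinear_act: "bounded_bilinear act"
  unfolding bilinear_conv_bounded_bilinear[symmetric] bilinear_def
  by (auto intro!: linearI simp: act_def hat_linear
      bounded_bilinear.add_left[OF bounded_bilinear_matrix_matrix_mult]
      bounded_bilinear.add_right[OF bounded_bilinear_matrix_matrix_mult]
      bounded_bilinear.scaleR_left[OF bounded_bilinear_matrix_matrix_mult]
      bounded_bilinear.scaleR_right[OF bounded_bilinear_matrix_matrix_mult]
      bounded_bilinear.add_left[OF bounded_bilinear_matrix_vector_mult]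
      bounded_bilinear.add_right[OF bounded_bilinear_matrix_vector_mult]
      bounded_bilinear.scaleR_left[OF bounded_bilinear_matrix_vector_mult]
      bounded_bilinear.scaleR_right[OF bounded_bilinear_matrix_vector_mult])

text \<open>The rotational part is \<open>hat_commutator\<close>; the translational part is how
  \<open>bracket\<close> is defined. This identity turns the zero-curvature equation into the
  compatibility condition of \<open>compatible_linear_system_exists\<close>.\<close>

lemma act_commutator: "act (act u k) v = act (act u v) k + act u (bracket k v)"
proof -
  have "R ** hat a ** hat b = R ** hat b ** hat a + R ** hat (cross3 a b)" for R a b
    by (simp add: bounded_bilinear.diff_right[OF bounded_bilinear_matrix_matrix_mult]
        matrix_mul_assoc flip: hat_commutator)
  then show ?thesis
    by (simp add: act_def bracket_def hat_mult matrix_vector_mult_diff_distrib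
        flip: matrix_vector_mul_assoc)
qed

lemma act_cancel:
  assumes "snd u \<in> SO3"
  shows "act u a = act u b \<longleftrightarrow> a = b"
  by (simp add: act_def SO3_cancel[OF assms] block_eq_iff)

lemma spd_bdiag_invertible:
  assumes "M \<in> spd" "C \<in> spd"
  shows "invertible (bdiag M C)"
proof (rule invertible_if_kernel_trivial)
  fix x assume "bdiag M C *v x = 0"
  then have "M *v upper x = 0" "C *v lower x = 0"
    by (simp_all add: block_eq_iff)
  then show "x = 0"
    using spd_mult_eq_0[OF assms(1)] spd_mult_eq_0[OF assms(2)] by (simp add: block_eq_iff)
qed

text \<open>Multiplication by the invertible \<open>Qmat\<close> clears all inverses and separates
  the block rows. In the total strain \<open>k\<close> the part \<open>(e1, ref_curv)\<close> comes
  from \<open>Emat\<close> and the part \<open>C z\<close> from the quadratic term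
  \<open>Gmat\<close>, so that linear and nonlinear terms merge into \<open>coad k\<close> and
  \<open>bracket k\<close>.\<close>

lemma intrinsic_pde_iff:
  fixes y yt yx :: vec12
  assumes "mass_mat \<Gamma> i x \<in> spd" "flex_mat \<Gamma> i x \<in> spd"
  defines "M \<equiv> mass_mat \<Gamma> i x" and "C \<equiv> flex_mat \<Gamma> i x"
    and "k \<equiv> flex_mat \<Gamma> i x *v lower y + bvec e1 (ref_curv \<Gamma> i x)"
  shows "yt + Amat \<Gamma> i x *v yx + Bmat \<Gamma> i x *v y = gfun \<Gamma> i x y \<longleftrightarrow>
    M *v upper yt + coad (upper y) (M *v upper y) = lower yx + coad k (lower y) \<and>
    C *v lower yt = upper yx + bracket k (upper y)"
proof -
  define Q where "Q = Qmat \<Gamma> i x"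
  have Q: "Q = bdiag M C" by (simp add: Q_def Qmat_def M_def C_def)
  have inv: "invertible Q" using spd_bdiag_invertible assms by (simp add: Q)
  have Qeq: "a = b \<longleftrightarrow> Q *v a = Q *v b" for a b
    by (metis matrix_inv_mult_vector(2)[OF inv])
  have A: "Q *v (Amat \<Gamma> i x *v w) = - (bmat 0 (mat 1) (mat 1) 0 *v w)" for w
    by (simp add: Amat_def Q_def[symmetric] matrix_inv_mult_vector(1)[OF inv]
        bounded_bilinear.minus_left[OF bounded_bilinear_matrix_vector_mult]
        bounded_bilinear.minus_right[OF bounded_bilinear_matrix_vector_mult]
        flip: matrix_vector_mul_assoc)
  have B: "Q *v (Bmat \<Gamma> i x *v w) = bmat 0 (- Emat \<Gamma> i x) (transpose (Emat \<Gamma> i x)) 0 *v w" for w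
    by (simp add: Bmat_def Q_def[symmetric] matrix_inv_mult_vector(1)[OF inv]
        flip: matrix_vector_mul_assoc)
  have g: "Q *v gfun \<Gamma> i x w = Gmat w *v (Q *v w)" for w
    by (simp add: gfun_def Q_def[symmetric] matrix_inv_mult_vector(1)[OF inv]
        flip: matrix_vector_mul_assoc)
  note neg = bounded_bilinear.minus_left[OF bounded_bilinear_matrix_vector_mult]
  have transpose0: "transpose 0 = (0 :: mat3)" by (simp add: transpose_def vec_eq_iff)
  have skew: "cross3 a b = - cross3 b a" for a b by (rule cross_skew)
  show ?thesis
    unfolding Qeq[of _ "gfun \<Gamma> i x y"] matrix_vector_right_distrib A B g
    unfolding Q Gmat_def Let_def Emat_def
    by (simp add: block_eq_iff transpose0 neg coad_def bracket_def k_def C_def M_def hat_mult transpose_bmat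
        transpose_hat cross_add_left cross_add_right algebra_simps
        skew[of "upper (lower y)" "upper (flex_mat \<Gamma> i x *v lower y)"] skew[of "upper (lower y)" "lower (flex_mat \<Gamma> i x *v lower y)"]
        skew[of "lower (lower y)" "lower (flex_mat \<Gamma> i x *v lower y)"] skew[of "upper (upper y)" "lower (flex_mat \<Gamma> i x *v lower y)"]
        skew[of "lower (upper y)" "lower (flex_mat \<Gamma> i x *v lower y)"] skew[of "lower (upper y)" e1])
qed


section \<open>Kinematics along an edge\<close>

text \<open>Differentiating \<open>transpose R ** R = mat 1\<close> shows that
  \<open>transpose R ** R'\<close> is skew-symmetric, so \<open>hat\<close> undoes
  \<open>vee\<close> on it. The derivative is relative to the closed interval, which covers the
  endpoints.\<close>

lemma rotation_derivative:
  assumes L: "0 < L" "s \<in> {0..L}" and R: "\<And>s. s \<in> {0..L} \<Longrightarrow> R s \<in> SO3"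
    and d: "(R has_vector_derivative R') (at s within {0..L})"
  shows "R' = R s ** hat (vee (transpose (R s) ** R'))"
proof -
  have "((\<lambda>s. transpose (R s) ** R s) has_vector_derivative
      transpose (R s) ** R' + transpose R' ** R s) (at s within {0..L})"
    by (intro bounded_bilinear.has_vector_derivative[OF bounded_bilinear_matrix_matrix_mult]
        bounded_linear.has_vector_derivative[OF bounded_linear_transpose] d)
  from d_on_eqI[OF this L]
  have "transpose (R s) ** R' + transpose R' ** R s = d_on L (\<lambda>s. transpose (R s) ** R s) s"
    by simp
  also have "\<dots> = 0"
  proof (rule d_on_eqI[OF _ L])
    show "((\<lambda>s. transpose (R s) ** R s) has_vector_derivative 0) (at s within {0..L})"
      by (rule has_vector_derivative_transform[OF L(2) _ has_vector_derivative_const])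
        (simp add: SO3_orthogonal R)
  qed
  finally have "transpose (transpose (R s) ** R') = - (transpose (R s) ** R')"
    by (simp add: matrix_transpose_mul eq_neg_iff_add_eq_0 add.commute)
  from hat_vee[OF this] show ?thesis
    by (simp add: SO3_transpose_mult[OF R[OF L(2)]])
qed

text \<open>Skewness of \<open>hat\<close> makes \<open>R ** transpose R\<close> constant: in this
  order the two terms of its derivative cancel identically, whereas \<open>transpose R ** R\<close>
  would only satisfy a linear equation. The determinant is then 1 or -1, continuous and 1 at time 0,
  so it cannot reach -1 without vanishing.\<close>

lemma rotation_ode_SO3:
  assumes d: "\<And>t. t \<in> {0..T} \<Longrightarrow> (R has_vector_derivative R t ** hat (\<omega> t)) (at t within {0..T})"
    and init: "R 0 \<in> SO3" and t: "t \<in> {0..T}"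
  shows "R t \<in> SO3"
proof -
  note bmm = bounded_bilinear_matrix_matrix_mult
  have "((\<lambda>t. R t ** transpose (R t)) has_vector_derivative 0) (at t within {0..T})"
    if "t \<in> {0..T}" for t
  proof -
    have "((\<lambda>t. R t ** transpose (R t)) has_vector_derivative
        R t ** transpose (R t ** hat (\<omega> t)) + (R t ** hat (\<omega> t)) ** transpose (R t)) (at t within {0..T})"
      by (intro bounded_bilinear.has_vector_derivative[OF bmm]
          bounded_linear.has_vector_derivative[OF bounded_linear_transpose] d that)
    also have "R t ** transpose (R t ** hat (\<omega> t)) + (R t ** hat (\<omega> t)) ** transpose (R t) = 0"
      by (simp add: matrix_transpose_mul transpose_hat bounded_bilinear.minus_left[OF bmm]
          bounded_bilinear.minus_right[OF bmm] matrix_mul_assoc)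
    finally show ?thesis .
  qed
  then obtain c where c: "\<And>t. t \<in> {0..T} \<Longrightarrow> R t ** transpose (R t) = c"
    using has_derivative_zero_constant[of "{0..T}" "\<lambda>t. R t ** transpose (R t)"]
    by (auto simp: has_vector_derivative_def)
  have c1: "R t ** transpose (R t) = mat 1" if "t \<in> {0..T}" for t
    using c[of 0] c[OF that] that SO3_orthogonal[OF init] by simp
  have orth: "orthogonal_matrix (R t)" if "t \<in> {0..T}" for t
    using c1[OF that] matrix_left_right_inverse by (auto simp: orthogonal_matrix_def)
  have det: "det (R t) = 1 \<or> det (R t) = - 1" if "t \<in> {0..T}" for t
    using det_orthogonal_matrix[OF orth[OF that]] .
  have contR: "continuous_on {0..T} R"
    using d by (rule continuous_on_vector_derivative)
  have "continuous_on {0..t} (\<lambda>t. det (R t))"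
    unfolding det_def
    by (intro continuous_intros continuous_on_subset[OF contR]) (use t in auto)
  then have "det (R t) \<noteq> - 1"
    using IVT2'[of "\<lambda>t. det (R t)" t 0 0] init t det
    by (force simp: SO3_def rotation_matrix_def)
  then show ?thesis
    using orth[OF t] det[OF t] by (simp add: SO3_def rotation_matrix_def)
qed

text \<open>The transport rule for a vector given in the moving frame; the cross product with
  \<open>\<omega>\<close> is the source of the gyroscopic terms.\<close>

lemma rotated_derivative:
  assumes "(R has_vector_derivative R s ** hat \<omega>) (at s within A)"
    and "(m has_vector_derivative m') (at s within A)"
  shows "((\<lambda>s. R s *v m s) has_vector_derivative R s *v (m' + cross3 \<omega> (m s))) (at s within A)"
proof -
  have "((\<lambda>s. R s *v m s) has_vector_derivative R s *v m' + (R s ** hat \<omega>) *v m s) (at s within A)"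
    by (intro bounded_bilinear.has_vector_derivative[OF bounded_bilinear_matrix_vector_mult] assms)
  then show ?thesis
    by (simp add: matrix_vector_right_distrib hat_mult flip: matrix_vector_mul_assoc)
qed

lemma dt_eqI:
  assumes "((\<lambda>s. f (x, s)) has_vector_derivative d) (at t within {0..T})" "0 < T" "t \<in> {0..T}"
  shows "dt T f (x, t) = d"
  using d_on_eqI[OF assms] by (simp add: dt_def)

lemma dx_eqI:
  assumes "((\<lambda>\<xi>. f (\<xi>, t)) has_vector_derivative d) (at x within {0..l})" "0 < l" "x \<in> {0..l}"
  shows "dx l f (x, t) = d"
  using d_on_eqI[OF assms] by (simp add: dx_def)

text \<open>Only \<open>b\<close> is assumed C^1; differentiability of \<open>a\<close> in time is
  part of what is shown, up to the boundary. Writing \<open>f\<close> as its value at time 0 plus a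
  time integral of \<open>b\<close>, and differentiating under the integral, represents
  \<open>a\<close> through a time integral of the space derivative of \<open>b\<close>.\<close>

lemma mixed_partials:
  fixes f :: "real \<times> real \<Rightarrow> 'b::euclidean_space"
  assumes l: "0 < l" and T: "0 < T"
    and f: "has_partials ({0..l} \<times> {0..T}) f a b" and b: "C1_on ({0..l} \<times> {0..T}) b"
    and z: "z \<in> {0..l} \<times> {0..T}"
  shows "dt T a z = dx l b z"
proof -
  let ?S = "{0..l} \<times> {0..T}"
  obtain x t where xt: "z = (x, t)" "x \<in> {0..l}" "t \<in> {0..T}" using z by auto
  define bx where "bx = dx l b"
  have bx: "has_partials ?S b bx (dt T b)" and contbx: "continuous_on ?S bx"
    using C1_on_partials[OF l T b] by (simp_all add: bx_def)
  have contb: "continuous_on ?S b" using b by (rule C1_on_imp_continuous_on)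
  have slice: "continuous_on {0..s} (\<lambda>r. g (\<xi>, r))"
    if "continuous_on ?S g" "\<xi> \<in> {0..l}" "s \<in> {0..T}" for g :: "real \<times> real \<Rightarrow> 'b" and \<xi> s
    by (rule continuous_on_compose2[OF that(1)]) (use that in \<open>auto intro!: continuous_intros\<close>)
  have eq: "a (x, s) = a (x, 0) + integral {0..s} (\<lambda>r. bx (x, r))" if s: "s \<in> {0..T}" for s
  proof -
    have F: "integral {0..s} (\<lambda>r. b (\<xi>, r)) = f (\<xi>, s) - f (\<xi>, 0)" if \<xi>: "\<xi> \<in> {0..l}" for \<xi>
    proof (rule integral_unique, rule fundamental_theorem_of_calculus)
      show "0 \<le> s" using s by simp
      fix r assume r: "r \<in> {0..s}"
      then have "r \<in> {0..T}" using s by simp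
      from has_partials_slice(2)[OF f \<xi> this]
      show "((\<lambda>r. f (\<xi>, r)) has_vector_derivative b (\<xi>, r)) (at r within {0..s})"
        by (rule has_vector_derivative_within_subset) (use s in auto)
    qed
    have "((\<lambda>\<xi>. integral (cbox 0 s) (\<lambda>r. b (\<xi>, r))) has_vector_derivative
        integral (cbox 0 s) (\<lambda>r. bx (x, r))) (at x within {0..l})"
    proof (rule leibniz_rule_vector_derivative)
      show "((\<lambda>\<xi>. b (\<xi>, r)) has_vector_derivative bx (\<xi>, r)) (at \<xi> within {0..l})"
        if "\<xi> \<in> {0..l}" "r \<in> cbox 0 s" for \<xi> r
        using has_partials_slice(1)[OF bx that(1), of r] that(2) s by simp
      show "(\<lambda>r. b (\<xi>, r)) integrable_on cbox 0 s" if "\<xi> \<in> {0..l}" for \<xi>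
        using integrable_continuous_real[OF slice[OF contb that s]] by simp
      show "continuous_on ({0..l} \<times> cbox 0 s) (\<lambda>(\<xi>, r). bx (\<xi>, r))"
      proof -
        have "{0..l} \<times> {0..s} \<subseteq> ?S" using s by auto
        from continuous_on_subset[OF contbx this] show ?thesis by simp
      qed
    qed (use xt in auto)
    then have "((\<lambda>\<xi>. f (\<xi>, s) - f (\<xi>, 0)) has_vector_derivative
        integral {0..s} (\<lambda>r. bx (x, r))) (at x within {0..l})"
      unfolding cbox_interval
      by (rule has_vector_derivative_transform[OF xt(2), rotated]) (simp add: F)
    moreover have "((\<lambda>\<xi>. f (\<xi>, s) - f (\<xi>, 0)) has_vector_derivative a (x, s) - a (x, 0)) (at x within {0..l})"
      using has_partials_slice(1)[OF f xt(2)] s T by (intro has_vector_derivative_diff) auto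
    ultimately have "integral {0..s} (\<lambda>r. bx (x, r)) = a (x, s) - a (x, 0)"
      using d_on_eqI l xt(2) by metis
    then show ?thesis by simp
  qed
  have "continuous_on {0..T} (\<lambda>r. bx (x, r))"
    by (rule slice[OF contbx xt(2)]) (use T in simp)
  from has_vector_derivative_add[OF has_vector_derivative_const integral_has_vector_derivative[OF this xt(3)]]
  have "((\<lambda>s. a (x, 0) + integral {0..s} (\<lambda>r. bx (x, r))) has_vector_derivative bx (x, t)) (at t within {0..T})"
    by simp
  then have "((\<lambda>s. a (x, s)) has_vector_derivative bx (x, t)) (at t within {0..T})"
    by (rule has_vector_derivative_transform[OF xt(3), rotated]) (rule eq)
  from d_on_eqI[OF this T xt(3)] show ?thesis
    by (simp add: xt(1) dt_def bx_def)
qed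

text \<open>Spatial counterpart of \<open>vel\<close>: the logarithmic derivative of the motion
  along the beam. Subtracting the reference value \<open>(e1, ref_curv)\<close> gives the
  deformation entering the constitutive law.\<close>

definition kin :: "real \<Rightarrow> (real \<times> real \<Rightarrow> vec3) \<Rightarrow> (real \<times> real \<Rightarrow> mat3) \<Rightarrow> real \<times> real \<Rightarrow> vec6" where
  "kin l p R z = bvec (transpose (R z) *v dx l p z) (vee (transpose (R z) ** dx l R z))"

text \<open>The same quantity computed from the intrinsic unknown by inverting the constitutive law;
  by \<open>stress_eq_iff\<close> the two agree exactly when the stresses do.\<close>

definition strain :: "'v beam_net \<Rightarrow> nat \<Rightarrow> (real \<times> real \<Rightarrow> vec12) \<Rightarrow> real \<times> real \<Rightarrow> vec6" where
  "strain \<Gamma> i y z = flex_mat \<Gamma> i (fst z) *v lower (y z) + bvec e1 (ref_curv \<Gamma> i (fst z))"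

lemma bvec_diff: "bvec (a - c) (b - d) = bvec a b - bvec (c :: real^'m) (d :: real^'n)"
  by (simp add: block_eq_iff)

lemma stress_eq_iff:
  assumes "flex_mat \<Gamma> i (fst z) \<in> spd"
  shows "stress \<Gamma> i p R z = lower (y z) \<longleftrightarrow> kin (edge_len \<Gamma> i) p R z = strain \<Gamma> i y z"
proof -
  define C where "C = flex_mat \<Gamma> i (fst z)"
  have inv: "invertible C" using assms by (simp add: C_def spd_invertible)
  define b where "b = bvec e1 (ref_curv \<Gamma> i (fst z))"
  have "stress \<Gamma> i p R z = matrix_inv C *v (kin (edge_len \<Gamma> i) p R z - b)"
    by (simp add: stress_def C_def kin_def b_def bvec_diff)
  moreover have "matrix_inv C *v w = w' \<longleftrightarrow> w = C *v w'" for w w'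
    using matrix_inv_mult_vector[OF inv] by metis
  ultimately have "stress \<Gamma> i p R z = lower (y z) \<longleftrightarrow> kin (edge_len \<Gamma> i) p R z - b = C *v lower (y z)"
    by simp
  then show ?thesis
    by (simp add: strain_def diff_eq_eq flip: C_def b_def)
qed

context
  fixes l T :: real and S :: "(real \<times> real) set"
  assumes l: "0 < l" and T: "0 < T"
  defines "S \<equiv> {0..l} \<times> {0..T}"
begin

lemma kinematics:
  assumes p: "C1_on S p" and R: "C1_on S R" and SO: "\<And>z. z \<in> S \<Longrightarrow> R z \<in> SO3"
  shows "has_partials S (\<lambda>z. (p z, R z)) (\<lambda>z. act (p z, R z) (kin l p R z))
    (\<lambda>z. act (p z, R z) (vel T p R z))"
proof (rule has_partials_cong)
  note pp = C1_on_partials(1)[OF l T p[unfolded S_def]]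
  note pR = C1_on_partials(1)[OF l T R[unfolded S_def]]
  show "has_partials S (\<lambda>z. (p z, R z)) (\<lambda>z. (dx l p z, dx l R z)) (\<lambda>z. (dt T p z, dt T R z))"
    unfolding S_def by (intro has_partials_Pair pp pR)
  fix z assume z: "z \<in> S"
  obtain x t where xt: "z = (x, t)" "x \<in> {0..l}" "t \<in> {0..T}" using z by (auto simp: S_def)
  have "dx l R z = R z ** hat (vee (transpose (R z) ** dx l R z))"
    using rotation_derivative[OF l xt(2) _ has_partials_slice(1)[OF pR xt(2,3)]] SO xt
    by (auto simp: S_def)
  then show "act (p z, R z) (kin l p R z) = (dx l p z, dx l R z)"
    using SO3_transpose_mult[OF SO[OF z]] by (simp add: act_def kin_def)
  have "dt T R z = R z ** hat (vee (transpose (R z) ** dt T R z))"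
    using rotation_derivative[OF T xt(3) _ has_partials_slice(2)[OF pR xt(2,3)]] SO xt
    by (auto simp: S_def)
  then show "act (p z, R z) (vel T p R z) = (dt T p z, dt T R z)"
    using SO3_transpose_mult[OF SO[OF z]] by (simp add: act_def vel_def angvel_def)
qed simp

lemma kinematics_unique:
  assumes u: "has_partials S (\<lambda>z. (p z, R z)) (\<lambda>z. act (p z, R z) (k z)) (\<lambda>z. act (p z, R z) (v z))"
    and SO: "R z \<in> SO3" and z: "z \<in> S"
  shows "dx l p z = R z *v upper (k z)" "dx l R z = R z ** hat (lower (k z))"
    "dt T p z = R z *v upper (v z)" "dt T R z = R z ** hat (lower (v z))"
    "kin l p R z = k z" "vel T p R z = v z"
proof -
  note P = has_partials_bounded_linear[OF bounded_linear_fst u, simplified]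
    has_partials_bounded_linear[OF bounded_linear_snd u, simplified]
  show *: "dx l p z = R z *v upper (k z)" "dx l R z = R z ** hat (lower (k z))"
    "dt T p z = R z *v upper (v z)" "dt T R z = R z ** hat (lower (v z))"
    using P[unfolded S_def, THEN has_partials_dx_dt(1)[OF l T]]
      P[unfolded S_def, THEN has_partials_dx_dt(2)[OF l T]] z
    by (auto simp: act_def S_def)
  show "kin l p R z = k z" "vel T p R z = v z"
    unfolding kin_def vel_def angvel_def * SO3_transpose_mult[OF SO] vee_hat by simp_all
qed

lemma C1_on_vel_kin:
  assumes p: "C2_on S p" and R: "C2_on S R"
  shows "C1_on S (vel T p R)" "C1_on S (kin l p R)"
  unfolding vel_def[abs_def] kin_def[abs_def] angvel_def S_def
  by (intro C1_on_bvec C1_on_bounded_bilinear[OF bounded_bilinear_matrix_vector_mult]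
      C1_on_bounded_linear[OF bounded_linear_vee] C2_on_partials[OF l T]
      C1_on_bounded_bilinear[OF bounded_bilinear_matrix_matrix_mult]
      C1_on_bounded_linear[OF bounded_linear_transpose] C2_on_imp_C1_on p[unfolded S_def] R[unfolded S_def])+

text \<open>Equality of the mixed derivatives of \<open>u\<close>, whose partials are
  \<open>act u k\<close> and \<open>act u v\<close>: \<open>act_commutator\<close> produces the
  bracket and \<open>u\<close> cancels. Hence the strain equations hold for every C^2 beam, and only
  the momentum balance remains to be compared.\<close>

lemma kinematics_compat:
  assumes p: "C2_on S p" and R: "C2_on S R" and SO: "\<And>z. z \<in> S \<Longrightarrow> R z \<in> SO3" and z: "z \<in> S"
  shows "dt T (kin l p R) z = dx l (vel T p R) z + bracket (kin l p R z) (vel T p R z)"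
proof -
  define k where "k = kin l p R"
  define v where "v = vel T p R"
  define u where "u z = (p z, R z)" for z
  have k: "C1_on S k" and v: "C1_on S v" using C1_on_vel_kin[OF p R] by (simp_all add: k_def v_def)
  have u: "has_partials S u (\<lambda>z. act (u z) (k z)) (\<lambda>z. act (u z) (v z))"
    using kinematics[OF C2_on_imp_C1_on[OF p] C2_on_imp_C1_on[OF R] SO]
    by (simp add: u_def[abs_def] k_def v_def)
  have C1u: "C1_on S u"
    unfolding u_def by (intro C1_on_Pair C2_on_imp_C1_on p R)
  note pk = C1_on_partials(1)[OF l T k[unfolded S_def]]
  note pv = C1_on_partials(1)[OF l T v[unfolded S_def]]
  have "dt T (\<lambda>z. act (u z) (k z)) z = dx l (\<lambda>z. act (u z) (v z)) z"
    by (rule mixed_partials[OF l T u[unfolded S_def]])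
      (use z C1_on_bounded_bilinear[OF bounded_bilinear_act C1u v] in \<open>auto simp: S_def\<close>)
  also have "dt T (\<lambda>z. act (u z) (k z)) z = act (u z) (dt T k z) + act (act (u z) (v z)) (k z)"
    using has_partials_dx_dt(2)[OF l T has_partials_bounded_bilinear[OF bounded_bilinear_act u[unfolded S_def] pk]] z
    by (simp add: S_def)
  also have "dx l (\<lambda>z. act (u z) (v z)) z = act (u z) (dx l v z) + act (act (u z) (k z)) (v z)"
    using has_partials_dx_dt(1)[OF l T has_partials_bounded_bilinear[OF bounded_bilinear_act u[unfolded S_def] pv]] z
    by (simp add: S_def)
  finally have "act (u z) (dt T k z) = act (u z) (dx l v z + bracket (k z) (v z))"
    unfolding act_commutator[of "u z" "k z" "v z"]
    by (simp add: bounded_bilinear.add_right[OF bounded_bilinear_act])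
  then show ?thesis
    using SO[OF z] by (simp add: act_cancel u_def k_def v_def)
qed

text \<open>Regularity is gained in two rounds: \<open>u\<close> has continuous partials, hence is
  C^1; then its partials \<open>act u k\<close> and \<open>act u v\<close> are C^1, hence
  \<open>u\<close> is C^2. The hypothesis \<open>init\<close> says that the initial shape has strain
  \<open>k\<close> at time 0.\<close>

lemma rigid_motion_exists:
  fixes v k :: "real \<times> real \<Rightarrow> vec6"
  assumes v: "C1_on S v" and k: "C1_on S k"
    and compat: "\<And>x t. 0 < x \<Longrightarrow> x < l \<Longrightarrow> 0 < t \<Longrightarrow> t < T \<Longrightarrow>
      dt T k (x, t) = dx l v (x, t) + bracket (k (x, t)) (v (x, t))"
    and p0: "C1_on {0..l} p0" and R0: "C1_on {0..l} R0" "\<And>x. x \<in> {0..l} \<Longrightarrow> R0 x \<in> SO3"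
    and init: "\<And>x. x \<in> {0..l} \<Longrightarrow> k (x, 0) =
      bvec (transpose (R0 x) *v d_on l p0 x) (vee (transpose (R0 x) ** d_on l R0 x))"
  obtains p R where "C2_on S p" "C2_on S R" "\<And>z. z \<in> S \<Longrightarrow> R z \<in> SO3"
    "has_partials S (\<lambda>z. (p z, R z)) (\<lambda>z. act (p z, R z) (k z)) (\<lambda>z. act (p z, R z) (v z))"
    "\<And>x. x \<in> {0..l} \<Longrightarrow> p (x, 0) = p0 x" "\<And>x. x \<in> {0..l} \<Longrightarrow> R (x, 0) = R0 x"
proof -
  note pv = C1_on_partials[OF l T v[unfolded S_def]]
  note pk = C1_on_partials[OF l T k[unfolded S_def]]
  have contb: "continuous_on S (\<lambda>z. bracket (k z) (v z))"
  proof -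
    have cross: "C1_on S (\<lambda>z. cross3 (f z) (g z))" if "C1_on S f" "C1_on S g" for f g :: "real \<times> real \<Rightarrow> vec3"
      using C1_on_bounded_bilinear[of cross3] bilinear_cross that
      by (simp add: bilinear_conv_bounded_bilinear)
    show ?thesis
      unfolding bracket_def
      by (intro C1_on_imp_continuous_on C1_on_bvec C1_on_diff cross
          C1_on_bounded_linear[OF bounded_linear_upper] C1_on_bounded_linear[OF bounded_linear_lower] v k)
  qed
  \<comment> \<open>Both sides are continuous and agree on the open rectangle, which is dense in
    \<open>S\<close>.\<close>
  have comp: "dt T k z = dx l v z + bracket (k z) (v z)" if z: "z \<in> S" for z
  proof -
    have cl: "closure ({0<..<l} \<times> {0<..<T}) = S"
      using l T by (simp add: closure_Times S_def)
    have "dt T k z - dx l v z - bracket (k z) (v z) = 0"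
      by (rule continuous_constant_on_closure[where S = "{0<..<l} \<times> {0<..<T}"])
        (use z compat pv(2) pk(3) contb in \<open>auto simp: cl S_def intro!: continuous_intros\<close>)
    then show ?thesis by (simp add: algebra_simps)
  qed
  have u0: "((\<lambda>x. (p0 x, R0 x)) has_vector_derivative act (p0 x, R0 x) (k (x, 0))) (at x within {0..l})"
    if x: "x \<in> {0..l}" for x
  proof -
    note d = C1_on_d_on(1)[OF p0 l x] C1_on_d_on(1)[OF R0(1) l x]
    have "act (p0 x, R0 x) (k (x, 0)) = (d_on l p0 x, d_on l R0 x)"
      using rotation_derivative[OF l x R0(2) d(2)] SO3_transpose_mult[OF R0(2)[OF x]]
      by (simp add: act_def init[OF x])
    then show ?thesis
      using has_vector_derivative_Pair[OF d] by simp
  qed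
  obtain u where u: "has_partials S u (\<lambda>z. act (u z) (k z)) (\<lambda>z. act (u z) (v z))"
    and ui: "\<And>x. x \<in> {0..l} \<Longrightarrow> u (x, 0) = (p0 x, R0 x)"
  proof (rule compatible_linear_system_exists[OF bounded_bilinear_act l T pv(1,2) pk(1) _ u0])
    fix z w assume "z \<in> {0..l} \<times> {0..T}"
    then show "act (act w (k z)) (v z) + act w (dx l v z) = act (act w (v z)) (k z) + act w (dt T k z)"
      using comp[of z]
      by (simp add: S_def act_commutator[of w "k z"] bounded_bilinear.add_right[OF bounded_bilinear_act])
  qed (auto simp: S_def)
  define p where "p z = fst (u z)" for z
  define R where "R z = snd (u z)" for z
  have upR: "u = (\<lambda>z. (p z, R z))" by (simp add: p_def R_def)
  have contu: "continuous_on S u"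
    using u unfolding has_partials_def continuous_on_eq_continuous_within
    by (blast dest: has_derivative_continuous)
  have C1u: "C1_on S u"
    by (rule has_partials_C1_on[OF u])
      (intro bounded_bilinear.continuous_on[OF bounded_bilinear_act] contu C1_on_imp_continuous_on v k)+
  have C1s: "C1_on S (\<lambda>z. act (u z) (k z))" "C1_on S (\<lambda>z. act (u z) (v z))"
    by (intro C1_on_bounded_bilinear[OF bounded_bilinear_act] C1u v k)+
  have SO: "R z \<in> SO3" if z: "z \<in> S" for z
  proof -
    obtain x t where xt: "z = (x, t)" "x \<in> {0..l}" "t \<in> {0..T}" using z by (auto simp: S_def)
    have "R (x, t) \<in> SO3"
    proof (rule rotation_ode_SO3[where R = "\<lambda>t. R (x, t)" and \<omega> = "\<lambda>t. lower (v (x, t))"])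
      fix s assume s: "s \<in> {0..T}"
      from has_partials_slice(2)[OF has_partials_bounded_linear[OF bounded_linear_snd u, unfolded S_def] xt(2) s]
      show "((\<lambda>t. R (x, t)) has_vector_derivative R (x, s) ** hat (lower (v (x, s)))) (at s within {0..T})"
        by (simp add: R_def act_def)
    next
      show "R (x, 0) \<in> SO3" using R0(2) ui xt by (simp add: R_def)
    qed (use xt in auto)
    then show ?thesis by (simp add: xt)
  qed
  show thesis
  proof (rule that)
    show "C2_on S p"
      using has_partials_C2_on[OF has_partials_bounded_linear[OF bounded_linear_fst u]]
        C1s[THEN C1_on_bounded_linear[OF bounded_linear_fst]] by (simp add: p_def[abs_def])
    show "C2_on S R"
      using has_partials_C2_on[OF has_partials_bounded_linear[OF bounded_linear_snd u]]
        C1s[THEN C1_on_bounded_linear[OF bounded_linear_snd]] by (simp add: R_def[abs_def])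
    show "has_partials S (\<lambda>z. (p z, R z)) (\<lambda>z. act (p z, R z) (k z)) (\<lambda>z. act (p z, R z) (v z))"
      using u unfolding upR by simp
  qed (use ui SO in \<open>auto simp: p_def R_def\<close>)
qed

text \<open>By \<open>rotated_derivative\<close> each of the four derivatives is \<open>R\<close>
  applied to a moving-frame expression, and \<open>R\<close> also factors out of the cross products;
  cancelling it leaves the balance in the body frame. The mass matrix depends on \<open>x\<close>
  alone and passes through the time derivative.\<close>

lemma momentum_balance_iff:
  assumes len: "edge_len \<Gamma> i = l" and y: "C1_on S y"
    and u: "has_partials S (\<lambda>z. (p z, R z)) (\<lambda>z. act (p z, R z) (k z)) (\<lambda>z. act (p z, R z) (upper (y z)))"
    and SO: "\<And>z. z \<in> S \<Longrightarrow> R z \<in> SO3"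
    and vel: "\<And>z. z \<in> S \<Longrightarrow> vel T p R z = upper (y z)"
    and stress: "\<And>z. z \<in> S \<Longrightarrow> stress \<Gamma> i p R z = lower (y z)"
    and xt: "x \<in> {0..l}" "t \<in> {0..T}"
  shows "dt T (\<lambda>z. upper (momenta \<Gamma> T i p R z)) (x, t) = dx l (\<lambda>z. upper (forces \<Gamma> i p R z)) (x, t) \<and>
    cross3 (dt T p (x, t)) (upper (momenta \<Gamma> T i p R (x, t))) + dt T (\<lambda>z. lower (momenta \<Gamma> T i p R z)) (x, t) =
    cross3 (dx l p (x, t)) (upper (forces \<Gamma> i p R (x, t))) + dx l (\<lambda>z. lower (forces \<Gamma> i p R z)) (x, t) \<longleftrightarrow>
    mass_mat \<Gamma> i x *v upper (dt T y (x, t)) + coad (upper (y (x, t))) (mass_mat \<Gamma> i x *v upper (y (x, t))) =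
    lower (dx l y (x, t)) + coad (k (x, t)) (lower (y (x, t)))"
proof -
  define M where "M = mass_mat \<Gamma> i x"
  have z: "(x, t) \<in> S" using xt by (simp add: S_def)
  note py = C1_on_partials(1)[OF l T y[unfolded S_def]]
  have yt: "((\<lambda>s. M *v upper (y (x, s))) has_vector_derivative M *v upper (dt T y (x, t))) (at t within {0..T})"
    by (intro bounded_linear.has_vector_derivative[OF matrix_vector_mul_bounded_linear]
        bounded_linear.has_vector_derivative[OF bounded_linear_upper] has_partials_slice(2)[OF py xt])
  have yx: "((\<lambda>\<xi>. lower (y (\<xi>, t))) has_vector_derivative lower (dx l y (x, t))) (at x within {0..l})"
    by (intro bounded_linear.has_vector_derivative[OF bounded_linear_lower] has_partials_slice(1)[OF py xt])
  note pR = has_partials_bounded_linear[OF bounded_linear_snd u, simplified, unfolded S_def act_def snd_conv]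
  note Rt = has_partials_slice(2)[OF pR xt] and Rx = has_partials_slice(1)[OF pR xt]
  have mom: "momenta \<Gamma> T i p R (x, s) = bdiag (R (x, s)) (R (x, s)) *v (M *v upper (y (x, s)))"
    if "s \<in> {0..T}" for s
    using vel[of "(x, s)"] xt that by (simp add: momenta_def S_def M_def flip: matrix_vector_mul_assoc)
  have force: "forces \<Gamma> i p R (\<xi>, t) = bdiag (R (\<xi>, t)) (R (\<xi>, t)) *v lower (y (\<xi>, t))"
    if "\<xi> \<in> {0..l}" for \<xi>
    using stress[of "(\<xi>, t)"] xt that by (simp add: forces_def S_def)
  have at: "dt T (\<lambda>z. upper (momenta \<Gamma> T i p R z)) (x, t) =
      R (x, t) *v (upper (M *v upper (dt T y (x, t))) + cross3 (lower (upper (y (x, t)))) (upper (M *v upper (y (x, t)))))"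
    by (rule dt_eqI[OF _ T xt(2)], rule has_vector_derivative_transform[OF xt(2)], subst mom, assumption,
        subst upper_bdiag, rule refl,
        rule rotated_derivative[OF Rt bounded_linear.has_vector_derivative[OF bounded_linear_upper yt]])
  have bt: "dt T (\<lambda>z. lower (momenta \<Gamma> T i p R z)) (x, t) =
      R (x, t) *v (lower (M *v upper (dt T y (x, t))) + cross3 (lower (upper (y (x, t)))) (lower (M *v upper (y (x, t)))))"
    by (rule dt_eqI[OF _ T xt(2)], rule has_vector_derivative_transform[OF xt(2)], subst mom, assumption,
        subst lower_bdiag, rule refl,
        rule rotated_derivative[OF Rt bounded_linear.has_vector_derivative[OF bounded_linear_lower yt]])
  have \<phi>x: "dx l (\<lambda>z. upper (forces \<Gamma> i p R z)) (x, t) =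
      R (x, t) *v (upper (lower (dx l y (x, t))) + cross3 (lower (k (x, t))) (upper (lower (y (x, t)))))"
    by (rule dx_eqI[OF _ l xt(1)], rule has_vector_derivative_transform[OF xt(1)], subst force, assumption,
        subst upper_bdiag, rule refl,
        rule rotated_derivative[OF Rx bounded_linear.has_vector_derivative[OF bounded_linear_upper yx]])
  have \<psi>x: "dx l (\<lambda>z. lower (forces \<Gamma> i p R z)) (x, t) =
      R (x, t) *v (lower (lower (dx l y (x, t))) + cross3 (lower (k (x, t))) (lower (lower (y (x, t)))))"
    by (rule dx_eqI[OF _ l xt(1)], rule has_vector_derivative_transform[OF xt(1)], subst force, assumption,
        subst lower_bdiag, rule refl,
        rule rotated_derivative[OF Rx bounded_linear.has_vector_derivative[OF bounded_linear_lower yx]])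
  note pd = kinematics_unique(1,3)[OF u SO[OF z] z]
  show ?thesis
    unfolding at bt \<phi>x \<psi>x pd mom[OF xt(2)] force[OF xt(1)] upper_bdiag
    unfolding SO3_cross[OF SO[OF z]] matrix_vector_right_distrib[symmetric] SO3_cancel[OF SO[OF z]]
    by (simp add: coad_def block_eq_iff M_def algebra_simps)
qed

end


section \<open>The network\<close>

lemma d_on_cong:
  assumes "\<And>s. s \<in> {0..L} \<Longrightarrow> f s = g s" "s \<in> {0..L}"
  shows "d_on L f s = d_on L g s"
proof -
  have "(f has_vector_derivative d) (at s within {0..L}) \<longleftrightarrow>
      (g has_vector_derivative d) (at s within {0..L})" for d
    using has_vector_derivative_transform[OF assms(2), of f g d]
      has_vector_derivative_transform[OF assms(2), of g f d] assms(1) by auto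
  then show ?thesis by (simp add: d_on_def vector_derivative_def)
qed

text \<open>For \<open>r\<close> constant in time, the right side is the time derivative of
  \<open>(p, R ** transpose r)\<close> when \<open>(p, R)\<close> has body velocity
  \<open>c\<close>. So the rotated frame has velocity \<open>bdiag r r *v c\<close>, which is what
  continuity at a node compares.\<close>

lemma act_rotate:
  assumes "r \<in> SO3"
  shows "act (p, R ** transpose r) (bdiag r r *v c) = (R *v upper c, R ** hat (lower c) ** transpose r)"
proof -
  have "R ** transpose r ** (r ** hat (lower c) ** transpose r) = R ** (transpose r ** r) ** hat (lower c) ** transpose r"
    by (simp add: matrix_mul_assoc)
  then show ?thesis
    by (simp add: act_def hat_rotate[OF assms] SO3_transpose_mult[OF assms] SO3_orthogonal[OF assms]
        flip: matrix_vector_mul_assoc)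
qed

text \<open>From left to right the curves are differentiated on the open interval, where they
  coincide, and the rotation is cancelled; from right to left both solve the linear equation with
  coefficient \<open>c\<close>. The lemma serves multiple nodes and Dirichlet nodes alike.\<close>

lemma act_curves_agree_iff:
  assumes T: "0 < T" and c: "continuous_on {0..T} c"
    and U: "\<And>t. t \<in> {0..T} \<Longrightarrow> (U has_vector_derivative act (U t) (c t)) (at t within {0..T})"
    and V: "\<And>t. t \<in> {0..T} \<Longrightarrow> (V has_vector_derivative act (V t) (d t)) (at t within {0..T})"
    and SO: "\<And>t. t \<in> {0..T} \<Longrightarrow> snd (U t) \<in> SO3" and init: "U 0 = V 0"
  shows "(\<forall>t\<in>{0<..<T}. U t = V t) \<longleftrightarrow> (\<forall>t\<in>{0<..<T}. c t = d t)"
proof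
  assume eq: "\<forall>t\<in>{0<..<T}. U t = V t"
  show "\<forall>t\<in>{0<..<T}. c t = d t"
  proof
    fix t assume t: "t \<in> {0<..<T}"
    have "(U has_vector_derivative act (U t) (c t)) (at t within {0<..<T})"
      by (rule has_vector_derivative_within_subset[OF U]) (use t in auto)
    moreover have "(U has_vector_derivative act (U t) (d t)) (at t within {0<..<T})"
    proof (rule has_vector_derivative_transform[OF t])
      show "\<And>s. s \<in> {0<..<T} \<Longrightarrow> U s = V s" using eq by blast
      have "(V has_vector_derivative act (V t) (d t)) (at t within {0<..<T})"
        by (rule has_vector_derivative_within_subset[OF V]) (use t in auto)
      then show "(V has_vector_derivative act (U t) (d t)) (at t within {0<..<T})"
        using eq t by simp
    qed
    ultimately have "act (U t) (c t) = act (U t) (d t)"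
      using t by (auto simp: at_within_open[OF t open_greaterThanLessThan] intro: vector_derivative_unique_at)
    then show "c t = d t"
      using act_cancel SO[of t] t by simp
  qed
next
  assume eq: "\<forall>t\<in>{0<..<T}. c t = d t"
  show "\<forall>t\<in>{0<..<T}. U t = V t"
  proof
    fix t assume t: "t \<in> {0<..<T}"
    have at: "at s within {0..T} = at s" if "0 < s" "s < T" for s :: real
      using that by (simp add: at_within_Icc_at)
    show "U t = V t"
    proof (rule linear_ode_unique[OF bounded_bilinear_act c, where u = U and v = V])
      show "continuous_on {0..T} U" using U by (rule continuous_on_vector_derivative)
      show "continuous_on {0..T} V" using V by (rule continuous_on_vector_derivative)
      show "(U has_vector_derivative act (U s) (c s)) (at s)" if "0 < s" "s < T" for s
        using U[of s] at[OF that] that by simp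
      show "(V has_vector_derivative act (V s) (c s)) (at s)" if "0 < s" "s < T" for s
        using V[of s] at[OF that] that eq by simp
    qed (use t init in auto)
  qed
qed

lemma first_edge_incident:
  assumes "n \<in> multiple_nodes \<Gamma> \<union> simple_nodes \<Gamma>"
  shows "first_edge \<Gamma> n \<in> incident \<Gamma> n"
proof -
  have "card (incident \<Gamma> n) \<noteq> 0"
    using assms by (auto simp: multiple_nodes_def simple_nodes_def)
  then show ?thesis
    unfolding first_edge_def by (metis Min_in card.empty card.infinite)
qed

text \<open>The unknowns are not among the fixed data, because the lemmas are applied both to the
  given intrinsic solution and to the transform of a competing solution.\<close>

locale beam_data =
  fixes N :: nat and \<Gamma> :: "'v beam_net" and T :: real
    and p0 p1 w0 :: "nat \<Rightarrow> real \<Rightarrow> real^3" and R0 :: "nat \<Rightarrow> real \<Rightarrow> real^3^3"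
    and y0 :: "nat \<Rightarrow> real \<Rightarrow> vec12"
    and q :: "'v \<Rightarrow> real \<Rightarrow> vec6"
    and f :: "(nat \<Rightarrow> real \<times> real \<Rightarrow> real^3^3) \<Rightarrow> 'v \<Rightarrow> real \<Rightarrow> vec6"
    and fp :: "'v \<Rightarrow> real \<Rightarrow> real^3" and fR :: "'v \<Rightarrow> real \<Rightarrow> real^3^3"
  assumes network: "is_beam_network N \<Gamma>" and T: "0 < T"
    and params: "\<And>i. i \<in> edges \<Gamma> \<Longrightarrow>
      C1_on {0..edge_len \<Gamma> i} (mass_mat \<Gamma> i) \<and> mass_mat \<Gamma> i ` {0..edge_len \<Gamma> i} \<subseteq> spd \<and>
      C1_on {0..edge_len \<Gamma> i} (flex_mat \<Gamma> i) \<and> flex_mat \<Gamma> i ` {0..edge_len \<Gamma> i} \<subseteq> spd \<and>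
      C2_on {0..edge_len \<Gamma> i} (ref_rot \<Gamma> i) \<and> ref_rot \<Gamma> i ` {0..edge_len \<Gamma> i} \<subseteq> SO3"
    and init_reg: "\<And>i. i \<in> edges \<Gamma> \<Longrightarrow>
      C2_on {0..edge_len \<Gamma> i} (p0 i) \<and>
      C2_on {0..edge_len \<Gamma> i} (R0 i) \<and> R0 i ` {0..edge_len \<Gamma> i} \<subseteq> SO3 \<and>
      C1_on {0..edge_len \<Gamma> i} (p1 i) \<and> C1_on {0..edge_len \<Gamma> i} (w0 i)"
    and y0: "\<And>i x. i \<in> edges \<Gamma> \<Longrightarrow> x \<in> {0..edge_len \<Gamma> i} \<Longrightarrow>
      y0 i x =
        bvec (bvec (transpose (R0 i x) *v p1 i x) (transpose (R0 i x) *v w0 i x))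
             (matrix_inv (flex_mat \<Gamma> i x) *v
                bvec (transpose (R0 i x) *v d_on (edge_len \<Gamma> i) (p0 i) x - e1)
                     (vee (transpose (R0 i x) ** d_on (edge_len \<Gamma> i) (R0 i) x) - ref_curv \<Gamma> i x))"
    and neumann_simple: "\<And>R n t. n \<in> neumann_nodes \<Gamma> \<Longrightarrow> t \<in> {0..T} \<Longrightarrow>
      f R n t =
        (let k = first_edge \<Gamma> n; xk = end_pos \<Gamma> n k
         in bdiag (R k (xk, t)) (R k (xk, t)) *v q n t)"
    and neumann_multiple: "\<And>R n t. n \<in> multiple_nodes \<Gamma> \<Longrightarrow> t \<in> {0..T} \<Longrightarrow>
      f R n t =
        (let k = first_edge \<Gamma> n; xk = end_pos \<Gamma> n k;
             S = R k (xk, t) ** transpose (ref_rot \<Gamma> k xk)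
         in bdiag S S *v q n t)"
    and dirichlet_reg: "\<And>n. n \<in> dirichlet_nodes \<Gamma> \<Longrightarrow>
      C2_on {0..T} (fp n) \<and> C2_on {0..T} (fR n) \<and> fR n ` {0..T} \<subseteq> SO3"
    and dirichlet_q: "\<And>n t. n \<in> dirichlet_nodes \<Gamma> \<Longrightarrow> t \<in> {0..T} \<Longrightarrow>
      q n t = bvec (transpose (fR n t) *v d_on T (fp n) t)
                   (vee (transpose (fR n t) ** d_on T (fR n) t))"
    and compat_dirichlet: "\<And>n. n \<in> dirichlet_nodes \<Gamma> \<Longrightarrow>
      (let k = first_edge \<Gamma> n; xk = end_pos \<Gamma> n k
       in fp n 0 = p0 k xk \<and> fR n 0 = R0 k xk)"
    and compat_multiple: "\<And>n i. n \<in> multiple_nodes \<Gamma> \<Longrightarrow> i \<in> incident \<Gamma> n \<Longrightarrow>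
      (let k = first_edge \<Gamma> n; xi = end_pos \<Gamma> n i; xk = end_pos \<Gamma> n k
       in p0 i xi = p0 k xk \<and>
          R0 i xi ** transpose (ref_rot \<Gamma> i xi) = R0 k xk ** transpose (ref_rot \<Gamma> k xk))"
begin

lemma len_pos: "i \<in> edges \<Gamma> \<Longrightarrow> 0 < edge_len \<Gamma> i"
  using network by (auto simp: is_beam_network_def)

lemma dirichlet_simple: "n \<in> dirichlet_nodes \<Gamma> \<Longrightarrow> n \<in> simple_nodes \<Gamma>"
  using network by (auto simp: is_beam_network_def)

lemma mass_spd: "i \<in> edges \<Gamma> \<Longrightarrow> x \<in> {0..edge_len \<Gamma> i} \<Longrightarrow> mass_mat \<Gamma> i x \<in> spd"
  and flex_spd: "i \<in> edges \<Gamma> \<Longrightarrow> x \<in> {0..edge_len \<Gamma> i} \<Longrightarrow> flex_mat \<Gamma> i x \<in> spd"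
  and ref_SO3: "i \<in> edges \<Gamma> \<Longrightarrow> x \<in> {0..edge_len \<Gamma> i} \<Longrightarrow> ref_rot \<Gamma> i x \<in> SO3"
  and R0_SO3: "i \<in> edges \<Gamma> \<Longrightarrow> x \<in> {0..edge_len \<Gamma> i} \<Longrightarrow> R0 i x \<in> SO3"
  using params[of i] init_reg[of i] by (simp_all add: image_subset_iff)

lemma end_pos_in:
  assumes "i \<in> incident \<Gamma> n"
  shows "i \<in> edges \<Gamma>" "end_pos \<Gamma> n i \<in> {0..edge_len \<Gamma> i}"
  using assms len_pos[of i] by (auto simp: incident_def end_pos_def)

lemma C1_on_ref_curv:
  assumes i: "i \<in> edges \<Gamma>"
  shows "C1_on {0..edge_len \<Gamma> i} (ref_curv \<Gamma> i)"
proof -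
  have r: "C2_on {0..edge_len \<Gamma> i} (ref_rot \<Gamma> i)" using params[OF i] by simp
  show ?thesis
    unfolding ref_curv_def[abs_def]
    by (rule C1_on_bounded_linear[OF bounded_linear_vee]
        C1_on_bounded_bilinear[OF bounded_bilinear_matrix_matrix_mult]
        C1_on_bounded_linear[OF bounded_linear_transpose] C2_on_imp_C1_on[OF r]
        C2_on_d_on[OF r len_pos[OF i]])+
qed

lemma C1_on_strain:
  assumes i: "i \<in> edges \<Gamma>" and y: "C1_on (rect \<Gamma> T i) y"
  shows "C1_on (rect \<Gamma> T i) (strain \<Gamma> i y)"
proof -
  have "C1_on {0..edge_len \<Gamma> i} (flex_mat \<Gamma> i)" using params[OF i] by simp
  then show ?thesis
    unfolding strain_def[abs_def] rect_def
    by (intro C1_on_add C1_on_bounded_bilinear[OF bounded_bilinear_matrix_vector_mult]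
        C1_on_bounded_linear[OF bounded_linear_lower] C1_on_bvec C1_on_const
        C1_on_fst[where f = "flex_mat \<Gamma> i"] C1_on_fst[OF C1_on_ref_curv[OF i]] y[unfolded rect_def])
qed

lemma dt_strain:
  assumes i: "i \<in> edges \<Gamma>" and y: "C1_on (rect \<Gamma> T i) y"
    and x: "x \<in> {0..edge_len \<Gamma> i}" and t: "t \<in> {0..T}"
  shows "dt T (strain \<Gamma> i y) (x, t) = flex_mat \<Gamma> i x *v lower (dt T y (x, t))"
proof (rule dt_eqI[OF _ T t])
  note py = C1_on_partials(1)[OF len_pos[OF i] T y[unfolded rect_def]]
  have "((\<lambda>s. flex_mat \<Gamma> i x *v lower (y (x, s)) + bvec e1 (ref_curv \<Gamma> i x)) has_vector_derivative
      flex_mat \<Gamma> i x *v lower (dt T y (x, t)) + 0) (at t within {0..T})"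
    by (intro has_vector_derivative_add has_vector_derivative_const
        bounded_linear.has_vector_derivative[OF matrix_vector_mul_bounded_linear]
        bounded_linear.has_vector_derivative[OF bounded_linear_lower] has_partials_slice(2)[OF py x t])
  then show "((\<lambda>s. strain \<Gamma> i y (x, s)) has_vector_derivative
      flex_mat \<Gamma> i x *v lower (dt T y (x, t))) (at t within {0..T})"
    by (simp add: strain_def)
qed

text \<open>\<open>realizes i y p R\<close>: the intrinsic unknown \<open>y\<close> consists of the velocities and stresses of
  the beam \<open>i\<close> with centerline \<open>p\<close> and cross sections \<open>R\<close>.\<close>

definition realizes :: "nat \<Rightarrow> (real \<times> real \<Rightarrow> vec12) \<Rightarrow> (real \<times> real \<Rightarrow> vec3) \<Rightarrow> (real \<times> real \<Rightarrow> mat3) \<Rightarrow> bool" where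
  "realizes i y p R \<longleftrightarrow> C1_on (rect \<Gamma> T i) y \<and> C2_on (rect \<Gamma> T i) p \<and> C2_on (rect \<Gamma> T i) R \<and>
     R ` rect \<Gamma> T i \<subseteq> SO3 \<and>
     has_partials (rect \<Gamma> T i) (\<lambda>z. (p z, R z)) (\<lambda>z. act (p z, R z) (strain \<Gamma> i y z))
       (\<lambda>z. act (p z, R z) (upper (y z)))"

lemma realizesD:
  assumes i: "i \<in> edges \<Gamma>" and r: "realizes i y p R" and z: "z \<in> rect \<Gamma> T i"
  shows "R z \<in> SO3" "vel T p R z = upper (y z)" "stress \<Gamma> i p R z = lower (y z)"
    "kin (edge_len \<Gamma> i) p R z = strain \<Gamma> i y z"
    "dt T p z = R z *v upper (upper (y z))"
proof -
  show SO: "R z \<in> SO3" using r z by (auto simp: realizes_def)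
  note u = r[unfolded realizes_def rect_def, THEN conjunct2, THEN conjunct2, THEN conjunct2, THEN conjunct2]
  note K = kinematics_unique[OF len_pos[OF i] T u SO z[unfolded rect_def]]
  show "vel T p R z = upper (y z)" "kin (edge_len \<Gamma> i) p R z = strain \<Gamma> i y z"
    "dt T p z = R z *v upper (upper (y z))"
    using K by simp_all
  then show "stress \<Gamma> i p R z = lower (y z)"
    using stress_eq_iff[of \<Gamma> i z p R y] flex_spd[OF i] z by (auto simp: rect_def)
qed

text \<open>Meant for a competing solution, whose transform must qualify as an unknown of the
  intrinsic system. That the stress is C^1 rests on the same regularity of the inverse flexibility
  and of the reference curvature, which costs one derivative of \<open>ref_rot\<close>.\<close>

lemma realizesI:
  assumes i: "i \<in> edges \<Gamma>" and p: "C2_on (rect \<Gamma> T i) p" and R: "C2_on (rect \<Gamma> T i) R"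
    and SO: "R ` rect \<Gamma> T i \<subseteq> SO3"
  shows "realizes i (\<lambda>z. bvec (vel T p R z) (stress \<Gamma> i p R z)) p R"
proof -
  let ?l = "edge_len \<Gamma> i" and ?S = "rect \<Gamma> T i" and ?y = "\<lambda>z. bvec (vel T p R z) (stress \<Gamma> i p R z)"
  note lp = len_pos[OF i]
  note vk = C1_on_vel_kin[OF lp T p[unfolded rect_def] R[unfolded rect_def], folded rect_def]
  have flex: "C1_on {0..?l} (\<lambda>x. matrix_inv (flex_mat \<Gamma> i x))"
    using params[OF i] spd_invertible[OF flex_spd[OF i]]
    by (intro C1_on_matrix_inv) (auto simp: invertible_det_nz)
  have "C1_on ?S (\<lambda>z. matrix_inv (flex_mat \<Gamma> i (fst z)) *v (kin ?l p R z - bvec e1 (ref_curv \<Gamma> i (fst z))))"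
    using C1_on_fst[OF flex, of "{0..T}"] C1_on_fst[OF C1_on_ref_curv[OF i], of "{0..T}"]
    by (intro C1_on_bounded_bilinear[OF bounded_bilinear_matrix_vector_mult] C1_on_diff vk(2)
        C1_on_bvec C1_on_const) (simp_all add: rect_def)
  then have "C1_on ?S (stress \<Gamma> i p R)"
    by (rule C1_on_cong) (simp add: stress_def kin_def flip: bvec_diff)
  then have y: "C1_on ?S ?y"
    by (intro C1_on_bvec vk(1))
  have "kin ?l p R z = strain \<Gamma> i ?y z" if "z \<in> ?S" for z
    using stress_eq_iff[of \<Gamma> i z p R ?y] flex_spd[OF i] that by (auto simp: rect_def)
  then have "has_partials ?S (\<lambda>z. (p z, R z)) (\<lambda>z. act (p z, R z) (strain \<Gamma> i ?y z))
      (\<lambda>z. act (p z, R z) (upper (?y z)))"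
    using SO
    by (intro has_partials_cong[OF kinematics[OF lp T C2_on_imp_C1_on C2_on_imp_C1_on, folded rect_def, OF p R]])
      auto
  then show ?thesis
    using y p R SO by (simp add: realizes_def)
qed

lemma realizes_trace:
  assumes i: "i \<in> edges \<Gamma>" and r: "realizes i y p R"
    and x: "x \<in> {0..edge_len \<Gamma> i}" and t: "t \<in> {0..T}"
  shows "((\<lambda>t. (p (x, t), R (x, t))) has_vector_derivative act (p (x, t), R (x, t)) (upper (y (x, t))))
    (at t within {0..T})"
proof -
  have "has_partials ({0..edge_len \<Gamma> i} \<times> {0..T}) (\<lambda>z. (p z, R z))
      (\<lambda>z. act (p z, R z) (strain \<Gamma> i y z)) (\<lambda>z. act (p z, R z) (upper (y z)))"
    using r by (simp add: realizes_def rect_def)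
  from has_partials_slice(2)[OF this x t] show ?thesis .
qed

lemma realizes_rotated_trace:
  assumes i: "i \<in> edges \<Gamma>" and r: "realizes i y p R"
    and x: "x \<in> {0..edge_len \<Gamma> i}" and t: "t \<in> {0..T}"
  shows "((\<lambda>t. (p (x, t), R (x, t) ** transpose (ref_rot \<Gamma> i x))) has_vector_derivative
    act (p (x, t), R (x, t) ** transpose (ref_rot \<Gamma> i x)) (Rbar \<Gamma> i x *v upper (y (x, t))))
    (at t within {0..T})"
proof -
  let ?r = "ref_rot \<Gamma> i x"
  note d = realizes_trace[OF i r x t]
  have "linear (\<lambda>u :: vec3 \<times> mat3. (fst u, snd u ** transpose ?r))"
    by (rule linearI) (auto simp: bounded_bilinear.add_left[OF bounded_bilinear_matrix_matrix_mult]
        bounded_bilinear.scaleR_left[OF bounded_bilinear_matrix_matrix_mult])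
  then have "bounded_linear (\<lambda>u :: vec3 \<times> mat3. (fst u, snd u ** transpose ?r))"
    by (simp add: linear_conv_bounded_linear)
  from bounded_linear.has_vector_derivative[OF this d] show ?thesis
    unfolding Rbar_def act_rotate[OF ref_SO3[OF i x]] by (simp add: act_def)
qed

lemma realizes_continuous_trace:
  assumes r: "realizes i y p R" and x: "x \<in> {0..edge_len \<Gamma> i}"
  shows "continuous_on {0..T} (\<lambda>t. y (x, t))"
proof -
  have "continuous_on (rect \<Gamma> T i) y"
    using r C1_on_imp_continuous_on by (auto simp: realizes_def)
  then show ?thesis
    by (rule continuous_on_compose2) (use x in \<open>auto simp: rect_def intro!: continuous_intros\<close>)
qed

text \<open>For a beam realizing \<open>y\<close> the lower six equations hold by
  \<open>kinematics_compat\<close>, so the intrinsic equation reduces to its upper six, which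
  \<open>momentum_balance_iff\<close> compares with the balance laws.\<close>

lemma realizes_pde_iff:
  assumes i: "i \<in> edges \<Gamma>" and r: "realizes i y p R"
    and x: "x \<in> {0..edge_len \<Gamma> i}" and t: "t \<in> {0..T}"
  shows "dt T y (x, t) + Amat \<Gamma> i x *v dx (edge_len \<Gamma> i) y (x, t) + Bmat \<Gamma> i x *v y (x, t) =
      gfun \<Gamma> i x (y (x, t)) \<longleftrightarrow>
    dt T (\<lambda>z. upper (momenta \<Gamma> T i p R z)) (x, t) = dx (edge_len \<Gamma> i) (\<lambda>z. upper (forces \<Gamma> i p R z)) (x, t) \<and>
    cross3 (dt T p (x, t)) (upper (momenta \<Gamma> T i p R (x, t))) + dt T (\<lambda>z. lower (momenta \<Gamma> T i p R z)) (x, t) =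
    cross3 (dx (edge_len \<Gamma> i) p (x, t)) (upper (forces \<Gamma> i p R (x, t))) +
      dx (edge_len \<Gamma> i) (\<lambda>z. lower (forces \<Gamma> i p R z)) (x, t)"
proof -
  let ?l = "edge_len \<Gamma> i"
  note lp = len_pos[OF i]
  have rr: "C1_on (rect \<Gamma> T i) y" "C2_on (rect \<Gamma> T i) p" "C2_on (rect \<Gamma> T i) R"
    "has_partials (rect \<Gamma> T i) (\<lambda>z. (p z, R z)) (\<lambda>z. act (p z, R z) (strain \<Gamma> i y z))
       (\<lambda>z. act (p z, R z) (upper (y z)))"
    using r by (auto simp: realizes_def)
  note D = realizesD[OF i r]
  have z: "(x, t) \<in> rect \<Gamma> T i" using x t by (simp add: rect_def)
  have "flex_mat \<Gamma> i x *v lower (dt T y (x, t)) = dt T (strain \<Gamma> i y) (x, t)"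
    using dt_strain[OF i rr(1) x t] by simp
  also have "\<dots> = dt T (kin ?l p R) (x, t)"
    unfolding dt_def prod.case by (rule d_on_cong) (use D(4) x t in \<open>auto simp: rect_def\<close>)
  also have "\<dots> = dx ?l (vel T p R) (x, t) + bracket (kin ?l p R (x, t)) (vel T p R (x, t))"
    using kinematics_compat[OF lp T rr(2,3)[unfolded rect_def]] D(1) z by (simp add: rect_def)
  also have "dx ?l (vel T p R) (x, t) = dx ?l (\<lambda>z. upper (y z)) (x, t)"
    unfolding dx_def prod.case by (rule d_on_cong) (use D(2) x t in \<open>auto simp: rect_def\<close>)
  also have "\<dots> = upper (dx ?l y (x, t))"
    by (intro dx_eqI[OF _ lp x] bounded_linear.has_vector_derivative[OF bounded_linear_upper]
        has_partials_slice(1)[OF C1_on_partials(1)[OF lp T rr(1)[unfolded rect_def]] x t])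
  finally have compat: "flex_mat \<Gamma> i x *v lower (dt T y (x, t)) =
      upper (dx ?l y (x, t)) + bracket (strain \<Gamma> i y (x, t)) (upper (y (x, t)))"
    using D(2,4)[OF z] by simp
  show ?thesis
    unfolding intrinsic_pde_iff[OF mass_spd[OF i x] flex_spd[OF i x]]
    using compat momentum_balance_iff[OF lp T refl rr(1)[unfolded rect_def] rr(4)[unfolded rect_def] _ _ _ x t]
      D(1-3)
    by (simp add: strain_def rect_def)
qed

section \<open>Transfer of the node and initial conditions, given the initial shape\<close>

context
  fixes y :: "nat \<Rightarrow> real \<times> real \<Rightarrow> vec12"
    and p :: "nat \<Rightarrow> real \<times> real \<Rightarrow> vec3" and R :: "nat \<Rightarrow> real \<times> real \<Rightarrow> mat3"
  assumes real: "\<And>i. i \<in> edges \<Gamma> \<Longrightarrow> realizes i (y i) (p i) (R i)"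
    and p_init: "\<And>i x. i \<in> edges \<Gamma> \<Longrightarrow> x \<in> {0..edge_len \<Gamma> i} \<Longrightarrow> p i (x, 0) = p0 i x"
    and R_init: "\<And>i x. i \<in> edges \<Gamma> \<Longrightarrow> x \<in> {0..edge_len \<Gamma> i} \<Longrightarrow> R i (x, 0) = R0 i x"
begin

lemma continuity_iff:
  assumes n: "n \<in> multiple_nodes \<Gamma>" and i: "i \<in> incident \<Gamma> n"
  defines "k \<equiv> first_edge \<Gamma> n"
  defines "xi \<equiv> end_pos \<Gamma> n i" and "xk \<equiv> end_pos \<Gamma> n k"
  shows "(\<forall>t\<in>{0<..<T}. Rbar \<Gamma> i xi *v upper (y i (xi, t)) = Rbar \<Gamma> k xk *v upper (y k (xk, t))) \<longleftrightarrow>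
    (\<forall>t\<in>{0<..<T}. p i (xi, t) = p k (xk, t) \<and>
      R i (xi, t) ** transpose (ref_rot \<Gamma> i xi) = R k (xk, t) ** transpose (ref_rot \<Gamma> k xk))"
proof -
  have k: "k \<in> incident \<Gamma> n" using first_edge_incident[of n \<Gamma>] n by (simp add: k_def)
  note ei = end_pos_in[OF i, folded xi_def] and ek = end_pos_in[OF k, folded xk_def]
  have "continuous_on {0..T} (\<lambda>t. Rbar \<Gamma> i xi *v upper (y i (xi, t)))"
    by (intro bounded_linear.continuous_on[OF matrix_vector_mul_bounded_linear]
        bounded_linear.continuous_on[OF bounded_linear_upper]
        realizes_continuous_trace[OF real[OF ei(1)] ei(2)])
  moreover have "R i (xi, t) ** transpose (ref_rot \<Gamma> i xi) \<in> SO3" if "t \<in> {0..T}" for t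
    using realizesD(1)[OF ei(1) real[OF ei(1)]] that ei(2)
    by (intro SO3_mult SO3_transpose ref_SO3 ei) (simp add: rect_def)
  moreover have "(p i (xi, 0), R i (xi, 0) ** transpose (ref_rot \<Gamma> i xi)) =
      (p k (xk, 0), R k (xk, 0) ** transpose (ref_rot \<Gamma> k xk))"
    using compat_multiple[OF n i] p_init[OF ei] p_init[OF ek] R_init[OF ei] R_init[OF ek]
    by (simp add: Let_def flip: k_def xi_def xk_def)
  ultimately show ?thesis
    using act_curves_agree_iff[OF T _ realizes_rotated_trace[OF ei(1) real[OF ei(1)] ei(2)]
      realizes_rotated_trace[OF ek(1) real[OF ek(1)] ek(2)]]
    by simp
qed

text \<open>Continuity gives the edges at \<open>n\<close> a common rotation \<open>Q\<close>, with
  each \<open>R i\<close> equal to \<open>Q\<close> times the reference rotation there, so the sum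
  of forces is the intrinsic sum rotated blockwise by \<open>Q\<close>. The datum \<open>f\<close>
  at a multiple node is \<open>q\<close> rotated by the same \<open>Q\<close>, which
  cancels.\<close>

lemma balance_iff:
  assumes n: "n \<in> multiple_nodes \<Gamma>" and t: "t \<in> {0<..<T}"
  defines "k \<equiv> first_edge \<Gamma> n"
  defines "xk \<equiv> end_pos \<Gamma> n k"
  assumes cont: "\<And>i. i \<in> incident \<Gamma> n \<Longrightarrow>
      R i (end_pos \<Gamma> n i, t) ** transpose (ref_rot \<Gamma> i (end_pos \<Gamma> n i)) =
      R k (xk, t) ** transpose (ref_rot \<Gamma> k xk)"
  shows "(\<Sum>i\<in>incident \<Gamma> n. end_sign \<Gamma> n i *\<^sub>R
        (Rbar \<Gamma> i (end_pos \<Gamma> n i) *v lower (y i (end_pos \<Gamma> n i, t)))) = q n t \<longleftrightarrow>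
    (\<Sum>i\<in>incident \<Gamma> n. end_sign \<Gamma> n i *\<^sub>R
        forces \<Gamma> i (p i) (R i) (end_pos \<Gamma> n i, t)) = f R n t"
proof -
  define Q where "Q = R k (xk, t) ** transpose (ref_rot \<Gamma> k xk)"
  have k: "k \<in> incident \<Gamma> n" using first_edge_incident[of n \<Gamma>] n by (simp add: k_def)
  note ek = end_pos_in[OF k, folded xk_def]
  have Q: "Q \<in> SO3"
    using realizesD(1)[OF ek(1) real[OF ek(1)], of "(xk, t)"] ek ref_SO3[OF ek] t
    by (auto simp: Q_def rect_def intro!: SO3_mult SO3_transpose)
  have "forces \<Gamma> i (p i) (R i) (end_pos \<Gamma> n i, t) =
      bdiag Q Q *v (Rbar \<Gamma> i (end_pos \<Gamma> n i) *v lower (y i (end_pos \<Gamma> n i, t)))"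
    if i: "i \<in> incident \<Gamma> n" for i
  proof -
    let ?x = "end_pos \<Gamma> n i"
    note ei = end_pos_in[OF i]
    have "Q ** ref_rot \<Gamma> i ?x = R i (?x, t)"
      unfolding Q_def cont[OF i, symmetric]
      by (simp add: SO3_orthogonal[OF ref_SO3[OF ei]] flip: matrix_mul_assoc)
    then show ?thesis
      using realizesD(3)[OF ei(1) real[OF ei(1)], of "(?x, t)"] ei t
      by (simp add: forces_def rect_def Rbar_def bdiag_mult_bdiag)
  qed
  then have "(\<Sum>i\<in>incident \<Gamma> n. end_sign \<Gamma> n i *\<^sub>R forces \<Gamma> i (p i) (R i) (end_pos \<Gamma> n i, t)) =
      bdiag Q Q *v (\<Sum>i\<in>incident \<Gamma> n. end_sign \<Gamma> n i *\<^sub>R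
        (Rbar \<Gamma> i (end_pos \<Gamma> n i) *v lower (y i (end_pos \<Gamma> n i, t))))"
    by (simp add: linear_sum[OF matrix_vector_mul_linear] matrix_vector_mult_scaleR)
  moreover have "f R n t = bdiag Q Q *v q n t"
    using neumann_multiple[OF n, of t R] t by (simp add: Let_def Q_def k_def xk_def)
  ultimately show ?thesis
    by (simp add: bdiag_SO3_cancel[OF Q])
qed

lemma neumann_iff:
  assumes n: "n \<in> neumann_nodes \<Gamma>" and t: "t \<in> {0<..<T}"
  defines "k \<equiv> first_edge \<Gamma> n"
  shows "end_sign \<Gamma> n k *\<^sub>R lower (y k (end_pos \<Gamma> n k, t)) = q n t \<longleftrightarrow>
    end_sign \<Gamma> n k *\<^sub>R forces \<Gamma> k (p k) (R k) (end_pos \<Gamma> n k, t) = f R n t"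
proof -
  let ?x = "end_pos \<Gamma> n k"
  have k: "k \<in> incident \<Gamma> n" using first_edge_incident[of n \<Gamma>] n by (simp add: k_def neumann_nodes_def)
  note ek = end_pos_in[OF k]
  have z: "(?x, t) \<in> rect \<Gamma> T k" using ek t by (simp add: rect_def)
  note D = realizesD[OF ek(1) real[OF ek(1)] z]
  show ?thesis
    using neumann_simple[OF n, of t R] t
    by (simp add: Let_def forces_def D(3) flip: k_def matrix_vector_mult_scaleR)
      (simp add: bdiag_SO3_cancel[OF D(1)])
qed

text \<open>By \<open>dirichlet_q\<close> the boundary datum, read as a curve of rigid motions, has
  velocity \<open>q\<close>; it is compared with the end of the beam, from which it starts by
  \<open>compat_dirichlet\<close>.\<close>

lemma dirichlet_iff:
  assumes n: "n \<in> dirichlet_nodes \<Gamma>"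
  defines "k \<equiv> first_edge \<Gamma> n"
  defines "xk \<equiv> end_pos \<Gamma> n k"
  shows "(\<forall>t\<in>{0<..<T}. upper (y k (xk, t)) = q n t) \<longleftrightarrow>
    (\<forall>t\<in>{0<..<T}. p k (xk, t) = fp n t \<and> R k (xk, t) = fR n t)"
proof -
  have k: "k \<in> incident \<Gamma> n"
    using first_edge_incident[of n \<Gamma>] dirichlet_simple[OF n] by (simp add: k_def)
  note ek = end_pos_in[OF k, folded xk_def]
  have reg: "C1_on {0..T} (fp n)" "C1_on {0..T} (fR n)" and SO: "\<And>t. t \<in> {0..T} \<Longrightarrow> fR n t \<in> SO3"
    using dirichlet_reg[OF n] C2_on_imp_C1_on by auto
  have V: "((\<lambda>t. (fp n t, fR n t)) has_vector_derivative act (fp n t, fR n t) (q n t)) (at t within {0..T})"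
    if t: "t \<in> {0..T}" for t
  proof -
    note d = C1_on_d_on(1)[OF reg(1) T t] C1_on_d_on(1)[OF reg(2) T t]
    have "act (fp n t, fR n t) (q n t) = (d_on T (fp n) t, d_on T (fR n) t)"
      using rotation_derivative[OF T t SO d(2)] SO3_transpose_mult[OF SO[OF t]]
      by (simp add: act_def dirichlet_q[OF n t])
    then show ?thesis
      using has_vector_derivative_Pair[OF d] by simp
  qed
  have "continuous_on {0..T} (\<lambda>t. upper (y k (xk, t)))"
    by (intro bounded_linear.continuous_on[OF bounded_linear_upper]
        realizes_continuous_trace[OF real[OF ek(1)] ek(2)])
  from act_curves_agree_iff[OF T this realizes_trace[OF ek(1) real[OF ek(1)] ek(2)] V]
  show ?thesis
    using compat_dirichlet[OF n] p_init[OF ek] R_init[OF ek] realizesD(1)[OF ek(1) real[OF ek(1)]] ek(2)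
    by (auto simp: Let_def k_def[symmetric] xk_def[symmetric] rect_def)
qed

text \<open>The stress half of \<open>y0\<close> involves only space derivatives at time 0, which
  are those of the initial shape, so it holds automatically; rotating the velocity half by
  \<open>R0\<close> gives the conditions on the time derivatives.\<close>

lemma initial_iff:
  assumes i: "i \<in> edges \<Gamma>" and x: "x \<in> {0..edge_len \<Gamma> i}"
  shows "y i (x, 0) = y0 i x \<longleftrightarrow>
    dt T (p i) (x, 0) = p1 i x \<and> R i (x, 0) *v angvel T (R i) (x, 0) = w0 i x"
proof -
  have z: "(x, 0) \<in> rect \<Gamma> T i" using x T by (simp add: rect_def)
  note D = realizesD[OF i real[OF i] z]
  note SO = R0_SO3[OF i x]
  have ang: "angvel T (R i) (x, 0) = lower (upper (y i (x, 0)))"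
    using D(2) by (metis lower_bvec vel_def)
  have "lower (y i (x, 0)) = lower (y0 i x)"
  proof -
    have "dx (edge_len \<Gamma> i) (p i) (x, 0) = d_on (edge_len \<Gamma> i) (p0 i) x"
      "dx (edge_len \<Gamma> i) (R i) (x, 0) = d_on (edge_len \<Gamma> i) (R0 i) x"
      unfolding dx_def prod.case by (rule d_on_cong[OF _ x], simp add: p_init[OF i] R_init[OF i])+
    then show ?thesis
      unfolding D(3)[symmetric] by (simp add: stress_def y0[OF i x] R_init[OF i x])
  qed
  then have "y i (x, 0) = y0 i x \<longleftrightarrow> upper (y i (x, 0)) = upper (y0 i x)"
    by (simp add: block_eq_iff[of "y i (x, 0)"])
  moreover have "a = transpose (R0 i x) *v b \<longleftrightarrow> R0 i x *v a = b" for a b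
    using SO3_transpose_mult[OF SO] by metis
  ultimately show ?thesis
    by (simp add: D(5) ang R_init[OF i x] y0[OF i x] block_eq_iff[of "upper (y i (x, 0))"])
qed

lemma solves_iff: "solves_intrinsic \<Gamma> T q y0 y \<longleftrightarrow> solves_geb \<Gamma> T f fp fR p0 R0 p1 w0 p R"
proof -
  \<comment> \<open>The clauses correspond one by one, but the force balances are equivalent only in
    the presence of continuity, hence the implication
    \<open>B3 \<Longrightarrow> A4 = B4\<close>.\<close>
  have combine: "(A1 \<and> A2 \<and> A3 \<and> A4 \<and> A5 \<and> A6 \<and> A7) = (B1 \<and> B2 \<and> B3 \<and> B4 \<and> B5 \<and> B6 \<and> B7)"
    if "A1" "B1" "A2 = B2" "A3 = B3" "B3 \<Longrightarrow> A4 = B4" "A5 = B5" "A6 = B6" "A7 = B7"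
    for A1 A2 A3 A4 A5 A6 A7 B1 B2 B3 B4 B5 B6 B7
    using that by blast
  show ?thesis
    unfolding solves_intrinsic_def solves_geb_def Let_def
  proof (rule combine, goal_cases)
    case 1 then show ?case using real by (auto simp: realizes_def)
  next
    case 2 then show ?case using real by (auto simp: realizes_def)
  next
    case 3 show ?case by (intro ball_cong refl realizes_pde_iff real) auto
  next
    case 4 show ?case by (intro ball_cong refl continuity_iff)
  next
    case 5
    then show ?case by (intro ball_cong refl balance_iff) auto
  next
    case 6 show ?case by (intro ball_cong refl neumann_iff)
  next
    case 7 show ?case by (intro ball_cong refl dirichlet_iff)
  next
    case 8 show ?case by (intro ball_cong refl) (simp add: initial_iff p_init R_init)
  qed
qed

end

text \<open>The lower six intrinsic equations are the integrability condition for velocity and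
  strain, and the stress half of \<open>y0\<close> says that the initial shape has the right strain;
  both feed \<open>rigid_motion_exists\<close>.\<close>

lemma realization_exists:
  assumes sol: "solves_intrinsic \<Gamma> T q y0 y" and i: "i \<in> edges \<Gamma>"
  shows "\<exists>p R. realizes i (y i) p R \<and>
    (\<forall>x\<in>{0..edge_len \<Gamma> i}. p (x, 0) = p0 i x \<and> R (x, 0) = R0 i x)"
proof -
  let ?l = "edge_len \<Gamma> i"
  note lp = len_pos[OF i]
  have y: "C1_on (rect \<Gamma> T i) (y i)" using sol i by (simp add: solves_intrinsic_def)
  obtain p R where pR: "C2_on (rect \<Gamma> T i) p" "C2_on (rect \<Gamma> T i) R" "\<And>z. z \<in> rect \<Gamma> T i \<Longrightarrow> R z \<in> SO3"
    "has_partials (rect \<Gamma> T i) (\<lambda>z. (p z, R z)) (\<lambda>z. act (p z, R z) (strain \<Gamma> i (y i) z))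
       (\<lambda>z. act (p z, R z) (upper (y i z)))"
    and init: "\<And>x. x \<in> {0..?l} \<Longrightarrow> p (x, 0) = p0 i x" "\<And>x. x \<in> {0..?l} \<Longrightarrow> R (x, 0) = R0 i x"
  proof (rule rigid_motion_exists[OF lp T, folded rect_def])
    show "C1_on (rect \<Gamma> T i) (\<lambda>z. upper (y i z))"
      by (rule C1_on_bounded_linear[OF bounded_linear_upper y])
    show "C1_on (rect \<Gamma> T i) (strain \<Gamma> i (y i))"
      by (rule C1_on_strain[OF i y])
    fix x t assume xt: "0 < x" "x < ?l" "0 < t" "t < T"
    then have x: "x \<in> {0..?l}" and t: "t \<in> {0..T}" by auto
    have "dx ?l (\<lambda>z. upper (y i z)) (x, t) = upper (dx ?l (y i) (x, t))"
      by (intro dx_eqI[OF _ lp x] bounded_linear.has_vector_derivative[OF bounded_linear_upper]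
          has_partials_slice(1)[OF C1_on_partials(1)[OF lp T y[unfolded rect_def]] x t])
    moreover have "dt T (y i) (x, t) + Amat \<Gamma> i x *v dx ?l (y i) (x, t) + Bmat \<Gamma> i x *v y i (x, t) =
        gfun \<Gamma> i x (y i (x, t))"
      using sol i xt by (simp add: solves_intrinsic_def)
    ultimately show "dt T (strain \<Gamma> i (y i)) (x, t) = dx ?l (\<lambda>z. upper (y i z)) (x, t) +
        bracket (strain \<Gamma> i (y i) (x, t)) (upper (y i (x, t)))"
      unfolding intrinsic_pde_iff[OF mass_spd[OF i x] flex_spd[OF i x]] dt_strain[OF i y x t]
      by (simp add: strain_def)
  next
    show "C1_on {0..?l} (p0 i)" "C1_on {0..?l} (R0 i)"
      using init_reg[OF i] C2_on_imp_C1_on by auto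
    fix x assume x: "x \<in> {0..?l}"
    show "R0 i x \<in> SO3" by (rule R0_SO3[OF i x])
    have "y i (x, 0) = y0 i x" using sol i x by (simp add: solves_intrinsic_def)
    then show "strain \<Gamma> i (y i) (x, 0) =
        bvec (transpose (R0 i x) *v d_on ?l (p0 i) x) (vee (transpose (R0 i x) ** d_on ?l (R0 i) x))"
      by (simp add: strain_def y0[OF i x] bvec_diff
          matrix_inv_mult_vector[OF spd_invertible[OF flex_spd[OF i x]]])
  qed blast
  have "realizes i (y i) p R"
    using y pR by (simp add: realizes_def image_subset_iff)
  then show ?thesis
    using init by blast
qed

lemma realization_unique:
  assumes i: "i \<in> edges \<Gamma>" and r: "realizes i y p R" and r': "realizes i y' p' R'"
    and eq: "\<And>z. z \<in> rect \<Gamma> T i \<Longrightarrow> y' z = y z"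
    and init: "\<And>x. x \<in> {0..edge_len \<Gamma> i} \<Longrightarrow> p' (x, 0) = p (x, 0) \<and> R' (x, 0) = R (x, 0)"
    and z: "z \<in> rect \<Gamma> T i"
  shows "p' z = p z \<and> R' z = R z"
proof -
  obtain x t where xt: "z = (x, t)" "x \<in> {0..edge_len \<Gamma> i}" "t \<in> {0..T}"
    using z by (auto simp: rect_def)
  have c: "continuous_on {0..T} (\<lambda>t. upper (y (x, t)))"
    by (intro bounded_linear.continuous_on[OF bounded_linear_upper] realizes_continuous_trace[OF r xt(2)])
  note d = realizes_trace[OF i r xt(2)] and d' = realizes_trace[OF i r' xt(2)]
  have at: "at s within {0..T} = at s" if "0 < s" "s < T" for s :: real
    using that by (simp add: at_within_Icc_at)
  have "(p' (x, t), R' (x, t)) = (p (x, t), R (x, t))"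
  proof (rule linear_ode_unique[OF bounded_bilinear_act c,
        where u = "\<lambda>t. (p' (x, t), R' (x, t))" and v = "\<lambda>t. (p (x, t), R (x, t))"])
    show "continuous_on {0..T} (\<lambda>t. (p' (x, t), R' (x, t)))" using d' by (rule continuous_on_vector_derivative)
    show "continuous_on {0..T} (\<lambda>t. (p (x, t), R (x, t)))" using d by (rule continuous_on_vector_derivative)
    fix s assume s: "0 < s" "s < T"
    show "((\<lambda>t. (p (x, t), R (x, t))) has_vector_derivative act (p (x, s), R (x, s)) (upper (y (x, s)))) (at s)"
      using d[of s] at[OF s] s by simp
    show "((\<lambda>t. (p' (x, t), R' (x, t))) has_vector_derivative act (p' (x, s), R' (x, s)) (upper (y (x, s)))) (at s)"
      using d'[of s] at[OF s] s eq[of "(x, s)"] xt by (simp add: rect_def)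
  qed (use init xt in auto)
  then show ?thesis by (simp add: xt)
qed

end

theorem theorem3p3p6:
  fixes N :: nat and \<Gamma> :: "'v beam_net" and T :: real
    and p0 p1 w0 :: "nat \<Rightarrow> real \<Rightarrow> real^3" and R0 :: "nat \<Rightarrow> real \<Rightarrow> real^3^3"
    and y0 :: "nat \<Rightarrow> real \<Rightarrow> vec12"
    and q :: "'v \<Rightarrow> real \<Rightarrow> vec6"
    and f :: "(nat \<Rightarrow> real \<times> real \<Rightarrow> real^3^3) \<Rightarrow> 'v \<Rightarrow> real \<Rightarrow> vec6"
    and fp :: "'v \<Rightarrow> real \<Rightarrow> real^3" and fR :: "'v \<Rightarrow> real \<Rightarrow> real^3^3"
    and y :: "nat \<Rightarrow> real \<times> real \<Rightarrow> vec12"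
  assumes network: "is_beam_network N \<Gamma>" and T: "0 < T"
    \<comment> \<open>(i)\<close>
    and params: "\<And>i. i \<in> edges \<Gamma> \<Longrightarrow>
      C1_on {0..edge_len \<Gamma> i} (mass_mat \<Gamma> i) \<and> mass_mat \<Gamma> i ` {0..edge_len \<Gamma> i} \<subseteq> spd \<and>
      C1_on {0..edge_len \<Gamma> i} (flex_mat \<Gamma> i) \<and> flex_mat \<Gamma> i ` {0..edge_len \<Gamma> i} \<subseteq> spd \<and>
      C2_on {0..edge_len \<Gamma> i} (ref_rot \<Gamma> i) \<and> ref_rot \<Gamma> i ` {0..edge_len \<Gamma> i} \<subseteq> SO3"
    and init_reg: "\<And>i. i \<in> edges \<Gamma> \<Longrightarrow>
      C2_on {0..edge_len \<Gamma> i} (p0 i) \<and>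
      C2_on {0..edge_len \<Gamma> i} (R0 i) \<and> R0 i ` {0..edge_len \<Gamma> i} \<subseteq> SO3 \<and>
      C1_on {0..edge_len \<Gamma> i} (p1 i) \<and> C1_on {0..edge_len \<Gamma> i} (w0 i)"
    and y0: "\<And>i x. i \<in> edges \<Gamma> \<Longrightarrow> x \<in> {0..edge_len \<Gamma> i} \<Longrightarrow>
      y0 i x =
        bvec (bvec (transpose (R0 i x) *v p1 i x) (transpose (R0 i x) *v w0 i x))
             (matrix_inv (flex_mat \<Gamma> i x) *v
                bvec (transpose (R0 i x) *v d_on (edge_len \<Gamma> i) (p0 i) x - e1)
                     (vee (transpose (R0 i x) ** d_on (edge_len \<Gamma> i) (R0 i) x) - ref_curv \<Gamma> i x))"
    \<comment> \<open>(ii)\<close>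
    and neumann_reg: "\<And>n. n \<in> multiple_nodes \<Gamma> \<union> neumann_nodes \<Gamma> \<Longrightarrow> C1_on {0..T} (q n)"
    and neumann_simple: "\<And>R n t. n \<in> neumann_nodes \<Gamma> \<Longrightarrow> t \<in> {0..T} \<Longrightarrow>
      f R n t =
        (let k = first_edge \<Gamma> n; xk = end_pos \<Gamma> n k
         in bdiag (R k (xk, t)) (R k (xk, t)) *v q n t)"
    and neumann_multiple: "\<And>R n t. n \<in> multiple_nodes \<Gamma> \<Longrightarrow> t \<in> {0..T} \<Longrightarrow>
      f R n t =
        (let k = first_edge \<Gamma> n; xk = end_pos \<Gamma> n k;
             S = R k (xk, t) ** transpose (ref_rot \<Gamma> k xk)
         in bdiag S S *v q n t)"
    \<comment> \<open>(iii)\<close>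
    and dirichlet_reg: "\<And>n. n \<in> dirichlet_nodes \<Gamma> \<Longrightarrow>
      C2_on {0..T} (fp n) \<and> C2_on {0..T} (fR n) \<and> fR n ` {0..T} \<subseteq> SO3"
    and dirichlet_q: "\<And>n t. n \<in> dirichlet_nodes \<Gamma> \<Longrightarrow> t \<in> {0..T} \<Longrightarrow>
      q n t = bvec (transpose (fR n t) *v d_on T (fp n) t)
                   (vee (transpose (fR n t) ** d_on T (fR n) t))"
    \<comment> \<open>(iv)\<close>
    and compat_dirichlet: "\<And>n. n \<in> dirichlet_nodes \<Gamma> \<Longrightarrow>
      (let k = first_edge \<Gamma> n; xk = end_pos \<Gamma> n k
       in fp n 0 = p0 k xk \<and> fR n 0 = R0 k xk)"
    and compat_multiple: "\<And>n i. n \<in> multiple_nodes \<Gamma> \<Longrightarrow> i \<in> incident \<Gamma> n \<Longrightarrow>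
      (let k = first_edge \<Gamma> n; xi = end_pos \<Gamma> n i; xk = end_pos \<Gamma> n k
       in p0 i xi = p0 k xk \<and>
          R0 i xi ** transpose (ref_rot \<Gamma> i xi) = R0 k xk ** transpose (ref_rot \<Gamma> k xk))"
    \<comment> \<open>\<open>y\<close> is the unique solution of the intrinsic system\<close>
    and sol: "solves_intrinsic \<Gamma> T q y0 y"
    and sol_unique: "\<And>y'. solves_intrinsic \<Gamma> T q y0 y' \<Longrightarrow>
      \<forall>i\<in>edges \<Gamma>. \<forall>z\<in>rect \<Gamma> T i. y' i z = y i z"
  shows "\<exists>p R. solves_geb \<Gamma> T f fp fR p0 R0 p1 w0 p R \<and>
    (\<forall>p' R'. solves_geb \<Gamma> T f fp fR p0 R0 p1 w0 p' R' \<longrightarrow>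
       (\<forall>i\<in>edges \<Gamma>. \<forall>z\<in>rect \<Gamma> T i. p' i z = p i z \<and> R' i z = R i z)) \<and>
    (\<forall>i\<in>edges \<Gamma>. \<forall>z\<in>rect \<Gamma> T i. y i z = Tnet \<Gamma> T p R i z)"
proof -
  interpret beam_data N \<Gamma> T p0 p1 w0 R0 y0 q f fp fR
    by unfold_locales (fact assms)+
  have "\<forall>i\<in>edges \<Gamma>. \<exists>p R. realizes i (y i) p R \<and>
      (\<forall>x\<in>{0..edge_len \<Gamma> i}. p (x, 0) = p0 i x \<and> R (x, 0) = R0 i x)"
    using realization_exists[OF sol] by blast
  then obtain p R where real: "\<And>i. i \<in> edges \<Gamma> \<Longrightarrow> realizes i (y i) (p i) (R i)"
    and init: "\<And>i x. i \<in> edges \<Gamma> \<Longrightarrow> x \<in> {0..edge_len \<Gamma> i} \<Longrightarrow> p i (x, 0) = p0 i x \<and> R i (x, 0) = R0 i x"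
    by metis
  \<comment> \<open>The node conditions, not imposed in the construction edge by edge, are recovered
    here through the equivalence of the systems.\<close>
  have geb: "solves_geb \<Gamma> T f fp fR p0 R0 p1 w0 p R"
    using solves_iff[of y p R] real init sol by blast
  have Tnet: "y i z = Tnet \<Gamma> T p R i z" if "i \<in> edges \<Gamma>" "z \<in> rect \<Gamma> T i" for i z
    using realizesD(2,3)[OF that(1) real[OF that(1)] that(2)] by (simp add: Tnet_def)
  have unique: "p' i z = p i z \<and> R' i z = R i z"
    if geb': "solves_geb \<Gamma> T f fp fR p0 R0 p1 w0 p' R'" and i: "i \<in> edges \<Gamma>" and z: "z \<in> rect \<Gamma> T i"
    for p' R' i z
  proof -
    have real': "realizes i (Tnet \<Gamma> T p' R' i) (p' i) (R' i)" if i: "i \<in> edges \<Gamma>" for i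
    proof -
      have "C2_on (rect \<Gamma> T i) (p' i)" "C2_on (rect \<Gamma> T i) (R' i)" "R' i ` rect \<Gamma> T i \<subseteq> SO3"
        using geb' i by (simp_all add: solves_geb_def)
      from realizesI[OF i this] show ?thesis by (simp add: Tnet_def[abs_def])
    qed
    have init': "p' i (x, 0) = p0 i x \<and> R' i (x, 0) = R0 i x" if "i \<in> edges \<Gamma>" "x \<in> {0..edge_len \<Gamma> i}" for i x
      using geb' that by (simp add: solves_geb_def)
    \<comment> \<open>The load \<open>f\<close>, evaluated at the competitor's own rotations, pulls
      back to the same \<open>q\<close>, so the transform solves the intrinsic system with unchanged
      data.\<close>
    have "solves_intrinsic \<Gamma> T q y0 (Tnet \<Gamma> T p' R')"
      using solves_iff[of "Tnet \<Gamma> T p' R'" p' R'] real' init' geb' by blast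
    then have "\<And>z. z \<in> rect \<Gamma> T i \<Longrightarrow> Tnet \<Gamma> T p' R' i z = y i z"
      using sol_unique i by blast
    then show ?thesis
      by (rule realization_unique[OF i real[OF i] real'[OF i]]) (use init init' i z in auto)
  qed
  show ?thesis
    using geb Tnet unique by blast
qed

end
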